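(* Assume the Riemann hypothesis. Let $r\ge 2$ be an integer and suppose that $\theta_r$ and $\theta'_r$ are constants such that $$\Delta(1,r;x)\ll x^{\theta_r}\log^{\theta'_r}x \qquad (x\to\infty)$$ and $\theta_r<\frac{1}{2r}$. Then for every $\varepsilon>0$, as $x\to\infty$, $$\mathcal{E}_r(x) = O\left(x^{\alpha+\varepsilon}\right), \qquad \alpha = \frac{1-\theta_r}{2r+1-4r\theta_r}.$$
   Context: For an integer $r\ge 0$, $\tau^{(r)}$ is the multiplicative arithmetic function with $\tau^{(r)}(p^a)=1$ for $a\le r$ and $\tau^{(r)}(p^a)=2$ for $a>r$ ($p$ prime, $a\ge 1$). For an integer $r\ge 2$, the error term $\mathcal{E}_r(x)$ is defined by $$\sum_{n\leqslant x}\tau^{(r-1)}(n) = \frac{\zeta(r)}{\zeta(2r)}x + \frac{\zeta(1/r)}{\zeta(2)}x^{1/r} + \mathcal{E}_r(x).$$ (Note the shift of index: $\mathcal{E}_r$ corresponds to $\tau^{(r-1)}$.) For an integer $b\ge 2$, let $T(1,b;x)=\#\{(k,l)\in\mathbb{N}^2 : k l^b\le x\}$ and $$\Delta(1,b;x) = T(1,b;x) - \zeta(b)x - \zeta(1/b)x^{1/b},$$ where $\zeta$ is the Riemann zeta-function (analytically continued). *)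

theory Defs
  imports
    "HOL-Complex_Analysis.Complex_Analysis"
    "HOL-Computational_Algebra.Primes"
    "HOL-Library.Landau_Symbols"
begin

section \<open>The Riemann zeta-function\<close>

text \<open>
  The analytic continuation of the Dirichlet series to the punctured plane. The pole at \<open>1\<close> gets the
  dummy value \<open>0\<close>, which makes the function unique; \<open>zeta_unique_continuation\<close> below shows that
  it exists.
\<close>

definition is_zeta_continuation :: "(complex \<Rightarrow> complex) \<Rightarrow> bool" where
  "is_zeta_continuation f \<longleftrightarrow>
     f holomorphic_on (- {1}) \<and>
     (\<forall>s. Re s > 1 \<longrightarrow> (\<lambda>n. of_nat (Suc n) powr (- s)) sums f s) \<and>
     f 1 = 0"

definition zeta :: "complex \<Rightarrow> complex" where
  "zeta = (THE f. is_zeta_continuation f)"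

definition riemann_hypothesis :: bool where
  "riemann_hypothesis \<longleftrightarrow> (\<forall>s. zeta s = 0 \<and> 0 < Re s \<and> Re s < 1 \<longrightarrow> Re s = 1 / 2)"

text \<open>
  The zeta-function is real on the real axis (\<open>of_real_zeta_real\<close>), so taking the real part loses
  nothing.
\<close>

definition zeta_real :: "real \<Rightarrow> real" where
  "zeta_real x = Re (zeta (complex_of_real x))"


section \<open>The counting functions and their error terms\<close>

definition tau :: "nat \<Rightarrow> nat \<Rightarrow> nat" where
  "tau r n = (\<Prod>p\<in>prime_factors n. if multiplicity p n \<le> r then 1 else 2)"

definition err :: "nat \<Rightarrow> real \<Rightarrow> real" where
  "err r x = (\<Sum>n | n \<ge> 1 \<and> real n \<le> x. real (tau (r - 1) n))
     - zeta_real (real r) / zeta_real (real (2 * r)) * x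
     - zeta_real (1 / real r) / zeta_real 2 * x powr (1 / real r)"

text \<open>For \<open>b \<ge> 1\<close> the set of pairs is finite (\<open>finite_T1_pairs\<close>), so \<open>card\<close> has its usual meaning.\<close>

definition T1 :: "nat \<Rightarrow> real \<Rightarrow> nat" where
  "T1 b x = card {(k :: nat, l :: nat). k \<ge> 1 \<and> l \<ge> 1 \<and> real (k * l ^ b) \<le> x}"

definition Delta1 :: "nat \<Rightarrow> real \<Rightarrow> real" where
  "Delta1 b x = real (T1 b x) - zeta_real (real b) * x
     - zeta_real (1 / real b) * x powr (1 / real b)"


lemma finite_T1_pairs:
  assumes "b \<ge> 1"
  shows "finite {(k :: nat, l :: nat). k \<ge> 1 \<and> l \<ge> 1 \<and> real (k * l ^ b) \<le> x}"
proof (rule finite_subset)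
  show "{(k :: nat, l :: nat). k \<ge> 1 \<and> l \<ge> 1 \<and> real (k * l ^ b) \<le> x} \<subseteq>
          {..nat \<lfloor>x\<rfloor>} \<times> {..nat \<lfloor>x\<rfloor>}"
  proof
    fix z assume "z \<in> {(k :: nat, l :: nat). k \<ge> 1 \<and> l \<ge> 1 \<and> real (k * l ^ b) \<le> x}"
    then obtain k l where z: "z = (k, l)" and kl: "k \<ge> 1" "l \<ge> 1" "real (k * l ^ b) \<le> x"
      by blast
    have "k * 1 \<le> k * l ^ b" "1 * l \<le> k * l ^ b"
      using kl assms by (intro mult_le_mono self_le_power; simp)+
    hence "k \<le> k * l ^ b" "l \<le> k * l ^ b" by (simp_all only: mult_1 mult_1_right)
    moreover have "k * l ^ b \<le> nat \<lfloor>x\<rfloor>" using kl(3) by (rule le_nat_floor)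
    ultimately show "z \<in> {..nat \<lfloor>x\<rfloor>} \<times> {..nat \<lfloor>x\<rfloor>}"
      unfolding z mem_Times_iff atMost_iff fst_conv snd_conv by (blast intro: le_trans)
  qed
qed simp


section \<open>The arithmetic function is multiplicative with the prescribed values\<close>

lemma tau_1: "tau r 1 = 1"
  by (simp add: tau_def)

lemma tau_prime_power:
  assumes "prime p" "a \<ge> 1"
  shows "tau r (p ^ a) = (if a \<le> r then 1 else 2)"
  using assms by (simp add: tau_def prime_factorization_prime_power)

lemma tau_mult_coprime:
  assumes "coprime m n" "m > 0" "n > 0"
  shows "tau r (m * n) = tau r m * tau r n"
proof -
  let ?g = "\<lambda>k p. if multiplicity p k \<le> r then 1 else (2::nat)"
  have disj: "prime_factors m \<inter> prime_factors n = {}"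
    using assms(1) by (metis coprime_common_divisor disjoint_iff in_prime_factors_imp_dvd
      in_prime_factors_imp_prime not_prime_unit)
  have 1: "multiplicity p (m * n) = multiplicity p m" if "p \<in> prime_factors m" for p
  proof -
    have "\<not> p dvd n" "prime p" using that disj assms by (auto simp: prime_factors_dvd)
    thus ?thesis using assms
      by (simp add: prime_elem_multiplicity_mult_distrib not_dvd_imp_multiplicity_0)
  qed
  have 2: "multiplicity p (m * n) = multiplicity p n" if "p \<in> prime_factors n" for p
  proof -
    have "\<not> p dvd m" "prime p" using that disj assms by (auto simp: prime_factors_dvd)
    thus ?thesis using assms
      by (simp add: prime_elem_multiplicity_mult_distrib not_dvd_imp_multiplicity_0)
  qed
  have "prime_factors (m * n) = prime_factors m \<union> prime_factors n"
    using assms by (simp add: prime_factors_product)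
  hence "tau r (m * n) = (\<Prod>p\<in>prime_factors m \<union> prime_factors n. ?g (m * n) p)"
    by (simp add: tau_def)
  also have "\<dots> = (\<Prod>p\<in>prime_factors m. ?g (m * n) p) * (\<Prod>p\<in>prime_factors n. ?g (m * n) p)"
    using disj by (intro prod.union_disjoint) auto
  also have "\<dots> = tau r m * tau r n"
    unfolding tau_def using 1 2 by (intro arg_cong2[of _ _ _ _ "(*)"] prod.cong) auto
  finally show ?thesis .
qed


section \<open>Existence and uniqueness of the continuation\<close>

lemma holomorphic_suminf_powr_bound:
  fixes f :: "nat \<Rightarrow> complex \<Rightarrow> complex"
  assumes hol: "\<And>n. f n holomorphic_on {s. Re s > c}"
    and bd: "\<And>a A. a > c \<Longrightarrow> \<exists>C p. p > 1 \<and>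
      (\<forall>s n. a \<le> Re s \<longrightarrow> norm s \<le> A \<longrightarrow> norm (f n s) \<le> C * real (Suc n) powr (- p))"
  shows "(\<lambda>s. \<Sum>n. f n s) holomorphic_on {s. Re s > c}"
    and "\<And>s. Re s > c \<Longrightarrow> summable (\<lambda>n. f n s)"
proof -
  have sm: "summable (\<lambda>n. C * real (Suc n) powr (- p))" if "p > 1" for C p
    using that summable_Suc_iff[of "\<lambda>n. real n powr (- p)"]
    by (intro summable_mult) (simp add: summable_real_powr_iff del: of_nat_Suc)
  show "summable (\<lambda>n. f n s)" if "Re s > c" for s
  proof -
    from bd[OF that, of "norm s"] obtain C p where p: "p > 1"
      "\<And>n. norm (f n s) \<le> C * real (Suc n) powr (- p)" by blast
    show ?thesis by (rule summable_comparison_test'[OF sm[OF p(1)] p(2)])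
  qed
  show "(\<lambda>s. \<Sum>n. f n s) holomorphic_on {s. Re s > c}"
  proof (rule holomorphic_uniform_sequence)
    show "open {s. Re s > c}" by (simp add: open_halfspace_Re_gt)
    show "(\<lambda>s. \<Sum>i<n. f i s) holomorphic_on {s. Re s > c}" for n
      using hol by (intro holomorphic_intros)
    fix s assume "s \<in> {s. Re s > c}"
    hence s: "Re s > c" by simp
    define d where "d = (Re s - c) / 2"
    have d: "d > 0" using s by (simp add: d_def)
    have re: "Re z \<ge> (Re s + c) / 2" and nz: "norm z \<le> norm s + d" if "z \<in> cball s d" for z
    proof -
      have "norm (s - z) \<le> d" using that by (simp add: dist_norm)
      moreover have "\<bar>Re (s - z)\<bar> \<le> norm (s - z)" by (rule abs_Re_le_cmod)
      ultimately show "Re z \<ge> (Re s + c) / 2" by (simp add: d_def field_simps)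
      show "norm z \<le> norm s + d"
        using \<open>norm (s - z) \<le> d\<close> norm_triangle_ineq2[of z s] by (simp add: norm_minus_commute)
    qed
    have "(Re s + c) / 2 > c" using s by simp
    from bd[OF this, of "norm s + d"] obtain C p where p: "p > 1"
      "\<And>z n. (Re s + c) / 2 \<le> Re z \<Longrightarrow> norm z \<le> norm s + d \<Longrightarrow>
         norm (f n z) \<le> C * real (Suc n) powr (- p)" by blast
    have "uniform_limit (cball s d) (\<lambda>n z. \<Sum>i<n. f i z) (\<lambda>z. \<Sum>i. f i z) sequentially"
      by (rule Weierstrass_m_test[OF _ sm[OF p(1)]]) (use re nz p(2) in blast)
    moreover have "cball s d \<subseteq> {s. Re s > c}"
      using re \<open>(Re s + c) / 2 > c\<close> by force
    ultimately show "\<exists>d>0. cball s d \<subseteq> {s. Re s > c} \<and>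
        uniform_limit (cball s d) (\<lambda>n z. \<Sum>i<n. f i z) (\<lambda>z. \<Sum>i. f i z) sequentially"
      using d by blast
  qed
qed

definition zeta_series :: "complex \<Rightarrow> complex" where
  "zeta_series s = (\<Sum>n. of_nat (Suc n) powr (- s))"

lemma norm_nat_powr: "norm (of_nat (Suc n) powr s :: complex) = real (Suc n) powr Re s"
  using norm_powr_real_powr[of "of_nat (Suc n)" s] by simp

lemma zeta_series:
  shows holomorphic_zeta_series: "zeta_series holomorphic_on {s. Re s > 1}"
    and sums_zeta_series: "Re s > 1 \<Longrightarrow> (\<lambda>n. of_nat (Suc n) powr (- s)) sums zeta_series s"
proof -
  let ?f = "\<lambda>n s. of_nat (Suc n) powr (- s) :: complex"
  have hol: "?f n holomorphic_on {s. Re s > 1}" for n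
    by (intro holomorphic_intros) (simp del: of_nat_Suc)
  have bd: "\<exists>C p. p > 1 \<and>
      (\<forall>s n. a \<le> Re s \<longrightarrow> norm s \<le> A \<longrightarrow> norm (?f n s) \<le> C * real (Suc n) powr (- p))"
    if "a > 1" for a A :: real
    unfolding norm_nat_powr using that
    by (intro exI[of _ 1] exI[of _ a]) (auto intro!: powr_mono simp del: of_nat_Suc)
  show "zeta_series holomorphic_on {s. Re s > 1}"
    unfolding zeta_series_def by (rule holomorphic_suminf_powr_bound(1)[OF hol bd])
  show "Re s > 1 \<Longrightarrow> (\<lambda>n. of_nat (Suc n) powr (- s)) sums zeta_series s"
    unfolding zeta_series_def using holomorphic_suminf_powr_bound(2)[OF hol bd] by (rule summable_sums)
qed

lemma holomorphic_gbinomial [holomorphic_intros]: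
  "f holomorphic_on A \<Longrightarrow> (\<lambda>s. f s gchoose k :: complex) holomorphic_on A"
  unfolding gbinomial_prod_rev by (intro holomorphic_intros) auto

text \<open>
  Expanding \<open>(m + 1)\<^bsup>1-s\<^esup>\<close> around \<open>m\<close> up to order \<open>M\<close> leaves a remainder that is summable over \<open>m\<close>
  for \<open>Re s > 1 - M\<close>.
\<close>

definition taylor_rem :: "nat \<Rightarrow> nat \<Rightarrow> complex \<Rightarrow> complex" where
  "taylor_rem M n s = of_nat (Suc (Suc n)) powr (1 - s)
     - (\<Sum>j\<le>M. ((1 - s) gchoose j) * of_nat (Suc n) powr (1 - s - of_nat j))"

lemma taylor_rem_bound:
  assumes "a > 1 - real M"
  shows "\<exists>C p. p > 1 \<and>
      (\<forall>s n. a \<le> Re s \<longrightarrow> norm s \<le> A \<longrightarrow> norm (taylor_rem M n s) \<le> C * real (Suc n) powr (- p))"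
proof -
  have "continuous_on (cball 0 A) (\<lambda>s::complex. (1 - s) gchoose Suc M)"
    by (intro holomorphic_on_imp_continuous_on holomorphic_intros)
  hence "bounded ((\<lambda>s::complex. (1 - s) gchoose Suc M) ` cball 0 A)"
    by (intro compact_imp_bounded compact_continuous_image) auto
  then obtain K where K: "K > 0" "\<And>s. norm s \<le> A \<Longrightarrow> norm ((1 - s) gchoose Suc M :: complex) \<le> K"
    unfolding bounded_pos by auto
  have *: "norm (taylor_rem M n s) \<le> (real (Suc M) * K) * real (Suc n) powr (- (a + real M))"
    if s: "a \<le> Re s" "norm s \<le> A" for s n
  proof -
    define f :: "nat \<Rightarrow> complex \<Rightarrow> complex" where
      "f = (\<lambda>i z. fact i * ((1 - s) gchoose i) * z powr (1 - s - of_nat i))"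
    define S where "S = {z. Im z = 0 \<and> Re z \<ge> real (Suc n)}"
    have "convex S"
      unfolding S_def convex_def
    proof safe
      fix x y :: complex and u v :: real
      assume *: "Re x \<ge> real (Suc n)" "Re y \<ge> real (Suc n)" "0 \<le> u" "0 \<le> v" "u + v = 1"
      have "real (Suc n) = u * real (Suc n) + v * real (Suc n)"
        using * by (metis distrib_right mult_1)
      also have "\<dots> \<le> u * Re x + v * Re y" using * by (intro add_mono mult_left_mono)
      finally show "real (Suc n) \<le> Re (u *\<^sub>R x + v *\<^sub>R y)" by simp
    qed auto
    have "norm (f 0 (of_nat (Suc (Suc n))) -
        (\<Sum>i\<le>M. f i (of_nat (Suc n)) * (of_nat (Suc (Suc n)) - of_nat (Suc n)) ^ i / fact i))
      \<le> (fact (Suc M) * K * real (Suc n) powr (- (a + real M))) *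
        norm (of_nat (Suc (Suc n)) - of_nat (Suc n) :: complex) ^ Suc M / fact M"
    proof (rule field_Taylor[OF \<open>convex S\<close>])
      show "of_nat (Suc n) \<in> S" "of_nat (Suc (Suc n)) \<in> S"
        by (auto simp: S_def)
    next
      fix i x assume "x \<in> S"
      hence x: "x \<notin> \<real>\<^sub>\<le>\<^sub>0"
        by (auto simp: S_def complex_nonpos_Reals_iff)
      have "fact (Suc i) * ((1 - s) gchoose Suc i) =
            fact i * ((1 - s) gchoose i) * (1 - s - of_nat i)"
        unfolding gbinomial_mult_fact by simp
      moreover have "((\<lambda>z. fact i * ((1 - s) gchoose i) * z powr (1 - s - of_nat i))
          has_field_derivative fact i * ((1 - s) gchoose i) *
            ((1 - s - of_nat i) * x powr (1 - s - of_nat i - 1))) (at x within S)"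
        by (intro DERIV_cmult DERIV_subset[OF has_field_derivative_powr[OF x]]) auto
      moreover have "1 - s - of_nat i - 1 = 1 - s - of_nat (Suc i)" by simp
      ultimately show "(f i has_field_derivative f (Suc i) x) (at x within S)"
        unfolding f_def by (simp only: mult.assoc)
    next
      fix x assume "x \<in> S"
      hence x: "x \<in> \<real>" "Re x \<ge> real (Suc n)" by (auto simp: S_def complex_is_Real_iff)
      have "norm (x powr (1 - s - of_nat (Suc M))) = Re x powr (- (Re s + real M))"
        using x by (subst norm_powr_real_powr) auto
      also have "\<dots> \<le> real (Suc n) powr (- (Re s + real M))"
        using x s assms by (intro powr_mono2') auto
      also have "\<dots> \<le> real (Suc n) powr (- (a + real M))"
        using s by (intro powr_mono) auto
      finally show "norm (f (Suc M) x) \<le> fact (Suc M) * K * real (Suc n) powr (- (a + real M))"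
        using K(2)[OF s(2)] K(1) unfolding f_def norm_mult
        by (intro mult_mono mult_nonneg_nonneg) (auto simp: norm_fact simp del: fact_Suc)
    qed
    moreover have "f 0 (of_nat (Suc (Suc n))) -
        (\<Sum>i\<le>M. f i (of_nat (Suc n)) * (of_nat (Suc (Suc n)) - of_nat (Suc n)) ^ i / fact i)
        = taylor_rem M n s"
      by (simp add: f_def taylor_rem_def)
    moreover have "of_nat (Suc (Suc n)) - of_nat (Suc n) = (1 :: complex)"
      by simp
    ultimately show ?thesis
      by (simp add: mult.assoc del: of_nat_Suc)
  qed
  show ?thesis
    using * assms by (intro exI[of _ "real (Suc M) * K"] exI[of _ "a + real M"]) auto
qed

lemma holomorphic_taylor_rem: "taylor_rem M n holomorphic_on A"
  unfolding taylor_rem_def by (intro holomorphic_intros) (auto simp del: of_nat_Suc)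

lemma sum_taylor_rem:
  assumes "Re s > 1"
  shows "(\<Sum>n. taylor_rem (Suc M) n s) = (s - 1) * zeta_series s - 1
           - (\<Sum>j=2..Suc M. ((1 - s) gchoose j) * zeta_series (s + of_nat j - 1))"
proof -
  have "(\<lambda>n. real (Suc n) powr (1 - Re s)) \<longlonglongrightarrow> 0"
    using assms by real_asymp
  hence "(\<lambda>n. of_nat (Suc n) powr (1 - s) :: complex) \<longlonglongrightarrow> 0"
    by (subst tendsto_norm_zero_iff [symmetric], subst norm_nat_powr) simp
  from telescope_sums[OF this]
  have 1: "(\<lambda>n. of_nat (Suc (Suc n)) powr (1 - s) - of_nat (Suc n) powr (1 - s)) sums (- 1 :: complex)"
    by simp
  have 2: "(\<lambda>n. ((1 - s) gchoose j) * of_nat (Suc n) powr (1 - s - of_nat j)) sums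
              (((1 - s) gchoose j) * zeta_series (s + of_nat j - 1))" if "j \<ge> 1" for j
    using sums_mult[OF sums_zeta_series[of "s + of_nat j - 1"], of "(1 - s) gchoose j"] assms that
    by (simp add: algebra_simps)
  have "(\<lambda>n. (of_nat (Suc (Suc n)) powr (1 - s) - of_nat (Suc n) powr (1 - s))
     - (\<Sum>j=1..Suc M. ((1 - s) gchoose j) * of_nat (Suc n) powr (1 - s - of_nat j))) sums
     (-1 - (\<Sum>j=1..Suc M. ((1 - s) gchoose j) * zeta_series (s + of_nat j - 1)))"
    by (intro sums_diff sums_sum 1 2) auto
  also have "(\<lambda>n. (of_nat (Suc (Suc n)) powr (1 - s) - of_nat (Suc n) powr (1 - s))
     - (\<Sum>j=1..Suc M. ((1 - s) gchoose j) * of_nat (Suc n) powr (1 - s - of_nat j))) =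
     (\<lambda>n. taylor_rem (Suc M) n s)"
    unfolding taylor_rem_def atMost_atLeast0
    by (simp add: sum.atLeast_Suc_atMost[of 0] diff_diff_eq del: sum.cl_ivl_Suc of_nat_Suc)
  finally have "(\<Sum>n. taylor_rem (Suc M) n s) = 
      -1 - (\<Sum>j=1..Suc M. ((1 - s) gchoose j) * zeta_series (s + of_nat j - 1))"
    by (simp add: sums_iff)
  also have "(\<Sum>j=1..Suc M. ((1 - s) gchoose j) * zeta_series (s + of_nat j - 1)) =
      (1 - s) * zeta_series s + (\<Sum>j=2..Suc M. ((1 - s) gchoose j) * zeta_series (s + of_nat j - 1))"
    by (subst sum.atLeast_Suc_atMost) (simp_all add: numeral_2_eq_2 del: sum.cl_ivl_Suc)
  finally show ?thesis by (simp add: algebra_simps)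
qed

lemma continuation_step:
  "\<exists>h. h holomorphic_on {s. Re s > 1 - real N} \<and> (\<forall>s. Re s > 1 \<longrightarrow> h s = (s - 1) * zeta_series s)"
proof (induction N)
  case 0
  show ?case
    by (rule exI[of _ "\<lambda>s. (s - 1) * zeta_series s"]) (auto intro!: holomorphic_intros holomorphic_zeta_series)
next
  case (Suc N)
  then obtain h where h: "h holomorphic_on {s. Re s > 1 - real N}"
    "\<And>s. Re s > 1 \<Longrightarrow> h s = (s - 1) * zeta_series s" by blast
  define q :: "nat \<Rightarrow> complex \<Rightarrow> complex" where
    "q = (\<lambda>j s. - (\<Prod>i = 0..<j-1. 1 - s - of_nat i) / fact j)"
  have q: "q j s * (s + of_nat j - 2) = (1 - s) gchoose j" if j2: "j \<ge> 2" for j s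
  proof -
    obtain k where j: "j = Suc k" using j2 not0_implies_Suc[of j] by auto
    have "((1 - s) gchoose j) = (\<Prod>i = 0..<k. 1 - s - of_nat i) * (1 - s - of_nat k) / fact j"
      by (simp add: gbinomial_prod_rev j)
    moreover have "1 - s - of_nat k = - (s + of_nat j - 2)" by (simp add: j)
    ultimately have "((1 - s) gchoose j) =
        (\<Prod>i = 0..<k. 1 - s - of_nat i) * - (s + of_nat j - 2) / fact j" by metis
    thus ?thesis unfolding q_def j diff_Suc_1
      by (simp only: mult_minus_right mult_minus_left minus_divide_left times_divide_eq_left)
  qed
  define g where "g = (\<lambda>s. 1 + (\<Sum>n. taylor_rem (Suc N) n s) + (\<Sum>j=2..Suc N. q j s * h (s + of_nat j - 1)))"
  have "(\<lambda>s. \<Sum>n. taylor_rem (Suc N) n s) holomorphic_on {s. Re s > 1 - real (Suc N)}"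
    by (rule holomorphic_suminf_powr_bound(1)[OF holomorphic_taylor_rem taylor_rem_bound])
  moreover have "(\<lambda>s. h (s + of_nat j - 1)) holomorphic_on {s. Re s > 1 - real (Suc N)}" if "j \<ge> 2" for j
    using that by (intro holomorphic_on_compose_gen[of "\<lambda>s. s + of_nat j - 1" _ h, unfolded o_def, OF _ h(1)] holomorphic_intros) auto
  moreover have "q j holomorphic_on {s. Re s > 1 - real (Suc N)}" for j
    unfolding q_def by (intro holomorphic_intros) auto
  ultimately have "g holomorphic_on {s. Re s > 1 - real (Suc N)}"
    unfolding g_def by (intro holomorphic_intros) auto
  moreover have "g s = (s - 1) * zeta_series s" if "Re s > 1" for s
  proof -
    have "q j s * h (s + of_nat j - 1) = ((1 - s) gchoose j) * zeta_series (s + of_nat j - 1)"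
      if "j \<in> {2..Suc N}" for j
      using that \<open>Re s > 1\<close> by (subst h(2)) (auto simp flip: q simp: algebra_simps)
    thus ?thesis unfolding g_def sum_taylor_rem[OF that] by simp
  qed
  ultimately show ?case by blast
qed

lemma zeta_continuation_unique:
  assumes "is_zeta_continuation f" "is_zeta_continuation g"
  shows "f = g"
proof
  fix w
  show "f w = g w"
  proof (cases "w = 1")
    case False
    show ?thesis
    proof (rule analytic_continuation_open[where f = f and g = g])
      show "open {s. Re s > 1}" by (simp add: open_halfspace_Re_gt)
      show "{s. Re s > 1} \<noteq> {}" by (auto intro!: exI[of _ 2])
      show "connected (- {1::complex})" by (intro connected_punctured_universe) simp
      show "f z = g z" if "z \<in> {s. Re s > 1}" for z
        using that assms unfolding is_zeta_continuation_def by (metis mem_Collect_eq sums_unique2)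
    qed (use assms False in \<open>auto simp: is_zeta_continuation_def\<close>)
  qed (use assms in \<open>auto simp: is_zeta_continuation_def\<close>)
qed

lemma zeta_unique_continuation: "\<exists>!f. is_zeta_continuation f"
proof -
  obtain h where h: "\<And>N. h N holomorphic_on {s. Re s > 1 - real N}"
    "\<And>N s. Re s > 1 \<Longrightarrow> h N s = (s - 1) * zeta_series s"
    using continuation_step by metis
  have eq: "h M s = h N s" if "Re s > 1 - real M" "Re s > 1 - real N" "M \<le> N" for M N s
  proof (rule analytic_continuation_open[where f = "h M" and g = "h N"])
    show "open {s. Re s > 1}" "open {s. Re s > 1 - real M}" by (auto simp: open_halfspace_Re_gt)
    show "{s. Re s > 1} \<noteq> {}" by (auto intro!: exI[of _ 2])
    show "connected {s. Re s > 1 - real M}"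
      by (intro convex_connected convex_halfspace_Re_gt)
    show "h N holomorphic_on {s. Re s > 1 - real M}"
      using \<open>M \<le> N\<close> by (intro holomorphic_on_subset[OF h(1)[of N]]) auto
  qed (use h that in auto)
  define H where "H = (\<lambda>s. h (nat \<lceil>2 - Re s\<rceil>) s)"
  have dom: "Re s > 1 - real (nat \<lceil>2 - Re s\<rceil>)" for s
    by linarith
  have H: "H s = h N s" if "Re s > 1 - real N" for N s
    using eq[OF that dom] eq[OF dom that] unfolding H_def by (metis nat_le_linear)
  have "H holomorphic_on UNIV"
  proof (unfold holomorphic_on_def, safe)
    fix s
    define N where "N = nat \<lceil>2 - Re s\<rceil>"
    have "H holomorphic_on {s. Re s > 1 - real N}"
      using h(1)[of N] by (rule holomorphic_transform) (simp add: H)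
    moreover have "s \<in> {s. Re s > 1 - real N}" using dom by (simp add: N_def)
    ultimately show "H field_differentiable at s"
      by (intro holomorphic_on_imp_differentiable_at[of _ "{s. Re s > 1 - real N}"])
        (auto simp: open_halfspace_Re_gt)
  qed
  hence "(\<lambda>s. H s / (s - 1)) holomorphic_on (- {1})"
    by (intro holomorphic_intros) (auto intro: holomorphic_on_subset)
  moreover have "(\<lambda>n. of_nat (Suc n) powr (- s)) sums (H s / (s - 1))" if "Re s > 1" for s
  proof -
    have "H s = (s - 1) * zeta_series s" "s \<noteq> 1"
      using that H[of 0 s] h(2)[of s 0] by auto
    thus ?thesis using sums_zeta_series[OF that] by simp
  qed
  ultimately have "is_zeta_continuation (\<lambda>s. H s / (s - 1))"
    unfolding is_zeta_continuation_def by simp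
  thus ?thesis using zeta_continuation_unique by blast
qed

lemma is_zeta_continuation_zeta: "is_zeta_continuation zeta"
  unfolding zeta_def by (rule theI'[OF zeta_unique_continuation])

lemma cnj_zeta: "cnj (zeta (cnj s)) = zeta s"
proof -
  note z = is_zeta_continuation_zeta[unfolded is_zeta_continuation_def]
  have "is_zeta_continuation (cnj \<circ> zeta \<circ> cnj)"
    unfolding is_zeta_continuation_def
  proof (intro conjI allI impI)
    have "x \<in> cnj ` (- {1})" if "x \<noteq> 1" for x
      by (rule image_eqI[of _ _ "cnj x"]) (use that in auto)
    hence "cnj ` (- {1}) = - {1}" by auto
    thus "(cnj \<circ> zeta \<circ> cnj) holomorphic_on (- {1})"
      using z by (intro holomorphic_on_compose_cnj_cnj) (auto simp: open_delete)
    show "(cnj \<circ> zeta \<circ> cnj) 1 = 0" using z by simp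
    fix s :: complex assume "Re s > 1"
    hence "(\<lambda>n. cnj (of_nat (Suc n) powr (- cnj s))) sums cnj (zeta (cnj s))"
      using z by (simp only: sums_cnj) auto
    moreover have "cnj (of_nat (Suc n) powr (- cnj s)) = of_nat (Suc n) powr (- s)" for n
      by (subst cnj_powr) (simp_all del: of_nat_Suc add: complex_cnj_of_nat)
    ultimately show "(\<lambda>n. of_nat (Suc n) powr (- s)) sums (cnj \<circ> zeta \<circ> cnj) s" by simp
  qed
  from zeta_continuation_unique[OF this is_zeta_continuation_zeta] show ?thesis
    by (metis comp_apply)
qed

lemma of_real_zeta_real: "complex_of_real (zeta_real x) = zeta (complex_of_real x)"
  using cnj_zeta[of "complex_of_real x"] by (simp add: zeta_real_def complex_eq_iff)

end

theory Submission
  imports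
    Defs
    "HOL-Computational_Algebra.Squarefree"
    "HOL-Number_Theory.Prime_Powers"
    "HOL-Real_Asymp.Real_Asymp"
begin

text \<open>
  Since the Dirichlet series of \<open>tau (r - 1)\<close> is \<open>zeta s * zeta (r s) / zeta (2 r s)\<close>, its summatory
  function is the sum of \<open>mu m * T1 r (x / m\<^bsup>2r\<^esup>)\<close> over \<open>m\<close>. Weight the small \<open>m\<close> by
  \<open>1 - (m/y)\<^sup>K\<close>: on this part the given bound for \<open>Delta1 r\<close> is applied term by term and costs
  \<open>x\<^bsup>\<theta>\<^esup> y\<^bsup>1 - 2r\<theta>\<^esup>\<close>. The complementary part is the Perron integral of
  \<open>zeta s * zeta (r s) * G (2 r s)\<close>, where \<open>G\<close> is the smoothed tail of the series of \<open>1 / zeta\<close>.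
  Under the Riemann hypothesis, \<open>zeta\<close> and \<open>1 / zeta\<close> grow more slowly than every power to the right of
  the critical line, so moving a Perron integral for \<open>G\<close> to real part \<open>1/2 + \<delta>\<close> gives
  \<open>G w = O(y\<^bsup>1/2 + \<delta> - Re w\<^esup>)\<close> up to small powers of the ordinate. Moving the outer integral to real
  part \<open>1/2 + \<delta>\<close> then costs \<open>x\<^bsup>1/2\<^esup> y\<^bsup>1/2 - r\<^esup>\<close>, and its residue at \<open>1\<close> restores the main term. The
  exponent \<open>\<alpha>\<close> comes from balancing the two costs, \<open>y = x\<^bsup>\<beta>\<^esup>\<close> with
  \<open>\<beta> = (1 - 2\<theta>) / (2r + 1 - 4r\<theta>)\<close>. All Perron integrals converge absolutely, because the summatory
  function is monotone and may be averaged over an interval of length \<open>x\<^bsup>\<alpha>\<^esup>\<close>.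
\<close>

section \<open>A truncated Perron formula\<close>

text \<open>Averaging is undone by positivity of the coefficients, which \<open>tau\<close> has and
  the tail lacks. Hence the head is estimated pointwise and only then averaged, the tail is known
  only on average, and the two are put together again before the averaging is removed.

  The residue of the tail at 1 is a multiple of the midpoint of the interval and supplies what the
  head lacks in the linear term. It therefore lacks a smoothed tail of the series of 1 / zeta(2),
  which costs x^(1/r) y^(-3/2), still at most x^\<alpha> up to small powers.

  The weight 1 - (m/y)^K turns Perron's kernel 1/s into K / (s (s + K)), which decays quadratically.
  The price is a second pole at -K; taking K larger than the real parts at which G is estimated
  keeps it to the left of the lines of integration for G. The condition 2 r \<beta> < 1 keeps the
  arguments x / m^(2 r) large, where the bound for \<open>Delta1\<close> applies.\<close>

definition vline :: "real \<Rightarrow> real \<Rightarrow> (complex \<Rightarrow> complex) \<Rightarrow> complex" where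
  "vline c T f = integral {-T..T} (\<lambda>t. f (Complex c t))"

lemma Complex_continuous: "continuous_on A (\<lambda>t. Complex c t)"
  by (auto simp: Complex_eq intro!: continuous_intros)

lemma vline_integrable:
  fixes f :: "complex \<Rightarrow> complex"
  assumes "continuous_on {s. Re s = c \<and> \<bar>Im s\<bar> \<le> T} f"
  shows "(\<lambda>t. f (Complex c t)) integrable_on {-T..T}"
  by (rule integrable_continuous_real, rule continuous_on_compose2[OF assms Complex_continuous]) auto

text \<open>The factor \<i> is divided out of \<open>vline\<close>, so that a residue enters the
  formulas below as \<open>2 * pi\<close> times its value.\<close>

lemma contour_integral_eq_vline:
  assumes "T > 0"
  shows "contour_integral (linepath (Complex c (-T)) (Complex c T)) f = \<i> * vline c T f"
  unfolding vline_def by (rule contour_integral_linepath_same_Re) (use assms in auto)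

abbreviation vrect :: "real \<Rightarrow> real \<Rightarrow> real \<Rightarrow> real \<Rightarrow> complex" where
  "vrect a b T \<equiv> rectpath (Complex a (-T)) (Complex b T)"

text \<open>The vertical sides give the two line integrals; the horizontal ones, of length
  \<open>b - a\<close>, make up the error. In the applications \<open>I\<close> is
  \<open>2 * pi\<close> times the sum of the enclosed residues.\<close>

lemma vline_shift_rectpath:
  assumes T: "T > 0" and ab: "a < b"
    and cont: "continuous_on (path_image (vrect a b T)) f"
    and bd: "\<And>s. a \<le> Re s \<Longrightarrow> Re s \<le> b \<Longrightarrow> \<bar>Im s\<bar> = T \<Longrightarrow> norm (f s) \<le> B"
    and I: "contour_integral (vrect a b T) f = \<i> * I"
  shows "norm (vline b T f - vline a T f - I) \<le> 2 * B * (b - a)"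
proof -
  define a1 a2 a3 a4 where "a1 = Complex a (-T)" "a2 = Complex b (-T)" "a3 = Complex b T" "a4 = Complex a T"
  note defs = this
  have rp: "rectpath a1 a3 = linepath a1 a2 +++ linepath a2 a3 +++ linepath a3 a4 +++ linepath a4 a1"
    by (simp add: rectpath_def Let_def defs)
  have pi: "path_image (rectpath a1 a3) = closed_segment a1 a2 \<union> closed_segment a2 a3 \<union>
      closed_segment a3 a4 \<union> closed_segment a4 a1"
    unfolding rp by (simp add: path_image_join Un_assoc)
  have cont': "continuous_on (path_image (rectpath a1 a3)) f"
    using cont by (simp add: defs)
  have ci: "f contour_integrable_on (linepath a1 a2)" "f contour_integrable_on (linepath a2 a3)"
     "f contour_integrable_on (linepath a3 a4)" "f contour_integrable_on (linepath a4 a1)"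
    by (rule contour_integrable_continuous_linepath, rule continuous_on_subset[OF cont'], force simp: pi)+
  have "\<i> * I = contour_integral (rectpath a1 a3) f" using I by (simp add: defs)
  also have "\<dots> = contour_integral (linepath a1 a2) f + (contour_integral (linepath a2 a3) f + 
      (contour_integral (linepath a3 a4) f + contour_integral (linepath a4 a1) f))"
    unfolding rp using ci by (simp add: contour_integrable_join contour_integral_join)
  also have "contour_integral (linepath a2 a3) f = \<i> * vline b T f"
    unfolding defs by (rule contour_integral_eq_vline[OF T])
  also have "contour_integral (linepath a4 a1) f = - (\<i> * vline a T f)"
  proof -
    have "continuous_on (closed_segment a4 a1) f" by (rule continuous_on_subset[OF cont']) (auto simp: pi)
    from contour_integral_reverse_linepath[OF this] show ?thesis
      unfolding defs contour_integral_eq_vline[OF T] .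
  qed
  finally have eq: "\<i> * (vline b T f - vline a T f - I) =
     - (contour_integral (linepath a1 a2) f + contour_integral (linepath a3 a4) f)"
    by (simp add: algebra_simps)
  have B: "0 \<le> B" using order_trans[OF norm_ge_zero bd[of a1]] ab T by (simp add: defs)
  have h1: "norm (contour_integral (linepath a1 a2) f) \<le> B * norm (a2 - a1)"
  proof (rule contour_integral_bound_linepath[OF ci(1) B])
    fix x assume "x \<in> closed_segment a1 a2"
    hence "Im x = -T" "Re x \<in> closed_segment a b" by (auto simp: defs closed_segment_same_Im)
    thus "norm (f x) \<le> B" using ab T by (intro bd) (auto simp: closed_segment_eq_real_ivl)
  qed
  have h2: "norm (contour_integral (linepath a3 a4) f) \<le> B * norm (a4 - a3)"
  proof (rule contour_integral_bound_linepath[OF ci(3) B])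
    fix x assume "x \<in> closed_segment a3 a4"
    hence "Im x = T" "Re x \<in> closed_segment b a" by (auto simp: defs closed_segment_same_Im)
    thus "norm (f x) \<le> B" using ab T by (intro bd) (auto simp: closed_segment_eq_real_ivl)
  qed
  have n: "norm (a2 - a1) = b - a" "norm (a4 - a3) = b - a"
    using ab by (auto simp: defs cmod_def)
  have "norm (\<i> * (vline b T f - vline a T f - I)) \<le> B * (b - a) + B * (b - a)"
    unfolding eq norm_minus_cancel using h1 h2 unfolding n by (rule norm_triangle_le[OF add_mono])
  thus ?thesis by (simp add: norm_mult)
qed

lemma vline_shift_holomorphic:
  assumes T: "T > 0" and ab: "a < b"
    and hol: "f holomorphic_on S" and S: "open S" "convex S" "cbox (Complex a (-T)) (Complex b T) \<subseteq> S"
    and bd: "\<And>s. a \<le> Re s \<Longrightarrow> Re s \<le> b \<Longrightarrow> \<bar>Im s\<bar> = T \<Longrightarrow> norm (f s) \<le> B"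
  shows "norm (vline b T f - vline a T f) \<le> 2 * B * (b - a)"
proof -
  have sub: "path_image (vrect a b T) \<subseteq> S"
    using path_image_rectpath_subset_cbox[of "Complex a (-T)" "Complex b T"] S ab T by auto
  have "contour_integral (vrect a b T) f = 0"
    by (intro contour_integral_unique Cauchy_theorem_convex_simple[OF hol \<open>convex S\<close>]) (use sub in auto)
  moreover have "continuous_on (path_image (vrect a b T)) f"
    using holomorphic_on_imp_continuous_on[OF hol] sub by (rule continuous_on_subset)
  ultimately have "norm (vline b T f - vline a T f - 0) \<le> 2 * B * (b - a)"
    by (intro vline_shift_rectpath[OF T ab _ bd]) auto
  thus ?thesis by simp
qed

lemma rectpath_Cauchy:
  assumes T: "T > 0" and ab: "a < Re p" "Re p < b" "\<bar>Im p\<bar> < T"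
    and hol: "h holomorphic_on S" and S: "open S" "convex S" "cbox (Complex a (-T)) (Complex b T) \<subseteq> S"
  shows "((\<lambda>s. h s / (s - p)) has_contour_integral 2 * pi * \<i> * h p) (vrect a b T)"
    "continuous_on (path_image (vrect a b T)) (\<lambda>s. h s / (s - p))"
proof -
  let ?g = "vrect a b T"
  have pin: "p \<in> box (Complex a (-T)) (Complex b T)" using ab by (auto simp: in_box_complex_iff)
  have sub: "path_image ?g \<subseteq> S"
    using path_image_rectpath_subset_cbox[of "Complex a (-T)" "Complex b T"] S ab T by auto
  have np: "p \<notin> path_image ?g"
    using pin ab T path_image_rectpath_cbox_minus_box[of "Complex a (-T)" "Complex b T"] by auto
  have "p \<in> S" using pin S box_subset_cbox by blast
  have "((\<lambda>s. h s / (s - p)) has_contour_integral 2 * pi * \<i> * winding_number ?g p * h p) ?g"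
    by (rule Cauchy_integral_formula_convex_simple[OF \<open>convex S\<close> hol])
       (use sub np \<open>p \<in> S\<close> S in \<open>auto simp: interior_open\<close>)
  thus "((\<lambda>s. h s / (s - p)) has_contour_integral 2 * pi * \<i> * h p) ?g"
    using winding_number_rectpath[OF pin] by simp
  show "continuous_on (path_image ?g) (\<lambda>s. h s / (s - p))"
    using np by (intro continuous_intros continuous_on_subset[OF holomorphic_on_imp_continuous_on[OF hol] sub]) auto
qed

lemma vline_shift_pole:
  fixes h :: "complex \<Rightarrow> complex"
  assumes T: "T > 0" and ab: "a < Re p" "Re p < b" "\<bar>Im p\<bar> < T"
    and hol: "h holomorphic_on S" and S: "open S" "convex S" "cbox (Complex a (-T)) (Complex b T) \<subseteq> S"
    and bd: "\<And>s. a \<le> Re s \<Longrightarrow> Re s \<le> b \<Longrightarrow> \<bar>Im s\<bar> = T \<Longrightarrow> norm (h s / (s - p)) \<le> B"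
  shows "norm (vline b T (\<lambda>s. h s / (s - p)) - vline a T (\<lambda>s. h s / (s - p)) - 2 * pi * h p) \<le> 2 * B * (b - a)"
proof (rule vline_shift_rectpath[OF T _ _ bd])
  show "contour_integral (vrect a b T) (\<lambda>s. h s / (s - p)) = \<i> * (2 * pi * h p)"
    using contour_integral_unique[OF rectpath_Cauchy(1)[OF T ab hol S]] by simp
qed (use ab rectpath_Cauchy(2)[OF T ab hol S] in auto)

lemma vline_bound_const:
  assumes "T \<ge> 0" "continuous_on {s. Re s = c \<and> \<bar>Im s\<bar> \<le> T} f"
    "\<And>s. Re s = c \<Longrightarrow> \<bar>Im s\<bar> \<le> T \<Longrightarrow> norm (f s) \<le> B"
  shows "norm (vline c T f) \<le> 2 * T * B"
proof -
  have "norm (vline c T f) \<le> B * (T - (-T))"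
    unfolding vline_def
    by (rule integral_bound) (use assms in \<open>auto intro!: continuous_on_compose2[OF assms(2) Complex_continuous]\<close>)
  thus ?thesis by (simp add: mult_ac)
qed

text \<open>\<open>2 * pi / K\<close> times this weight is the Perron integral of \<open>u powr s / (s * (s + K))\<close>.\<close>

definition rweight :: "real \<Rightarrow> real \<Rightarrow> real" where
  "rweight K u = max 0 (1 - u powr (-K))"

lemma norm_of_real_powr: "u > 0 \<Longrightarrow> norm (complex_of_real u powr s) = u powr Re s"
  by (simp add: norm_powr_real_powr)

text \<open>For \<open>u \<le> 1\<close> the line is moved to the right, where nothing is crossed;
  for \<open>u > 1\<close> to the left past the poles 0 and -K, whose residues 1 / K and - u^(-K) /
  K form the weight. Moving by about \<open>T\<close> makes both factors of the denominator at least
  \<open>T\<close> in norm on all new sides, so each side contributes O(u^c / T).\<close>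

lemma perron_kernel:
  assumes u: "u > 0" and c: "c > 0" and K: "K > 0" and T: "T \<ge> 1"
  shows "norm (vline c T (\<lambda>s. of_real u powr s / (s * (s + of_real K))) - 2 * pi / K * rweight K u)
     \<le> (4 + 2 * c + 2 * K) * (u powr c / T)"
proof (cases "u \<le> 1")
  case True
  let ?f = "\<lambda>s. complex_of_real u powr s / (s * (s + of_real K))"
  have mono: "u powr x \<le> u powr c" if "x \<ge> c" for x
    using True u that by (intro powr_mono') auto
  have bd: "norm (?f s) \<le> u powr c / T^2" if "Re s \<ge> c" "norm s \<ge> T" "norm (s + of_real K) \<ge> T" for s
    unfolding norm_divide norm_mult norm_of_real_powr[OF u] power2_eq_square
    by (intro frac_le mult_mono mono) (use that u T in auto)
  have nz: "s * (s + of_real K) \<noteq> 0" if "Re s > 0" for s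
  proof -
    have "s \<noteq> 0" "s + of_real K \<noteq> 0" using that K by (auto simp: complex_eq_iff)
    thus ?thesis by simp
  qed
  have hol: "?f holomorphic_on {s. Re s > 0}"
    using u nz by (intro holomorphic_intros) auto
  have n1: "norm s \<ge> T" "norm (s + of_real K) \<ge> T" if "\<bar>Im s\<bar> = T" for s
    using abs_Im_le_cmod[of s] abs_Im_le_cmod[of "s + of_real K"] that by auto
  have n2: "norm s \<ge> T" "norm (s + of_real K) \<ge> T" if "Re s = c + T" for s
    using complex_Re_le_cmod[of s] complex_Re_le_cmod[of "s + of_real K"] that K c by auto
  have 1: "norm (vline (c + T) T ?f - vline c T ?f) \<le> 2 * (u powr c / T^2) * (c + T - c)"
    by (rule vline_shift_holomorphic[OF _ _ hol])
       (use T c n1 bd in \<open>auto simp: open_halfspace_Re_gt convex_halfspace_Re_gt in_cbox_complex_iff\<close>)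
  have 2: "norm (vline (c + T) T ?f) \<le> 2 * T * (u powr c / T^2)"
    by (rule vline_bound_const)
       (use T c n2 bd in \<open>auto intro!: continuous_on_subset[OF holomorphic_on_imp_continuous_on[OF hol]]\<close>)
  have "1 powr (-K) \<le> u powr (-K)" using u True K by (intro powr_mono2') auto
  hence "rweight K u = 0" by (simp add: rweight_def)
  hence "norm (vline c T ?f - 2 * pi / K * rweight K u) = norm (vline c T ?f)" by simp
  also have "\<dots> \<le> norm (vline (c + T) T ?f) + norm (vline (c + T) T ?f - vline c T ?f)"
    using norm_triangle_sub[of "vline c T ?f" "vline (c + T) T ?f"] by (simp add: norm_minus_commute)
  also have "\<dots> \<le> 4 * (u powr c / T)" using 1 2 T by (simp add: power2_eq_square)
  also have "\<dots> \<le> (4 + 2 * c + 2 * K) * (u powr c / T)"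
    using c K T by (intro mult_right_mono) auto
  finally show ?thesis .
next
  case False
  hence u1: "u \<ge> 1" by simp
  let ?f = "\<lambda>s. complex_of_real u powr s / (s * (s + of_real K))"
  \<comment> \<open>Far enough for both s and s + K to have norm at least \<open>T\<close> on the
    left side.\<close>
  define a where "a = -(K + T)"
  let ?g = "vrect a c T"
  have hol: "(\<lambda>s. complex_of_real u powr s) holomorphic_on UNIV"
    using u by (intro holomorphic_intros) auto
  have r1: "((\<lambda>s. of_real u powr s / (s - 0)) has_contour_integral 2 * pi * \<i> * of_real u powr 0) ?g"
    "continuous_on (path_image ?g) (\<lambda>s. complex_of_real u powr s / (s - 0))"
    by (rule rectpath_Cauchy[OF _ _ _ _ hol]; use T c K in \<open>auto simp: a_def\<close>)+
  have r2: "((\<lambda>s. of_real u powr s / (s - (-of_real K))) has_contour_integral 2 * pi * \<i> * of_real u powr (- of_real K)) ?g"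
    "continuous_on (path_image ?g) (\<lambda>s. complex_of_real u powr s / (s - (- of_real K)))"
    by (rule rectpath_Cauchy[OF _ _ _ _ hol]; use T c K in \<open>auto simp: a_def\<close>)+
  \<comment> \<open>Partial fractions separate the two poles, so that Cauchy's formula with a single
    pole applies to each part. The values differ from those of \<open>?f\<close> only at the poles,
    which lie off the contour.\<close>
  define f where "f = (\<lambda>s. (1 / of_real K) * (complex_of_real u powr s / (s - 0) - complex_of_real u powr s / (s - (-of_real K))))"
  have feq: "?f s = f s" if "s \<noteq> 0" "s \<noteq> - of_real K" for s
    using that K by (simp add: f_def divide_simps add_eq_0_iff2) (simp add: algebra_simps)
  have ci: "contour_integral ?g f = \<i> * (2 * pi / K * (1 - u powr (-K)))"
  proof -
    have "of_real u powr (- of_real K) = complex_of_real (u powr (-K))"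
      by (metis u powr_of_real of_real_minus less_imp_le)
    thus ?thesis
      unfolding f_def contour_integral_unique[OF has_contour_integral_lmul[OF has_contour_integral_diff[OF r1(1) r2(1)], of "1 / of_real K"]]
      using u by (simp add: algebra_simps diff_divide_distrib)
  qed
  have bd: "norm (f s) \<le> u powr c / T^2" if "Re s \<le> c" "norm s \<ge> T" "norm (s + of_real K) \<ge> T" for s
  proof -
    have "f s = ?f s" using that T by (intro feq[symmetric]) auto
    moreover have "norm (?f s) \<le> u powr c / T^2"
      unfolding norm_divide norm_mult norm_of_real_powr[OF u] power2_eq_square
      by (intro frac_le mult_mono powr_mono) (use that u1 T in auto)
    ultimately show ?thesis by simp
  qed
  have n1: "norm s \<ge> T" "norm (s + of_real K) \<ge> T" if "\<bar>Im s\<bar> = T" for s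
    using abs_Im_le_cmod[of s] abs_Im_le_cmod[of "s + of_real K"] that by auto
  have n2: "norm s \<ge> T" "norm (s + of_real K) \<ge> T" if "Re s = a" for s
    using abs_Re_le_cmod[of s] abs_Re_le_cmod[of "s + of_real K"] that K c T by (auto simp: a_def)
  have 1: "norm (vline c T f - vline a T f - 2 * pi / K * (1 - u powr (-K))) \<le> 2 * (u powr c / T^2) * (c - a)"
  proof (rule vline_shift_rectpath[OF _ _ _ _ ci])
    show "continuous_on (path_image ?g) f"
      unfolding f_def by (intro continuous_on_mult continuous_on_diff continuous_on_const r1(2) r2(2))
    show "norm (f s) \<le> u powr c / T^2" if "Re s \<le> c" "\<bar>Im s\<bar> = T" for s
      using that n1 by (intro bd) auto
  qed (use T c K in \<open>auto simp: a_def\<close>)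
  have 2: "norm (vline a T f) \<le> 2 * T * (u powr c / T^2)"
  proof (rule vline_bound_const)
    show "continuous_on {s. Re s = a \<and> \<bar>Im s\<bar> \<le> T} f"
      unfolding f_def using u T K by (intro continuous_intros) (auto simp: a_def complex_eq_iff)
    show "norm (f s) \<le> u powr c / T^2" if "Re s = a" for s
      using that c K T by (intro bd n2) (simp_all add: a_def)
  qed (use T in auto)
  have weight: "rweight K u = 1 - u powr (-K)"
    using powr_mono2'[of "-K" 1 u] u1 K by (simp add: rweight_def)
  have 3: "vline c T ?f = vline c T f"
    unfolding vline_def by (intro integral_cong feq) (use c K in \<open>auto simp: complex_eq_iff\<close>)
  have 4: "2 * T * (U / T^2) + 2 * (U / T^2) * (c - a) \<le> (4 + 2 * c + 2 * K) * (U / T)"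
    if "U \<ge> 0" for U
  proof -
    have "2 * T * (U / T^2) + 2 * (U / T^2) * (c - a) = (4 + 2 * ((c + K) / T)) * (U / T)"
      using T by (simp add: a_def power2_eq_square divide_simps) (simp add: algebra_simps)
    moreover have "(c + K) / T \<le> c + K" using c K T by (simp add: divide_le_eq mult_le_cancel_left1)
    moreover have "U / T \<ge> 0" using that T by simp
    ultimately show ?thesis by (simp only:) (rule mult_right_mono, linarith, assumption)
  qed
  have "norm (vline c T ?f - 2 * pi / K * rweight K u) \<le> norm (vline a T f) + norm (vline c T f - vline a T f - 2 * pi / K * (1 - u powr (-K)))"
    unfolding 3 weight by (rule order_trans[OF _ norm_triangle_ineq]) simp
  also have "\<dots> \<le> 2 * T * (u powr c / T^2) + 2 * (u powr c / T^2) * (c - a)"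
    using 1 2 by (intro add_mono)
  also have "\<dots> \<le> (4 + 2 * c + 2 * K) * (u powr c / T)"
    by (rule 4) simp
  finally show ?thesis .
qed

lemma of_real_powr_exp: "x > 0 \<Longrightarrow> complex_of_real x powr w = exp (w * of_real (ln x))"
  by (simp add: powr_def Ln_of_real)

lemma of_real_divide_powr:
  "x > 0 \<Longrightarrow> y > 0 \<Longrightarrow> complex_of_real (x / y) powr w = of_real y powr (-w) * of_real x powr w"
  by (simp add: of_real_powr_exp ln_div exp_diff right_diff_distrib exp_minus field_simps del: of_real_divide)

lemma rweight_eq_0: "0 < u \<Longrightarrow> u \<le> 1 \<Longrightarrow> K > 0 \<Longrightarrow> rweight K u = 0"
  using powr_mono2'[of "-K" u 1] by (simp add: rweight_def)

text \<open>The coefficient \<open>a n\<close> belongs to the integer \<open>Suc n\<close>. Uniform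
  convergence on the segment allows termwise integration; the errors of the kernel, summed against
  the coefficients, stay O(1/T) because the series converges absolutely on the line. Every
  \<open>N \<ge> X\<close> gives the same finite sum, since the weight vanishes for
  \<open>Suc n \<ge> X\<close>.\<close>

lemma perron_series:
  fixes a :: "nat \<Rightarrow> complex"
  assumes K: "K > 0" and c: "c > 0" and X: "X > 0"
    and sm: "summable (\<lambda>n. norm (a n) * real (Suc n) powr (-c))"
    and A: "\<And>s. Re s = c \<Longrightarrow> (\<lambda>n. a n * of_nat (Suc n) powr (-s)) sums A s"
    and N: "real N \<ge> X"
  shows "((\<lambda>T. vline c T (\<lambda>s. A s * of_real X powr s / (s * (s + of_real K)))) \<longlongrightarrow>
           2 * pi / K * (\<Sum>n<N. a n * rweight K (X / real (Suc n)))) at_top"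
proof -
  define k where "k = (\<lambda>n s. complex_of_real (X / real (Suc n)) powr s / (s * (s + of_real K)))"
  define f where "f = (\<lambda>n s. a n * k n s)"
  define g where "g = (\<lambda>s. A s * of_real X powr s / (s * (s + of_real K)))"
  have Xn: "X / real (Suc n) > 0" for n using X by simp
  have fs: "(\<lambda>n. f n s) sums g s" if "Re s = c" for s
  proof -
    have "(\<lambda>n. (a n * of_nat (Suc n) powr (-s)) * (of_real X powr s / (s * (s + of_real K)))) sums
        (A s * (of_real X powr s / (s * (s + of_real K))))"
      by (intro sums_mult2 A that)
    also have "(\<lambda>n. (a n * of_nat (Suc n) powr (-s)) * (of_real X powr s / (s * (s + of_real K)))) = (\<lambda>n. f n s)"
      unfolding f_def k_def of_real_divide_powr[OF X of_nat_0_less_iff[THEN iffD2, OF zero_less_Suc]] by (simp add: mult.assoc)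
    finally show ?thesis by (simp add: g_def)
  qed
  have n1: "norm s \<ge> c" "norm (s + of_real K) \<ge> c" if "Re s = c" for s
    using complex_Re_le_cmod[of s] complex_Re_le_cmod[of "s + of_real K"] that K c by auto
  have fb: "norm (f n s) \<le> norm (a n) * real (Suc n) powr (-c) * (X powr c / c^2)" if "Re s = c" for n s
  proof -
    have "norm (f n s) = norm (a n) * (X / real (Suc n)) powr c / (norm s * norm (s + of_real K))"
      unfolding f_def k_def norm_mult norm_divide norm_of_real_powr[OF Xn] using that by simp
    also have "\<dots> \<le> norm (a n) * (X / real (Suc n)) powr c / (c * c)"
      using n1[OF that] c by (intro divide_left_mono mult_mono mult_nonneg_nonneg mult_pos_pos) auto
    also have "\<dots> = norm (a n) * real (Suc n) powr (-c) * (X powr c / c^2)"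
      using X by (simp add: powr_divide powr_minus power2_eq_square field_simps del: of_nat_Suc)
    finally show ?thesis .
  qed
  have vs: "(\<lambda>n. a n * vline c T (k n)) sums vline c T g" if T: "T > 0" for T
  proof -
    let ?S = "closed_segment (Complex c (-T)) (Complex c T)"
    have S: "Re s = c" if "s \<in> ?S" for s using that by (simp add: closed_segment_same_Re)
    have "uniform_limit ?S (\<lambda>N w. \<Sum>n<N. f n w) (\<lambda>w. \<Sum>n. f n w) sequentially"
      by (rule Weierstrass_m_test[OF _ summable_mult2[OF sm]]) (use fb S in blast)
    also have "?this \<longleftrightarrow> uniform_limit ?S (\<lambda>N w. \<Sum>n<N. f n w) g sequentially"
      by (intro uniform_limit_cong') (auto intro: sums_unique[OF fs, symmetric] S)
    finally have ul: "uniform_limit ?S (\<lambda>N w. \<Sum>n<N. f n w) g sequentially" .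
    have cont: "continuous_on ?S (k n)" for n
    proof -
      have nz: "s \<noteq> 0" "s + of_real K \<noteq> 0" if "s \<in> ?S" for s
        using S[OF that] n1[of s] c by auto
      show ?thesis
        unfolding k_def of_real_powr_exp[OF Xn]
        by (intro continuous_on_divide continuous_intros) (simp add: nz)
    qed
    hence contf: "continuous_on ?S (f n)" for n unfolding f_def by (intro continuous_intros)
    obtain J where J: "(g has_contour_integral J) (linepath (Complex c (-T)) (Complex c T))"
      "(\<lambda>n. contour_integral (linepath (Complex c (-T)) (Complex c T)) (f n)) sums J"
      by (rule contour_integral_sums_linepath[OF ul contf])
    have J': "J = \<i> * vline c T g" using contour_integral_unique[OF J(1)] contour_integral_eq_vline[OF T] by simp
    have "contour_integral (linepath (Complex c (-T)) (Complex c T)) (f n) = \<i> * (a n * vline c T (k n))" for n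
      unfolding f_def using contour_integrable_continuous_linepath[OF cont[of n]]
      by (subst contour_integral_lmul) (auto simp: contour_integral_eq_vline[OF T])
    hence "(\<lambda>n. \<i> * (a n * vline c T (k n))) sums (\<i> * vline c T g)" using J(2) J' by simp
    from sums_mult[OF this, of "-\<i>"] show ?thesis by (simp flip: mult.assoc)
  qed
  let ?w = "\<lambda>n. 2 * pi / K * rweight K (X / real (Suc n))"
  let ?S = "\<Sum>n<N. a n * complex_of_real (?w n)"
  have weight: "(\<lambda>n. a n * ?w n) sums
      ?S"
  proof (rule sums_finite)
    fix n assume "n \<notin> {..<N}"
    hence "X \<le> real (Suc n)" using N by simp
    hence "rweight K (X / real (Suc n)) = 0" using Xn[of n] K by (intro rweight_eq_0) auto
    thus "a n * ?w n = 0" by simp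
  qed auto
  define M where "M = (\<Sum>n. norm (a n) * real (Suc n) powr (-c)) * ((4 + 2 * c + 2 * K) * X powr c)"
  have bd: "norm (vline c T g - ?S) \<le> M / T" if T: "T \<ge> 1" for T
  proof -
    have s2: "(\<lambda>n. norm (a n) * real (Suc n) powr (-c) * ((4 + 2 * c + 2 * K) * X powr c / T)) sums (M / T)"
      unfolding M_def times_divide_eq_right[symmetric] by (rule sums_mult2[OF summable_sums[OF sm]])
    have s1: "(\<lambda>n. a n * (vline c T (k n) - ?w n)) sums
      (vline c T g - ?S)"
      using sums_diff[OF vs weight] T by (simp only: right_diff_distrib)
    have s3: "norm (a n * (vline c T (k n) - ?w n)) \<le>
       norm (a n) * real (Suc n) powr (-c) * ((4 + 2 * c + 2 * K) * X powr c / T)" for n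
    proof -
      have "norm (vline c T (k n) - ?w n) \<le> (4 + 2 * c + 2 * K) * ((X / real (Suc n)) powr c / T)"
        unfolding k_def by (rule perron_kernel[OF Xn c K T])
      also have "(X / real (Suc n)) powr c = real (Suc n) powr (-c) * X powr c"
        using X by (simp add: powr_divide powr_minus field_simps del: of_nat_Suc)
      finally have "norm (a n) * norm (vline c T (k n) - ?w n) \<le>
          norm (a n) * ((4 + 2 * c + 2 * K) * (real (Suc n) powr (-c) * X powr c / T))"
        by (rule mult_left_mono) simp
      also have "\<dots> = norm (a n) * real (Suc n) powr (-c) * ((4 + 2 * c + 2 * K) * X powr c / T)"
        by (simp only: times_divide_eq_right times_divide_eq_left mult_ac)
      finally show ?thesis unfolding norm_mult .
    qed
    show ?thesis by (rule norm_sums_le[OF s1 s2 s3])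
  qed
  have "((\<lambda>T. vline c T g - ?S) \<longlongrightarrow> 0) at_top"
  proof (rule Lim_null_comparison)
    show "\<forall>\<^sub>F T in at_top. norm (vline c T g - ?S) \<le> M / T"
      by (intro eventually_at_top_linorderI[of 1] bd)
    show "((\<lambda>T. M / T) \<longlongrightarrow> 0) at_top" by real_asymp
  qed
  thus ?thesis unfolding g_def
    by (subst (asm) LIM_zero_iff) (simp add: sum_distrib_left mult_ac)
qed

text \<open>Only the difference of the two integrals is asserted to converge; the existence of the
  limit on the left line is later obtained from Perron's formula on the right one. The decay
  assumption makes the horizontal sides disappear.\<close>

lemma vline_shift_limit:
  fixes h :: "complex \<Rightarrow> complex"
  assumes p: "c' < Re p" "Re p < c" and c0: "c0 < c'"
    and hol: "h holomorphic_on {s. Re s > c0}" and \<eta>: "\<eta> > 0"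
    and bd: "\<And>s. c' \<le> Re s \<Longrightarrow> Re s \<le> c \<Longrightarrow> \<bar>Im s\<bar> \<ge> T0 \<Longrightarrow> norm (h s / (s - p)) \<le> M * \<bar>Im s\<bar> powr (-\<eta>)"
  shows "((\<lambda>T. vline c T (\<lambda>s. h s / (s - p)) - vline c' T (\<lambda>s. h s / (s - p))) \<longlongrightarrow> 2 * pi * h p) at_top"
proof -
  have "((\<lambda>T. vline c T (\<lambda>s. h s / (s - p)) - vline c' T (\<lambda>s. h s / (s - p)) - 2 * pi * h p) \<longlongrightarrow> 0) at_top"
  proof (rule Lim_null_comparison)
    show "\<forall>\<^sub>F T in at_top. norm (vline c T (\<lambda>s. h s / (s - p)) - vline c' T (\<lambda>s. h s / (s - p)) - 2 * pi * h p)
        \<le> 2 * (M * T powr (-\<eta>)) * (c - c')"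
      using eventually_gt_at_top[of "\<bar>Im p\<bar>"] eventually_gt_at_top[of "0"] eventually_ge_at_top[of T0]
    proof eventually_elim
      case (elim T)
      show ?case
      proof (rule vline_shift_pole[OF _ _ _ _ hol])
        show "cbox (Complex c' (- T)) (Complex c T) \<subseteq> {s. Re s > c0}"
          using c0 by (auto simp: in_cbox_complex_iff)
        show "norm (h s / (s - p)) \<le> M * T powr (-\<eta>)" if "c' \<le> Re s" "Re s \<le> c" "\<bar>Im s\<bar> = T" for s
          using bd[OF that(1,2)] that(3) elim by simp
      qed (use p elim in \<open>auto simp: open_halfspace_Re_gt convex_halfspace_Re_gt\<close>)
    qed
    show "((\<lambda>T. 2 * (M * T powr (-\<eta>)) * (c - c')) \<longlongrightarrow> 0) at_top" using \<eta> by real_asymp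
  qed
  thus ?thesis by (subst (asm) LIM_zero_iff)
qed

lemma integral_one_plus_abs_powr_bound:
  fixes T \<eta> :: real
  assumes "\<eta> > 0" "T \<ge> 0"
  shows "(\<lambda>t. (1 + \<bar>t\<bar>) powr (-1-\<eta>)) integrable_on {-T..T}"
    "integral {-T..T} (\<lambda>t. (1 + \<bar>t\<bar>) powr (-1-\<eta>)) \<le> 2 / \<eta>"
proof -
  let ?g = "\<lambda>t::real. (1 + \<bar>t\<bar>) powr (-1-\<eta>)" and ?I = "(- 1/\<eta>) * (1 + T) powr (-\<eta>) - (- 1/\<eta>) * (1 + 0) powr (-\<eta>)"
  have 1: "(?g has_integral ?I) {0..T}"
    using assms by (intro fundamental_theorem_of_calculus)
      (auto intro!: derivative_eq_intros simp: minus_diff_commute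
        simp flip: has_real_derivative_iff_has_vector_derivative)
  hence 2: "((\<lambda>t. ?g (-t)) has_integral ?I) {-T..-0}"
    by (subst has_integral_reflect_real) auto
  have 3: "(?g has_integral (?I +
      ?I)) {-T..T}"
    by (rule has_integral_combine[where c = 0]) (use 1 2 assms in auto)
  thus "?g integrable_on {-T..T}" by blast
  have "integral {-T..T} ?g = 2 / \<eta> - 2 / \<eta> * (1 + T) powr (-\<eta>)"
    using integral_unique[OF 3] by simp
  thus "integral {-T..T} ?g \<le> 2 / \<eta>" using assms by simp
qed

text \<open>Uniform in \<open>T\<close>, so the bound survives the passage to the limit.\<close>

lemma vline_bound:
  assumes "continuous_on {s. Re s = c \<and> \<bar>Im s\<bar> \<le> T} f" "\<eta> > 0" "T \<ge> 0"
    and "\<And>s. Re s = c \<Longrightarrow> norm (f s) \<le> B * (1 + \<bar>Im s\<bar>) powr (-1-\<eta>)"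
  shows "norm (vline c T f) \<le> 2 * B / \<eta>"
proof -
  have B: "B \<ge> 0" using order_trans[OF norm_ge_zero assms(4)[of "Complex c 0"]] by simp
  have "norm (vline c T f) \<le> integral {-T..T} (\<lambda>t. B * (1 + \<bar>t\<bar>) powr (-1-\<eta>))"
    unfolding vline_def
  proof (rule integral_norm_bound_integral[OF vline_integrable[OF assms(1)]])
    show "(\<lambda>t. B * (1 + \<bar>t\<bar>) powr (-1-\<eta>)) integrable_on {-T..T}"
      using integrable_on_cmult_left[OF integral_one_plus_abs_powr_bound(1)[OF assms(2,3)], of B] by simp
    show "norm (f (Complex c t)) \<le> B * (1 + \<bar>t\<bar>) powr (-1-\<eta>)" for t
      using assms(4)[of "Complex c t"] by simp
  qed
  also have "\<dots> \<le> B * (2 / \<eta>)"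
    using integral_one_plus_abs_powr_bound[OF assms(2,3)] B by (simp only: integral_mult_right mult_left_mono)
  finally show ?thesis by (simp add: mult_ac)
qed

section \<open>The zeta-function in the right half-plane\<close>

text \<open>\<open>(s - 1) * zeta s\<close> with its pole removed, which \<open>zeta 1 = 0\<close> would miss.\<close>

definition zeta_reg :: "complex \<Rightarrow> complex" where
  "zeta_reg s = 1 + (\<Sum>n. taylor_rem 1 n s)"

lemma taylor_rem_1: "taylor_rem 1 n s = of_nat (Suc (Suc n)) powr (1 - s) - of_nat (Suc n) powr (1 - s)
   - (1 - s) * of_nat (Suc n) powr (- s)"
  by (simp add: taylor_rem_def)

text \<open>The mean value inequality is applied twice on the segment between two consecutive
  integers. The dependence on \<open>s\<close> is explicit, as needed for a polynomial bound in the
  vertical direction.\<close>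

lemma norm_taylor_rem_1:
  assumes "Re s > 0"
  shows "norm (taylor_rem 1 n s) \<le> norm (1 - s) * norm s * real (Suc n) powr (- Re s - 1)"
proof -
  define N where "N = Suc n"
  define S where "S = closed_segment (of_nat N :: complex) (of_nat (Suc N))"
  have S: "Im z = 0" "Re z \<ge> real N" "z \<notin> \<real>\<^sub>\<le>\<^sub>0" "norm (z - of_nat N) \<le> 1" if "z \<in> S" for z
  proof -
    have *: "Im z = 0" "Re z \<in> {real N..real (Suc N)}"
      using that by (auto simp: S_def closed_segment_same_Im closed_segment_eq_real_ivl simp del: of_nat_Suc)
    thus "Im z = 0" "Re z \<ge> real N" "z \<notin> \<real>\<^sub>\<le>\<^sub>0" by (auto simp: complex_nonpos_Reals_iff N_def)
    show "norm (z - of_nat N) \<le> 1" using * by (simp add: cmod_def)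
  qed
  have NS: "of_nat N \<in> S" "of_nat (Suc N) \<in> S" by (auto simp: S_def)
  have "convex S" by (simp add: S_def)
  define B where "B = norm s * real N powr (- Re s - 1)"
  have 1: "norm (z powr (-s) - of_nat N powr (-s)) \<le> B" if z: "z \<in> S" for z
  proof -
    have "norm (z powr (-s) - of_nat N powr (-s)) \<le> B * norm (z - of_nat N)"
    proof (rule field_differentiable_bound[OF \<open>convex S\<close> _ _ z NS(1)])
      fix w assume w: "w \<in> S"
      show "((\<lambda>w. w powr (-s)) has_field_derivative (-s * w powr (-s-1))) (at w within S)"
        by (rule DERIV_subset[OF has_field_derivative_powr[OF S(3)[OF w]]]) simp
      have wr: "w \<in> \<real>" "Re w > 0" using S[OF w] by (auto simp: complex_is_Real_iff N_def)
      have "norm (w powr (-s-1)) = Re w powr (- Re s - 1)" using wr by (simp add: norm_powr_real_powr)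
      also have "\<dots> \<le> real N powr (- Re s - 1)"
        using S[OF w] assms by (intro powr_mono2') (auto simp: N_def)
      finally show "norm (-s * w powr (-s-1)) \<le> B"
        unfolding B_def norm_mult by (intro mult_mono) auto
    qed
    also have "\<dots> \<le> B * 1" using S(4)[OF z] by (intro mult_left_mono) (auto simp: B_def)
    finally show ?thesis by simp
  qed
  \<comment> \<open>Its increment over the segment is the remainder, and its derivative is
    \<open>(1-s) * (z powr (-s) - of_nat N powr (-s))\<close>, to which the first mean value
    estimate applies.\<close>
  define g where "g = (\<lambda>z. z powr (1-s) - (1-s) * of_nat N powr (-s) * z)"
  have "norm (g (of_nat (Suc N)) - g (of_nat N)) \<le> (norm (1-s) * B) * norm (of_nat (Suc N) - of_nat N :: complex)"
  proof (rule field_differentiable_bound[OF \<open>convex S\<close> _ _ NS(2,1)])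
    fix w assume w: "w \<in> S"
    have "(g has_field_derivative ((1-s) * w powr (1-s-1) - (1-s) * of_nat N powr (-s) * 1)) (at w within S)"
      unfolding g_def
      by (intro DERIV_diff DERIV_cmult DERIV_ident DERIV_subset[OF has_field_derivative_powr[OF S(3)[OF w]]]) simp
    thus "(g has_field_derivative ((1-s) * (w powr (-s) - of_nat N powr (-s)))) (at w within S)"
      by (simp add: right_diff_distrib)
    show "norm ((1-s) * (w powr (-s) - of_nat N powr (-s))) \<le> norm (1-s) * B"
      unfolding norm_mult by (intro mult_left_mono 1 w) auto
  qed
  also have "of_nat (Suc N) - of_nat N = (1 :: complex)" by simp
  also have "g (of_nat (Suc N)) - g (of_nat N) = taylor_rem 1 n s"
    unfolding taylor_rem_1 g_def N_def by (simp add: algebra_simps)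
  finally show ?thesis by (simp add: B_def N_def mult_ac)
qed

lemma holomorphic_zeta_reg: "zeta_reg holomorphic_on {s. Re s > 0}"
proof -
  have "(\<lambda>s. \<Sum>n. taylor_rem 1 n s) holomorphic_on {s. Re s > 1 - real 1}"
    by (rule holomorphic_suminf_powr_bound(1)[OF holomorphic_taylor_rem taylor_rem_bound])
  thus ?thesis unfolding zeta_reg_def by (intro holomorphic_intros) simp
qed

lemma zeta_reg_1 [simp]: "zeta_reg 1 = 1"
  unfolding zeta_reg_def taylor_rem_1 by (simp del: of_nat_Suc)

lemmas zeta_props = is_zeta_continuation_zeta[unfolded is_zeta_continuation_def]

lemma sums_zeta: "Re s > 1 \<Longrightarrow> (\<lambda>n. of_nat (Suc n) powr (- s)) sums zeta s"
  using zeta_props by blast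

lemma zeta_1 [simp]: "zeta 1 = 0"
  using zeta_props by blast

lemma zeta_reg_eq:
  assumes "Re s > 0" "s \<noteq> 1"
  shows "zeta_reg s = (s - 1) * zeta s"
proof (rule analytic_continuation_open[where f = zeta_reg and g = "\<lambda>s. (s - 1) * zeta s"])
  show "open {s. Re s > 1}" "open ({s. Re s > 0} - {1})" by (auto simp: open_halfspace_Re_gt)
  show "{s. Re s > 1} \<noteq> {}" by (auto intro!: exI[of _ 2])
  show "connected ({s. Re s > 0} - {1})"
    by (intro connected_open_delete convex_connected convex_halfspace_Re_gt open_halfspace_Re_gt) simp
  show "zeta_reg holomorphic_on {s. Re s > 0} - {1}"
    by (rule holomorphic_on_subset[OF holomorphic_zeta_reg]) auto
  show "(\<lambda>s. (s - 1) * zeta s) holomorphic_on {s. Re s > 0} - {1}"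
    using zeta_props by (intro holomorphic_intros) (auto intro: holomorphic_on_subset)
  show "zeta_reg z = (z - 1) * zeta z" if "z \<in> {s. Re s > 1}" for z
  proof -
    have "zeta_series z = zeta z"
      using sums_zeta_series[of z] sums_zeta[of z] that by (auto intro: sums_unique2)
    thus ?thesis using sum_taylor_rem[of z 0] that by (simp add: zeta_reg_def numeral_2_eq_2)
  qed
qed (use assms in auto)

text \<open>Valid at 1 too: \<open>zeta 1 = 0\<close>, and division by zero gives 0.\<close>

lemma zeta_eq_zeta_reg: "Re s > 0 \<Longrightarrow> zeta s = zeta_reg s / (s - 1)"
  by (cases "s = 1") (simp_all add: zeta_reg_eq)

lemma summable_Suc_powr: "p > 1 \<Longrightarrow> summable (\<lambda>n. real (Suc n) powr (-p))"
  using summable_Suc_iff[of "\<lambda>n. real n powr (-p)"] by (simp add: summable_real_powr_iff del: of_nat_Suc)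

text \<open>Any polynomial bound would do, because only its logarithm enters the growth
  estimates.\<close>

lemma zeta_reg_bound:
  obtains C where "C > 0" "\<And>s. Re s \<ge> 1/2 \<Longrightarrow> norm (zeta_reg s) \<le> C * (1 + norm s) ^ 2"
proof -
  have sm: "summable (\<lambda>n. real (Suc n) powr (-3/2))"
    using summable_Suc_powr[of "3/2"] by simp
  define S where "S = (\<Sum>n. real (Suc n) powr (-3/2))"
  have S0: "S \<ge> 0" unfolding S_def by (rule suminf_nonneg[OF sm]) simp
  have "norm (zeta_reg s) \<le> (1 + S) * (1 + norm s) ^ 2" if s: "Re s \<ge> 1/2" for s
  proof -
    have "norm (taylor_rem 1 n s) \<le> norm (1 - s) * norm s * real (Suc n) powr (-3/2)" for n
      using s by (intro order_trans[OF norm_taylor_rem_1] mult_left_mono powr_mono) auto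
    moreover have "summable (\<lambda>n. norm (1 - s) * norm s * real (Suc n) powr (-3/2))"
      by (rule summable_mult[OF sm])
    ultimately have "norm (\<Sum>n. taylor_rem 1 n s) \<le> (\<Sum>n. norm (1 - s) * norm s * real (Suc n) powr (-3/2))"
      by (intro norm_suminf_le)
    also have "\<dots> = norm (1 - s) * norm s * S" unfolding S_def by (rule suminf_mult[OF sm])
    also have "\<dots> \<le> (1 + norm s) * (1 + norm s) * S"
      using norm_triangle_ineq4[of 1 s] S0 by (intro mult_right_mono mult_mono) auto
    finally have "norm (\<Sum>n. taylor_rem 1 n s) \<le> S * (1 + norm s)^2" by (simp add: power2_eq_square mult_ac)
    moreover have "norm (zeta_reg s) \<le> 1 + norm (\<Sum>n. taylor_rem 1 n s)"
      unfolding zeta_reg_def using norm_triangle_ineq[of 1 "\<Sum>n. taylor_rem 1 n s"] by simp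
    moreover have "1 \<le> (1 + norm s)^2" by (intro one_le_power) simp
    ultimately show ?thesis unfolding distrib_right mult_1 by linarith
  qed
  thus ?thesis using S0 by (intro that[of "1 + S"]) auto
qed

section \<open>Dirichlet convolutions and the Moebius function\<close>

lemma has_sum_product:
  fixes f g :: "nat \<Rightarrow> 'a :: {real_normed_field, banach}"
  assumes f: "(f has_sum F) A" "(\<lambda>n. norm (f n)) summable_on A"
    and g: "(g has_sum G) B" "(\<lambda>n. norm (g n)) summable_on B"
  shows "((\<lambda>(i,j). f i * g j) has_sum F * G) (A \<times> B)"
proof (rule has_sum_SigmaI)
  show "((\<lambda>j. case (i, j) of (i, j) \<Rightarrow> f i * g j) has_sum f i * G) B" for i
    using has_sum_cmult_right[OF g(1), of "f i"] by simp
  show "((\<lambda>i. f i * G) has_sum F * G) A"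
    by (rule has_sum_cmult_left[OF f(1)])
  have "(\<lambda>(i,j). norm (f i) * norm (g j)) summable_on (A \<times> B)"
  proof (rule summable_on_SigmaI)
    show "((\<lambda>j. case (i, j) of (i, j) \<Rightarrow> norm (f i) * norm (g j)) has_sum norm (f i) * (\<Sum>\<^sub>\<infinity>j\<in>B. norm (g j))) B" for i
      using has_sum_cmult_right[OF has_sum_infsum[OF g(2)], of "norm (f i)"] by simp
    show "(\<lambda>i. norm (f i) * (\<Sum>\<^sub>\<infinity>j\<in>B. norm (g j))) summable_on A"
      by (rule summable_on_cmult_left[OF f(2)])
  qed auto
  hence "(\<lambda>p. norm (case p of (i, j) \<Rightarrow> f i * g j)) summable_on (A \<times> B)"
    by (simp add: case_prod_unfold norm_mult)
  thus "(\<lambda>(i, j). f i * g j) summable_on A \<times> B" by (rule abs_summable_summable)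
qed

text \<open>The convolution of \<open>f\<close> with a \<open>g\<close> placed on the q-th powers
  runs over n = i * j^q, and j alone determines the pair. For q = 1 these are the divisors; for q =
  r their number is the coefficient of zeta(s) zeta(r s).\<close>

definition root_divs :: "nat \<Rightarrow> nat \<Rightarrow> nat set" where
  "root_divs q n = {j. j ^ q dvd n}"

lemma finite_root_divs:
  assumes "n > 0" "q > 0"
  shows "finite (root_divs q n)"
proof (rule finite_subset)
  show "root_divs q n \<subseteq> {..n}"
  proof
    fix j assume "j \<in> root_divs q n"
    hence "j ^ q \<le> n" using assms by (auto simp: root_divs_def intro: dvd_imp_le)
    moreover have "j \<le> j ^ q" using assms by (cases "j = 0") (auto intro: self_le_power)
    ultimately show "j \<in> {..n}" by simp
  qed
qed simp

lemma root_divs_pos: "n > 0 \<Longrightarrow> q > 0 \<Longrightarrow> j \<in> root_divs q n \<Longrightarrow> j > 0"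
  by (cases "j = 0") (auto simp: root_divs_def)

text \<open>The absolutely convergent double series is regrouped by the value n = i * j^q.\<close>

lemma has_sum_dirichlet_conv:
  fixes f g :: "nat \<Rightarrow> 'a :: {real_normed_field, banach}"
  assumes f: "(f has_sum F) {0<..}" "(\<lambda>n. norm (f n)) summable_on {0<..}"
    and g: "(g has_sum G) {0<..}" "(\<lambda>n. norm (g n)) summable_on {0<..}"
    and q: "q > 0"
  shows "((\<lambda>n. \<Sum>j\<in>root_divs q n. f (n div j ^ q) * g j) has_sum F * G) {0<..}"
proof -
  have "((\<lambda>(i,j). f i * g j) has_sum F * G) ({0<..} \<times> {0<..})"
    by (rule has_sum_product[OF f g])
  also have "?this \<longleftrightarrow> ((\<lambda>(n,j). f (n div j ^ q) * g j) has_sum F * G) (SIGMA n:{0<..}. root_divs q n)"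
    by (rule has_sum_reindex_bij_witness[of _ "\<lambda>(n,j). (n div j ^ q, j)" "\<lambda>(i,j). (i * j ^ q, j)"])
       (auto simp: root_divs_def dvd_div_mult_self dest: root_divs_pos[OF _ q, unfolded root_divs_def, simplified] 
         intro!: Nat.gr0I simp: q dvd_div_eq_0_iff)
  finally show ?thesis
    by (rule has_sum_SigmaD) (auto intro!: has_sum_finite finite_root_divs q)
qed

lemma abs_summable_dirichlet_conv:
  fixes f g :: "nat \<Rightarrow> 'a :: {real_normed_field, banach}"
  assumes f: "(\<lambda>n. norm (f n)) summable_on {0<..}" and g: "(\<lambda>n. norm (g n)) summable_on {0<..}"
    and q: "q > 0"
  shows "(\<lambda>n. norm (\<Sum>j\<in>root_divs q n. f (n div j ^ q) * g j)) summable_on {0<..}"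
proof (rule Infinite_Sum.abs_summable_on_comparison_test')
  have "(\<lambda>n. norm (norm (f n))) summable_on {0<..}" "(\<lambda>n. norm (norm (g n))) summable_on {0<..}" using f g by simp_all
  from has_sum_dirichlet_conv[OF has_sum_infsum[OF f] this(1) has_sum_infsum[OF g] this(2) q]
  show "(\<lambda>n. \<Sum>j\<in>root_divs q n. norm (f (n div j ^ q)) * norm (g j)) summable_on {0<..}"
    by (rule has_sum_imp_summable)
  show "norm (\<Sum>j\<in>root_divs q n. f (n div j ^ q) * g j) \<le> (\<Sum>j\<in>root_divs q n. norm (f (n div j ^ q)) * norm (g j))" for n
    by (rule order_trans[OF norm_sum]) (simp add: norm_mult)
qed

text \<open>Regrouping needs unordered sums over the positive integers, whereas \<open>zeta\<close>
  and Perron's formula use series indexed by \<open>Suc n\<close>; absolute convergence makes the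
  two notions agree.\<close>

lemma has_sum_Suc_iff_sums:
  fixes f :: "nat \<Rightarrow> 'a :: banach"
  assumes "(\<lambda>n. norm (f n)) summable_on {0<..}"
  shows "(f has_sum F) {0<..} \<longleftrightarrow> (\<lambda>n. f (Suc n)) sums F"
proof -
  have r: "(h has_sum c) {0<..} \<longleftrightarrow> ((\<lambda>n. h (Suc n)) has_sum c) UNIV" for h :: "nat \<Rightarrow> 'b :: banach" and c
    by (rule has_sum_reindex_bij_witness[of _ Suc "\<lambda>n. n - 1"]) auto
  have "(\<lambda>n. norm (f (Suc n))) summable_on UNIV"
    using assms r[of "\<lambda>n. norm (f n)"] by (auto simp: summable_on_def)
  hence "summable (\<lambda>n. norm (f (Suc n)))" by (rule summable_on_imp_summable)
  thus ?thesis unfolding r by (metis norm_summable_imp_has_sum has_sum_imp_sums)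
qed

lemma norm_summable_on_Suc_iff:
  fixes f :: "nat \<Rightarrow> 'a :: real_normed_vector"
  shows "(\<lambda>n. norm (f n)) summable_on {0<..} \<longleftrightarrow> summable (\<lambda>n. norm (f (Suc n)))"
proof -
  have "(\<lambda>n. norm (f n)) summable_on {0<..} \<longleftrightarrow> (\<lambda>n. norm (f (Suc n))) summable_on UNIV"
    by (rule summable_on_reindex_bij_witness[of _ Suc "\<lambda>n. n - 1"]) auto
  also have "\<dots> \<longleftrightarrow> summable (\<lambda>n. norm (f (Suc n)))"
    by (rule summable_on_UNIV_nonneg_real_iff) auto
  finally show ?thesis .
qed

section \<open>The Moebius function and squarefree divisors\<close>

definition mu :: "nat \<Rightarrow> real" where
  "mu n = (if squarefree n then (-1) ^ card (prime_factors n) else 0)"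

lemma abs_mu_le: "\<bar>mu n\<bar> \<le> 1"
  by (simp add: mu_def power_abs)

lemma squarefree_prod_primes:
  assumes "finite P" "\<And>p. p \<in> P \<Longrightarrow> prime (p :: nat)"
  shows "squarefree (\<Prod>P)" "prime_factors (\<Prod>P) = P"
proof -
  have cop: "coprime p q" if "p \<in> P" "q \<in> P" "p \<noteq> q" for p q
    using primes_coprime[of p q] assms that by auto
  show "squarefree (\<Prod>P)"
    by (rule squarefree_prod_coprime) (use cop assms in \<open>auto intro: squarefree_prime\<close>)
  have "0 \<notin> P" using assms(2) not_prime_0 by blast
  hence "prime_factors (\<Prod>P) = (\<Union>p\<in>P. prime_factors p)"
    using prime_factors_prod[OF assms(1), of "\<lambda>p. p"] by (simp add: o_def)
  also have "\<dots> = P" using assms by (auto simp: prime_prime_factors)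
  finally show "prime_factors (\<Prod>P) = P" .
qed

lemma squarefree_eq_prod_prime_factors:
  assumes "squarefree (n :: nat)"
  shows "n = \<Prod>(prime_factors n)"
proof -
  have n0: "n \<noteq> 0" using assms by (metis not_squarefree_0)
  have "n = (\<Prod>p\<in>prime_factors n. p ^ multiplicity p n)"
    using n0 by (intro prime_factorization_nat) simp
  also have "\<dots> = \<Prod>(prime_factors n)"
  proof (rule prod.cong)
    fix p assume p: "p \<in> prime_factors n"
    have "multiplicity p n = 1"
      using assms p n0 squarefree_factorial_semiring'[of n] by auto
    thus "p ^ multiplicity p n = p" by simp
  qed simp
  finally show ?thesis .
qed

text \<open>A squarefree \<open>d\<close> is the product of a set of primes, and
  \<open>d ^ q\<close> divides \<open>n\<close> iff each \<open>p ^ q\<close> does. With q = 1 this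
  yields the divisor sum of \<open>mu\<close>, with q = r the reading of \<open>tau\<close> as the
  number of squarefree d with d^r dividing n.\<close>

lemma bij_betw_squarefree_divs:
  assumes n: "n > 0" and q: "q > 0"
  shows "bij_betw prime_factors {d. squarefree d \<and> d ^ q dvd n} (Pow {p. prime p \<and> p ^ q dvd (n::nat)})"
proof (rule bij_betw_byWitness[where f' = "\<lambda>P. \<Prod>P"])
  have fin: "finite {p. prime p \<and> p ^ q dvd n}"
    by (rule finite_subset[OF _ finite_root_divs[OF n q]]) (auto simp: root_divs_def)
  show "\<forall>d\<in>{d. squarefree d \<and> d ^ q dvd n}. \<Prod>(prime_factors d) = d"
    by (auto intro!: squarefree_eq_prod_prime_factors[symmetric])
  show "\<forall>P\<in>Pow {p. prime p \<and> p ^ q dvd n}. prime_factors (\<Prod>P) = P"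
    using finite_subset[OF _ fin] by (intro ballI squarefree_prod_primes(2)) auto
  show "prime_factors ` {d. squarefree d \<and> d ^ q dvd n} \<subseteq> Pow {p. prime p \<and> p ^ q dvd n}"
  proof safe
    fix d p assume *: "d ^ q dvd n" "p \<in> prime_factors d"
    show "prime p" using * by (rule_tac in_prime_factors_imp_prime)
    have "p dvd d" using * by (rule_tac in_prime_factors_imp_dvd)
    thus "p ^ q dvd n" using *(1) by (meson dvd_power_same dvd_trans)
  qed
  show "(\<lambda>P. \<Prod>P) ` Pow {p. prime p \<and> p ^ q dvd n} \<subseteq> {d. squarefree d \<and> d ^ q dvd n}"
  proof safe
    fix P assume P: "P \<subseteq> {p. prime p \<and> p ^ q dvd n}"
    hence fP: "finite P" using fin finite_subset by blast
    show "squarefree (\<Prod>P)" using P by (intro squarefree_prod_primes fP) auto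
    have "(\<Prod>p\<in>P. p ^ q) dvd n"
      using fP P
    proof (induction P rule: finite_induct)
      case (insert p P)
      have "coprime p r" if "r \<in> P" for r
        using insert that primes_coprime[of p r] by auto
      hence "coprime (p ^ q) (\<Prod>p\<in>P. p ^ q)"
        by (intro prod_coprime_right) simp
      with insert show ?case by (simp add: divides_mult)
    qed simp
    thus "(\<Prod>P) ^ q dvd n" by (simp add: prod_power_distrib)
  qed
qed

text \<open>The alternating sum over all subsets of the prime factors is the expanded product of the
  factors 1 - 1.\<close>

lemma sum_mu_divs:
  assumes "n > 0"
  shows "(\<Sum>d | d dvd n. mu d) = (if n = 1 then 1 else 0)"
proof -
  have fin: "finite {d. d dvd n}" using assms by simp
  have "(\<Sum>d | d dvd n. mu d) = (\<Sum>d | squarefree d \<and> d ^ 1 dvd n. (-1) ^ card (prime_factors d))"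
    by (rule sum.mono_neutral_cong_right) (use fin in \<open>auto simp: mu_def\<close>)
  also have "\<dots> = (\<Sum>P\<in>Pow {p. prime p \<and> p ^ 1 dvd n}. (-1) ^ card P)"
    by (rule sum.reindex_bij_betw[OF bij_betw_squarefree_divs, of n 1 "\<lambda>P. (-1) ^ card P"]) (use assms in auto)
  also have "{p. prime p \<and> p ^ 1 dvd n} = prime_factors n"
    using assms by (auto simp: in_prime_factors_iff)
  also have "(\<Sum>P\<in>Pow (prime_factors n). (-1) ^ card P) = (\<Prod>p\<in>prime_factors n. (1 - 1 :: real))"
    using prod_diff_conv_sum[of "prime_factors n" "\<lambda>_. 1" "\<lambda>_. 1 :: real"] by simp
  also have "\<dots> = (if n = 1 then 1 else 0)"
  proof (cases "n = 1")
    case False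
    then obtain p where "prime p" "p dvd n" using prime_factor_nat by blast
    hence "p \<in> prime_factors n" using assms by (simp add: in_prime_factors_iff)
    hence "card (prime_factors n) > 0" by (auto simp: card_gt_0_iff)
    thus ?thesis using False by simp
  qed auto
  finally show ?thesis .
qed

section \<open>Dirichlet series of the zeta-function\<close>

definition npow :: "complex \<Rightarrow> nat \<Rightarrow> complex" where
  "npow s n = of_nat n powr (-s)"

lemma npow_exp: "n > 0 \<Longrightarrow> npow s n = exp (- s * of_real (ln (real n)))"
  using of_real_powr_exp[of "real n" "-s"] by (simp add: npow_def)

lemma npow_mult: "m > 0 \<Longrightarrow> n > 0 \<Longrightarrow> npow s (m * n) = npow s m * npow s n"
  by (simp add: npow_exp ln_mult exp_add[symmetric] algebra_simps)

lemma npow_power: "n > 0 \<Longrightarrow> npow s (n ^ q) = npow (of_nat q * s) n"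
  by (simp add: npow_exp ln_realpow algebra_simps)

lemma npow_add: "n > 0 \<Longrightarrow> npow (s + w) n = npow s n * npow w n"
  by (simp add: npow_exp exp_add[symmetric] algebra_simps)

lemma npow_1 [simp]: "npow s (Suc 0) = 1"
  by (simp add: npow_def)

lemma norm_npow: "n > 0 \<Longrightarrow> norm (npow s n) = real n powr (- Re s)"
  by (simp add: npow_exp powr_def)

lemma summable_powr: "\<sigma> > 1 \<Longrightarrow> (\<lambda>n. real n powr (-\<sigma>)) summable_on {0<..}"
  using norm_summable_on_Suc_iff[of "\<lambda>n. real n powr (-\<sigma>)"] summable_Suc_powr by simp

lemma norm_summable_npow:
  assumes "Re s > 1" "\<And>n. norm (a n) \<le> (B::real)"
  shows "(\<lambda>n. norm (a n * npow s n)) summable_on {0<..}"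
proof (rule Infinite_Sum.abs_summable_on_comparison_test')
  show "(\<lambda>n. B * real n powr (- Re s)) summable_on {0<..}"
    by (intro summable_on_cmult_right summable_powr assms)
  show "norm (a n * npow s n) \<le> B * real n powr (- Re s)" if "n \<in> {0<..}" for n
    using that assms(2)[of n] by (auto simp: norm_mult norm_npow intro!: mult_right_mono)
qed

lemma norm_summable_npow':
  assumes "Re s > 1"
  shows "(\<lambda>n. norm (npow s n)) summable_on {0<..}"
  using norm_summable_npow[OF assms, of "\<lambda>_. 1" 1] by simp

lemma has_sum_zeta:
  assumes "Re s > 1"
  shows "(npow s has_sum zeta s) {0<..}"
  unfolding has_sum_Suc_iff_sums[OF norm_summable_npow'[OF assms]]
  using sums_zeta[OF assms] by (simp add: npow_def)

text \<open>The convolution of \<open>mu\<close> with the constant 1 is the unit, so the two series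
  multiply to 1, which also excludes a zero.\<close>

lemma has_sum_mu:
  assumes "Re s > 1"
  shows "((\<lambda>n. of_real (mu n) * npow s n) has_sum (1 / zeta s)) {0<..}" and "zeta s \<noteq> 0"
proof -
  let ?a = "\<lambda>n. of_real (mu n) * npow s n"
  let ?c = "\<lambda>n. \<Sum>j\<in>root_divs 1 n. npow s (n div j ^ 1) * ?a j"
  have sm: "(\<lambda>n. norm (?a n)) summable_on {0<..}"
    by (rule norm_summable_npow[OF assms, of _ 1]) (simp add: abs_mu_le)
  define M where "M = infsum ?a {0<..}"
  have M: "(?a has_sum M) {0<..}" unfolding M_def by (rule has_sum_infsum, rule abs_summable_summable, rule sm)
  have "(?c has_sum zeta s * M) {0<..}"
    by (rule has_sum_dirichlet_conv[OF has_sum_zeta[OF assms] norm_summable_npow'[OF assms] M sm]) simp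
  also have "?this \<longleftrightarrow> ((\<lambda>n::nat. if n = 1 then 1 else 0) has_sum zeta s * M) {0<..}"
  proof (rule has_sum_cong)
    fix n :: nat assume n: "n \<in> {0<..}"
    have "?c n = (\<Sum>j | j dvd n. npow s n * of_real (mu j))"
    proof (rule sum.cong)
      fix j assume j: "j \<in> {j. j dvd n}"
      then obtain k where k: "n = j * k" by blast
      with n have "j > 0" "k > 0" by auto
      thus "npow s (n div j ^ 1) * ?a j = npow s n * of_real (mu j)"
        by (simp add: k npow_mult)
    qed (simp add: root_divs_def)
    also have "\<dots> = npow s n * of_real (\<Sum>j | j dvd n. mu j)" by (simp add: sum_distrib_left)
    also have "\<dots> = (if n = 1 then 1 else 0)" using n by (simp add: sum_mu_divs)
    finally show "?c n = (if n = 1 then 1 else 0)" .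
  qed
  finally have "((\<lambda>n::nat. if n = 1 then 1 else 0 :: complex) has_sum zeta s * M) {0<..}" .
  moreover have "((\<lambda>n::nat. if n = 1 then 1 else 0 :: complex) has_sum 1) {0<..}"
    by (rule has_sum_finite_neutralI[of "{1}"]) auto
  ultimately have *: "zeta s * M = 1" by (rule has_sum_unique)
  thus "zeta s \<noteq> 0" by auto
  with * have "M = 1 / zeta s" by (simp add: field_simps)
  thus "(?a has_sum (1 / zeta s)) {0<..}" using M by simp
qed

text \<open>The coefficients of both series are at most 1 in modulus, so the value of the zeta
  series at \<sigma> bounds both functions.\<close>

lemma zeta_bounds_right:
  assumes "\<sigma> > 1"
  obtains B where "B \<ge> 1" "\<And>s. Re s \<ge> \<sigma> \<Longrightarrow> norm (zeta s) \<le> B" "\<And>s. Re s \<ge> \<sigma> \<Longrightarrow> norm (1 / zeta s) \<le> B"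
proof -
  define B where "B = infsum (\<lambda>n. real n powr (-\<sigma>)) {0<..}"
  have B: "((\<lambda>n. real n powr (-\<sigma>)) has_sum B) {0<..}"
    unfolding B_def by (rule has_sum_infsum[OF summable_powr[OF assms]])
  have *: "norm S \<le> B" if "(f has_sum S) {0<..}" "\<And>n. n > 0 \<Longrightarrow> norm (f n) \<le> real n powr (-\<sigma>)" for f and S :: complex
    by (rule norm_infsum_le[OF that(1) B]) (use that in auto)
  have mono: "norm (npow s n) \<le> real n powr (-\<sigma>)" if "Re s \<ge> \<sigma>" "n > 0" for s n
    using that by (auto simp: norm_npow intro!: powr_mono)
  show ?thesis
  proof (rule that)
    show "norm (zeta s) \<le> B" if "Re s \<ge> \<sigma>" for s
      by (rule *[OF has_sum_zeta mono]) (use that assms in auto)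
    show "norm (1 / zeta s) \<le> B" if "Re s \<ge> \<sigma>" for s
    proof (rule *[OF has_sum_mu(1)])
      show "norm (of_real (mu n) * npow s n) \<le> real n powr (-\<sigma>)" if n: "n > 0" for n
        using mono[OF \<open>Re s \<ge> \<sigma>\<close> n] abs_mu_le[of n]
        by (auto simp: norm_mult intro: order_trans[OF mult_left_le_one_le])
    qed (use that assms in auto)
    have "1 \<le> sum (\<lambda>n. real n powr (-\<sigma>)) {1}" by simp
    also have "\<dots> \<le> B" unfolding B_def by (rule finite_sum_le_infsum[OF summable_powr[OF assms]]) auto
    finally show "B \<ge> 1" by simp
  qed
qed

abbreviation zeta_nld :: "complex \<Rightarrow> complex" where
  "zeta_nld s \<equiv> - deriv zeta s / zeta s"

text \<open>The convolution of the von Mangoldt function with 1 is the logarithm, so its series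
  times \<open>zeta\<close> is minus the termwise derivative of the series of
  \<open>zeta\<close>.\<close>

lemma has_sum_mangoldt:
  assumes s: "Re s > 1"
  shows "((\<lambda>n. mangoldt n * npow s n) has_sum (zeta_nld s)) {0<..}"
    "(\<lambda>n. norm (mangoldt n * npow s n :: complex)) summable_on {0<..}"
proof -
  let ?c = "\<lambda>n. \<Sum>j\<in>root_divs 1 n. npow s (n div j ^ 1) * (mangoldt j * npow s j)"
  \<comment> \<open>Half the distance to the line of abscissa 1 is spent on the logarithm, by ln n =
    O(n^\<delta>); the other half keeps the exponent above 1.\<close>
  define \<delta> where "\<delta> = (Re s - 1) / 2"
  have \<delta>: "\<delta> > 0" using s by (simp add: \<delta>_def)
  have ln_le: "ln (real n) \<le> (1 / \<delta>) * real n powr \<delta>" if "n > 0" for n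
    using ln_powr_bound[of "real n" \<delta>] that \<delta> by simp
  have bd: "norm (a n * npow s n) \<le> (1 / \<delta>) * real n powr (- (1 + \<delta>))"
    if "norm (a n) \<le> ln (real n)" "n > 0" for a :: "nat \<Rightarrow> complex" and n
  proof -
    have "norm (a n * npow s n) \<le> ((1 / \<delta>) * real n powr \<delta>) * real n powr (- Re s)"
      unfolding norm_mult norm_npow[OF that(2)]
      by (intro mult_right_mono order_trans[OF that(1) ln_le[OF that(2)]]) auto
    also have "\<dots> = (1 / \<delta>) * (real n powr (\<delta> + - Re s))" by (simp only: powr_add mult.assoc)
    also have "\<delta> + - Re s = - (1 + \<delta>)" by (simp add: \<delta>_def field_simps)
    finally show ?thesis .
  qed
  have sm: "(\<lambda>n. norm (a n * npow s n)) summable_on {0<..}"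
    if "\<And>n. n > 0 \<Longrightarrow> norm (a n) \<le> ln (real n)" for a :: "nat \<Rightarrow> complex"
  proof (rule Infinite_Sum.abs_summable_on_comparison_test')
    show "(\<lambda>n. (1 / \<delta>) * real n powr (- (1 + \<delta>))) summable_on {0<..}"
      using \<delta> by (intro summable_on_cmult_right summable_powr) auto
  qed (use bd that in auto)
  show smL: "(\<lambda>n. norm (mangoldt n * npow s n :: complex)) summable_on {0<..}"
    by (rule sm) (use mangoldt_le in auto)
  have sml: "(\<lambda>n. norm (of_real (ln (real n)) * npow s n :: complex)) summable_on {0<..}"
    by (rule sm) (auto simp: ln_ge_zero_iff)
  define L where "L = (\<Sum>\<^sub>\<infinity>n\<in>{0<..}. mangoldt n * npow s n)"
  have L: "((\<lambda>n. mangoldt n * npow s n) has_sum L) {0<..}"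
    unfolding L_def by (rule has_sum_infsum, rule abs_summable_summable, rule smL)
  have "(?c has_sum zeta s * L) {0<..}"
    by (rule has_sum_dirichlet_conv[OF has_sum_zeta[OF s] norm_summable_npow'[OF s] L smL]) simp
  also have "?this \<longleftrightarrow> ((\<lambda>n. of_real (ln (real n)) * npow s n) has_sum zeta s * L) {0<..}"
  proof (rule has_sum_cong)
    fix n :: nat assume n: "n \<in> {0<..}"
    have "?c n = (\<Sum>j | j dvd n. mangoldt j * npow s n)"
    proof (rule sum.cong)
      fix j assume j: "j \<in> {j. j dvd n}"
      then obtain k where k: "n = j * k" by blast
      with n have "j > 0" "k > 0" by auto
      thus "npow s (n div j ^ 1) * (mangoldt j * npow s j) = mangoldt j * npow s n"
        by (simp add: k npow_mult)
    qed (simp add: root_divs_def)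
    also have "\<dots> = of_real (ln (real n)) * npow s n" using n by (simp add: mangoldt_sum flip: sum_distrib_right)
    finally show "?c n = of_real (ln (real n)) * npow s n" .
  qed
  finally have 1: "(\<lambda>n. of_real (ln (real (Suc n))) * npow s (Suc n)) sums (zeta s * L)"
    using has_sum_Suc_iff_sums[OF sml] by simp
  define S where "S = {w. Re w > 1 + \<delta>}"
  have smS: "summable (\<lambda>n. real (Suc n) powr (- (1 + \<delta>)))"
    using \<delta> by (intro summable_Suc_powr) simp
  obtain g g' where g: "\<forall>w\<in>S. (\<lambda>n. npow w (Suc n)) sums g w \<and>
      (\<lambda>n. - of_real (ln (real (Suc n))) * npow w (Suc n)) sums g' w \<and> (g has_field_derivative g' w) (at w)"
  proof (rule series_and_derivative_comparison[OF _ smS])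
    show "open S" by (simp add: S_def open_halfspace_Re_gt)
    show "((\<lambda>w. npow w (Suc n)) has_field_derivative - of_real (ln (real (Suc n))) * npow w (Suc n)) (at w)" for n w
      unfolding npow_exp[OF zero_less_Suc] by (auto intro!: derivative_eq_intros)
    show "\<forall>\<^sub>F n in sequentially. \<forall>w\<in>S. norm (npow w (Suc n)) \<le> real (Suc n) powr (- (1 + \<delta>))"
      by (intro always_eventually) (auto simp: norm_npow S_def intro!: powr_mono simp del: of_nat_Suc)
  qed
  have sS: "s \<in> S" using s by (simp add: S_def \<delta>_def field_simps)
  have gz: "g w = zeta w" if "w \<in> S" for w
  proof (rule sums_unique2)
    show "(\<lambda>n. npow w (Suc n)) sums g w" using g that by blast
    show "(\<lambda>n. npow w (Suc n)) sums zeta w"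
      unfolding npow_def using that \<delta> by (intro sums_zeta) (simp add: S_def)
  qed
  have "(zeta has_field_derivative g' s) (at s)"
  proof (rule has_field_derivative_transform_within_open[OF _ _ sS gz])
    show "(g has_field_derivative g' s) (at s)" using g sS by blast
    show "open S" unfolding S_def by (rule open_halfspace_Re_gt)
  qed
  hence dz: "deriv zeta s = g' s" by (rule DERIV_imp_deriv)
  have 2: "(\<lambda>n. - (of_real (ln (real (Suc n))) * npow s (Suc n))) sums g' s" using g sS by simp
  have "deriv zeta s = - (zeta s * L)" unfolding dz by (rule sums_unique2[OF 2 sums_minus[OF 1]])
  hence "L = zeta_nld s" using has_sum_mu(2)[OF s] by (simp add: field_simps)
  thus "((\<lambda>n. mangoldt n * npow s n) has_sum (zeta_nld s)) {0<..}" using L by simp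
qed

section \<open>Non-vanishing on the line of real part one\<close>

lemma open_right: "open {s. Re s > c}" and convex_right: "convex {s. Re s > c}"
  by (simp_all add: open_halfspace_Re_gt convex_halfspace_Re_gt)

lemma has_field_derivative_zeta_reg:
  assumes "Re s > 0" "s \<noteq> 1"
  shows "(zeta_reg has_field_derivative (zeta s + (s - 1) * deriv zeta s)) (at s)"
proof -
  have "zeta holomorphic_on - {1}" using zeta_props by blast
  hence z: "(zeta has_field_derivative deriv zeta s) (at s)"
    by (rule holomorphic_derivI) (use assms in auto)
  have "((\<lambda>s. (s - 1) * zeta s) has_field_derivative (zeta s + (s - 1) * deriv zeta s)) (at s)"
    by (rule derivative_eq_intros z refl)+ simp
  thus ?thesis
  proof (rule has_field_derivative_transform_within_open)
    show "open ({s. Re s > 0} - {1})" using open_right by (intro open_delete)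
    show "s \<in> {s. Re s > 0} - {1}" using assms by simp
    show "(w - 1) * zeta w = zeta_reg w" if "w \<in> {s. Re s > 0} - {1}" for w
      using that by (simp add: zeta_reg_eq)
  qed
qed

lemma logderiv_zeta_reg:
  assumes "Re s > 1"
  shows "zeta_nld s = 1 / (s - 1) - deriv zeta_reg s / zeta_reg s"
proof -
  have s: "s \<noteq> 1" "Re s > 0" using assms by auto
  have d: "deriv zeta_reg s = zeta s + (s - 1) * deriv zeta s"
    by (rule DERIV_imp_deriv[OF has_field_derivative_zeta_reg[OF s(2,1)]])
  show ?thesis using has_sum_mu(2)[OF assms] s unfolding d by (simp add: zeta_reg_eq add_divide_distrib)
qed

text \<open>\<open>n\<close> is the order of vanishing of \<open>f\<close> at \<open>z\<close>;
  multiplying by \<open>s - z\<close> isolates the principal part of the logarithmic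
  derivative.\<close>

lemma logderiv_limit:
  assumes hol: "f holomorphic_on S" and S: "open S" "connected S" "z \<in> S" and nc: "\<not> f constant_on S"
  obtains n :: nat where "((\<lambda>s. (s - z) * (deriv f s / f s)) \<longlongrightarrow> of_nat n) (at z)" "n = 0 \<longleftrightarrow> f z \<noteq> 0"
proof (cases "f z = 0")
  case True
  obtain g r n where g: "0 < n" "0 < r" "ball z r \<subseteq> S" "g holomorphic_on ball z r"
    "\<And>w. w \<in> ball z r \<Longrightarrow> f w = (w - z)^n * g w" "\<And>w. w \<in> ball z r \<Longrightarrow> g w \<noteq> 0"
    using holomorphic_factor_zero_nonconstant[OF hol S(1,2,3) True nc] by metis
  have eq: "(w - z) * (deriv f w / f w) = of_nat n + (w - z) * (deriv g w / g w)" if w: "w \<in> ball z r" "w \<noteq> z" for w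
  proof -
    have dg: "(g has_field_derivative deriv g w) (at w)" by (rule holomorphic_derivI[OF g(4) _ w(1)]) simp
    have "((\<lambda>w. (w - z)^n * g w) has_field_derivative (of_nat n * (w - z)^(n-1) * g w + (w - z)^n * deriv g w)) (at w)"
      by (rule derivative_eq_intros dg refl)+ simp
    hence "(f has_field_derivative (of_nat n * (w - z)^(n-1) * g w + (w - z)^n * deriv g w)) (at w)"
      by (rule has_field_derivative_transform_within_open[of _ _ _ "ball z r"]) (use w g(5) in auto)
    hence "deriv f w = of_nat n * (w - z)^(n-1) * g w + (w - z)^n * deriv g w" by (rule DERIV_imp_deriv)
    moreover have "(w - z) * (w - z)^(n-1) = (w - z)^n" using g(1) by (cases n) auto
    ultimately have "(w - z) * deriv f w = (of_nat n + (w - z) * (deriv g w / g w)) * f w"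
      using g(6)[OF w(1)] unfolding g(5)[OF w(1)] by (simp add: field_simps)
    moreover have "f w \<noteq> 0" using g(5,6)[OF w(1)] w(2) by simp
    ultimately show ?thesis by (simp add: field_simps)
  qed
  have "isCont (\<lambda>w. of_nat n + (w - z) * (deriv g w / g w)) z"
  proof -
    have "continuous_on (ball z r) g" "continuous_on (ball z r) (deriv g)"
      using g(4) by (auto intro!: holomorphic_on_imp_continuous_on holomorphic_deriv)
    hence "isCont g z" "isCont (deriv g) z" using g(2) by (auto simp: continuous_on_eq_continuous_at)
    thus ?thesis using g(6)[of z] g(2) by (intro continuous_intros) auto
  qed
  hence "((\<lambda>w. of_nat n + (w - z) * (deriv g w / g w)) \<longlongrightarrow> of_nat n) (at z)"
    by (simp add: isCont_def)
  hence "((\<lambda>s. (s - z) * (deriv f s / f s)) \<longlongrightarrow> of_nat n) (at z)"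
  proof (rule Lim_transform_within_open)
    show "open (ball z r)" "z \<in> ball z r" using g(2) by auto
    show "of_nat n + (w - z) * (deriv g w / g w) = (w - z) * (deriv f w / f w)" if "w \<in> ball z r" "w \<noteq> z" for w
      using eq[OF that] by simp
  qed
  thus ?thesis using that g(1) True by blast
next
  case False
  have "continuous_on S f" "continuous_on S (deriv f)"
    using hol S by (auto intro!: holomorphic_on_imp_continuous_on holomorphic_deriv)
  hence "isCont f z" "isCont (deriv f) z" using S by (auto simp: continuous_on_eq_continuous_at)
  hence "isCont (\<lambda>s. (s - z) * (deriv f s / f s)) z" using False by (intro continuous_intros)
  hence "((\<lambda>s. (s - z) * (deriv f s / f s)) \<longlongrightarrow> of_nat 0) (at z)" by (simp add: isCont_def)
  thus ?thesis using that False by blast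
qed

text \<open>Positivity comes from 3 + 4 cos x + cos(2 x) = 2 (1 + cos x)^2 together with the
  nonnegative von Mangoldt coefficients.\<close>

lemma mangoldt_341:
  assumes "\<sigma> > 1"
  shows "Re (3 * (zeta_nld (of_real \<sigma>)) + 4 * (zeta_nld (Complex \<sigma> t))
    + (zeta_nld (Complex \<sigma> (2 * t)))) \<ge> 0"
proof -
  let ?L = "\<lambda>s n. mangoldt n * npow s n :: complex"
  have r: "Re (Complex \<sigma> u) > 1" for u using assms by simp
  have c: "complex_of_real \<sigma> = Complex \<sigma> 0" by (simp add: Complex_eq)
  have "((\<lambda>n. 3 * ?L (Complex \<sigma> 0) n + 4 * ?L (Complex \<sigma> t) n + ?L (Complex \<sigma> (2 * t)) n) has_sum
    (3 * (zeta_nld (Complex \<sigma> 0)) + 4 * (zeta_nld (Complex \<sigma> t))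
    + (zeta_nld (Complex \<sigma> (2 * t))))) {0<..}"
    by (intro has_sum_add has_sum_cmult_right has_sum_mangoldt(1) r)
  note h = has_sum_Re[OF this]
  show ?thesis unfolding c
  proof (rule has_sum_nonneg[OF h])
    fix n :: nat assume n: "n \<in> {0<..}"
    have Re: "Re (?L (Complex \<sigma> u) n) = mangoldt n * (exp (-\<sigma> * ln n) * cos (u * ln n))" for u
    proof -
      have "Re (npow (Complex \<sigma> u) n) = exp (-\<sigma> * ln n) * cos (u * ln n)"
        using n by (simp add: npow_exp Re_exp)
      moreover have "(mangoldt n :: complex) = of_real (mangoldt n)" by simp
      ultimately show ?thesis by (metis Re_complex_of_real times_complex.sel(1) Im_complex_of_real mult_zero_left diff_zero)
    qed
    have "Re (3 * ?L (Complex \<sigma> 0) n + 4 * ?L (Complex \<sigma> t) n + ?L (Complex \<sigma> (2 * t)) n)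
      = 3 * Re (?L (Complex \<sigma> 0) n) + 4 * Re (?L (Complex \<sigma> t) n) + Re (?L (Complex \<sigma> (2 * t)) n)"
      by simp
    also have "\<dots> = mangoldt n * exp (-\<sigma> * ln n) * (3 + 4 * cos (t * ln n) + cos (2 * (t * ln n)))"
      unfolding Re by (simp add: algebra_simps)
    also have "3 + 4 * cos x + cos (2 * x) = 2 * (1 + cos x)^2" for x :: real
      unfolding cos_double_cos by (simp add: power2_eq_square algebra_simps)
    finally show "Re (3 * ?L (Complex \<sigma> 0) n + 4 * ?L (Complex \<sigma> t) n + ?L (Complex \<sigma> (2 * t)) n) \<ge> 0"
      by (simp add: mangoldt_nonneg)
  qed
qed

text \<open>The Riemann hypothesis speaks about the open strip only, so this line needs the
  classical argument. As it is approached from the right, the left-hand side of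
  \<open>mangoldt_341\<close>, multiplied by the distance, tends to 3 - 4 n1 - n2, where n1 and n2
  are the orders of vanishing at the ordinates \<open>t\<close> and \<open>2 * t\<close>. This is
  negative if n1 is positive.\<close>

lemma zeta_reg_nonzero_line_1: "zeta_reg (Complex 1 t) \<noteq> 0"
proof
  let ?L = "\<lambda>h u. of_real h * zeta_nld (Complex (1 + h) u)"
  assume 0: "zeta_reg (Complex 1 t) = 0"
  define S where "S = {s. Re s > 0}"
  have S: "open S" "connected S" "zeta_reg holomorphic_on S"
    by (auto simp: S_def open_right convex_right convex_connected holomorphic_zeta_reg)
  have t: "t \<noteq> 0" using 0 zeta_reg_1 by (auto simp: complex_eq_iff one_complex.code)
  have nc: "\<not> zeta_reg constant_on S"
  proof
    assume "zeta_reg constant_on S"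
    hence "zeta_reg (Complex 1 t) = zeta_reg 1" unfolding constant_on_def by (metis (mono_tags) S_def mem_Collect_eq complex.sel(1) one_complex.sel(1) zero_less_one)
    thus False using 0 by simp
  qed
  have lim: "\<exists>n::nat. ((\<lambda>h. ?L h u) \<longlongrightarrow>
       (if u = 0 then 1 else 0) - of_nat n) (at_right 0) \<and> (n = 0 \<longleftrightarrow> zeta_reg (Complex 1 u) \<noteq> 0)" for u
  proof -
    obtain n :: nat where n: "((\<lambda>s. (s - Complex 1 u) * (deriv zeta_reg s / zeta_reg s)) \<longlongrightarrow> of_nat n) (at (Complex 1 u))"
      "n = 0 \<longleftrightarrow> zeta_reg (Complex 1 u) \<noteq> 0"
      by (rule logderiv_limit[OF S(3,1,2) _ nc, of "Complex 1 u"]) (auto simp: S_def)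
    have "filterlim (\<lambda>h. Complex (1 + h) u) (at (Complex 1 u)) (at_right 0)"
      unfolding filterlim_at
    proof
      have "((\<lambda>h::real. Complex 1 u + of_real h) \<longlongrightarrow> Complex 1 u + of_real 0) (at_right 0)" by (intro tendsto_intros)
      thus "((\<lambda>h. Complex (1 + h) u) \<longlongrightarrow> Complex 1 u) (at_right 0)" by (simp add: Complex_eq algebra_simps)
      show "\<forall>\<^sub>F h in at_right 0. Complex (1 + h) u \<in> UNIV \<and> Complex (1 + h) u \<noteq> Complex 1 u"
        by (simp add: eventually_at_filter)
    qed
    from filterlim_compose[OF n(1) this]
    have 1: "((\<lambda>h. of_real h * (deriv zeta_reg (Complex (1 + h) u) / zeta_reg (Complex (1 + h) u))) \<longlongrightarrow> of_nat n) (at_right 0)"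
      by (simp add: Complex_eq algebra_simps)
    \<comment> \<open>Only at ordinate 0 does the pole of \<open>zeta\<close> contribute.\<close>
    have 2: "((\<lambda>h. of_real h / (Complex (1 + h) u - 1)) \<longlongrightarrow> (if u = 0 then 1 else 0)) (at_right 0)"
    proof (cases "u = 0")
      case True
      have "((\<lambda>h::real. 1::complex) \<longlongrightarrow> 1) (at_right 0)" by simp
      moreover have "\<forall>\<^sub>F h in at_right (0::real). 1 = of_real h / (Complex (1 + h) u - 1)"
        using eventually_at_right_less[of "0::real"] by eventually_elim (simp add: True Complex_eq)
      ultimately have "((\<lambda>h. of_real h / (Complex (1 + h) u - 1)) \<longlongrightarrow> 1) (at_right 0)"
        by (rule Lim_transform_eventually)
      thus ?thesis using True by simp
    next
      case False
      have "((\<lambda>h::real. of_real h / (of_real h + \<i> * of_real u)) \<longlongrightarrow> of_real 0 / (of_real 0 + \<i> * of_real u)) (at_right 0)"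
        using False by (intro tendsto_intros) auto
      thus ?thesis using False by (simp add: Complex_eq)
    qed
    have "((\<lambda>h. of_real h / (Complex (1 + h) u - 1) - of_real h * (deriv zeta_reg (Complex (1 + h) u) / zeta_reg (Complex (1 + h) u)))
       \<longlongrightarrow> (if u = 0 then 1 else 0) - of_nat n) (at_right 0)"
      by (intro tendsto_diff 1 2)
    moreover have "\<forall>\<^sub>F h in at_right 0. of_real h / (Complex (1 + h) u - 1) - of_real h * (deriv zeta_reg (Complex (1 + h) u) / zeta_reg (Complex (1 + h) u))
       = ?L h u"
      using eventually_at_right_less[of "0::real"]
    proof eventually_elim
      case (elim h)
      show ?case by (subst logderiv_zeta_reg) (use elim in \<open>simp_all add: right_diff_distrib\<close>)
    qed
    ultimately show ?thesis using n(2) by (auto simp: tendsto_cong)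
  qed
  obtain n0 n1 n2 :: nat where n:
    "((\<lambda>h. ?L h 0) \<longlongrightarrow> 1 - of_nat n0) (at_right 0)"
    "n0 = 0 \<longleftrightarrow> zeta_reg (Complex 1 0) \<noteq> 0"
    "((\<lambda>h. ?L h t) \<longlongrightarrow> 0 - of_nat n1) (at_right 0)"
    "n1 = 0 \<longleftrightarrow> zeta_reg (Complex 1 t) \<noteq> 0"
    "((\<lambda>h. ?L h (2 * t)) \<longlongrightarrow> 0 - of_nat n2) (at_right 0)"
    using lim[of 0] lim[of t] lim[of "2 * t"] t by auto
  have "n0 = 0" using n(2) zeta_reg_1 by (simp add: Complex_eq)
  have "n1 \<ge> 1" using n(4) 0 by auto
  have "((\<lambda>h. Re (3 * ?L h 0 +
     4 * ?L h t +
     ?L h (2 * t))) \<longlongrightarrow>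
     Re (3 * (1 - of_nat n0) + 4 * (0 - of_nat n1) + (0 - of_nat n2))) (at_right 0)"
    by (intro tendsto_intros n)
  moreover have "\<forall>\<^sub>F h in at_right 0. Re (3 * ?L h 0 +
     4 * ?L h t +
     ?L h (2 * t)) \<ge> 0"
    using eventually_at_right_less[of "0::real"]
  proof eventually_elim
    case (elim h)
    let ?f = "\<lambda>u. zeta_nld (Complex (1 + h) u)"
    have "0 \<le> Re (3 * ?f 0 + 4 * ?f t + ?f (2 * t))"
      using mangoldt_341[of "1 + h" t] elim by (simp add: Complex_eq)
    hence "0 \<le> h * Re (3 * ?f 0 + 4 * ?f t + ?f (2 * t))" using elim by simp
    also have "\<dots> = Re (of_real h * (3 * ?f 0 + 4 * ?f t + ?f (2 * t)))" by simp
    also have "of_real h * (3 * ?f 0 + 4 * ?f t + ?f (2 * t)) = 3 * (of_real h * ?f 0) + 4 * (of_real h * ?f t) + of_real h * ?f (2 * t)"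
      by (simp only: distrib_left mult.left_commute)
    finally show ?case .
  qed
  ultimately have "0 \<le> Re (3 * (1 - of_nat n0) + 4 * (0 - of_nat n1) + (0 - of_nat n2))"
    by (intro tendsto_lowerbound[of _ _ "at_right (0::real)"]) auto
  thus False using \<open>n0 = 0\<close> \<open>n1 \<ge> 1\<close> by simp
qed

lemma zeta_reg_nonzero:
  assumes RH: riemann_hypothesis and s: "Re s > 1/2"
  shows "zeta_reg s \<noteq> 0"
proof (cases "Re s = 1")
  case True
  thus ?thesis using zeta_reg_nonzero_line_1[of "Im s"] by (simp add: complex_eq_iff[of s] flip: True)
next
  case False
  hence "s \<noteq> 1" by auto
  have "zeta s \<noteq> 0"
  proof (cases "Re s > 1")
    case True thus ?thesis by (rule has_sum_mu(2))
  next
    case False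
    thus ?thesis using RH s \<open>Re s \<noteq> 1\<close> unfolding riemann_hypothesis_def by force
  qed
  thus ?thesis using \<open>s \<noteq> 1\<close> s by (simp add: zeta_reg_eq)
qed

section \<open>Growth of the zeta-function under the Riemann hypothesis\<close>

text \<open>The map g / (2 M - g) sends the half-plane Re g < M into the unit disc and fixes 0, so
  Schwarz's lemma applies; its conclusion is then solved for g.\<close>

lemma borel_caratheodory:
  assumes hol: "f holomorphic_on ball c R" and A: "\<And>z. z \<in> ball c R \<Longrightarrow> Re (f z) < A"
    and \<rho>: "\<rho> < 1" and z: "z \<in> ball c R" "norm (z - c) \<le> \<rho> * R"
  shows "norm (f z - f c) \<le> 2 * (A - Re (f c)) * \<rho> / (1 - \<rho>)"
proof -
  have R: "R > 0" using z(1) by (metis ball_eq_empty empty_iff not_less)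
  define M where "M = A - Re (f c)"
  have M: "M > 0" using A[of c] R by (simp add: M_def)
  define g where "g = (\<lambda>w. f (c + of_real R * w) - f c)"
  define h where "h = (\<lambda>w. g w / (2 * of_real M - g w))"
  have inb: "c + of_real R * w \<in> ball c R" if "norm w < 1" for w
    using that R by (simp add: dist_norm norm_mult)
  have Reg: "Re (g w) < M" if "norm w < 1" for w
    using A[OF inb[OF that]] by (simp add: g_def M_def)
  have nz: "2 * of_real M - g w \<noteq> 0" if "norm w < 1" for w
    using Reg[OF that] M by (auto simp: complex_eq_iff)
  have holg: "g holomorphic_on ball 0 1"
    unfolding g_def
    by (intro holomorphic_intros holomorphic_on_compose_gen[OF _ hol, unfolded o_def]) (use inb in auto)
  have holh: "h holomorphic_on ball 0 1"
    unfolding h_def using nz by (intro holomorphic_intros holg) auto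
  have lt: "norm (h w) < 1" if w: "norm w < 1" for w
  proof -
    \<comment> \<open>The difference of the two squares is 4 M (M - Re g).\<close>
    have "(norm (g w))^2 < (norm (2 * of_real M - g w))^2"
      using mult_strict_left_mono[OF Reg[OF w] M] unfolding cmod_power2
      by (simp add: power2_eq_square algebra_simps)
    hence "norm (g w) < norm (2 * of_real M - g w)" by (rule power2_less_imp_less) simp
    thus ?thesis using nz[OF w] by (simp add: h_def norm_divide)
  qed
  define w where "w = (z - c) / of_real R"
  have w: "norm w < 1" "norm w \<le> \<rho>" "z = c + of_real R * w"
    using z R by (auto simp: w_def norm_divide dist_norm norm_minus_commute field_simps)
  have "norm (h w) \<le> norm w"
    by (rule Schwarz_Lemma(1)[OF holh _ lt w(1)]) (simp_all add: h_def g_def)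
  also have "\<dots> \<le> \<rho>" by (rule w)
  finally have "norm (g w) \<le> \<rho> * norm (2 * of_real M - g w)"
    using nz[OF w(1)] by (simp add: h_def norm_divide divide_le_eq)
  also have "\<dots> \<le> \<rho> * (2 * M + norm (g w))"
    using M w(2) norm_triangle_ineq4[of "2 * of_real M" "g w"] order_trans[OF norm_ge_zero w(2)]
    by (intro mult_left_mono) (auto simp: norm_mult)
  finally have "norm (g w) \<le> 2 * M * \<rho> / (1 - \<rho>)"
    using \<rho> by (simp add: field_simps)
  thus ?thesis by (simp add: g_def M_def w(3)[symmetric])
qed

text \<open>Does the work of the three circles theorem. Cauchy's estimates on the small disc bound
  the first \<open>N\<close> Taylor coefficients, those on the large disc the rest. The ratio
  \<open>r2 / r1\<close> may exceed 1, which is harmless for fixed \<open>N\<close>.\<close>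

lemma two_radii_bound:
  assumes hol: "g holomorphic_on ball c R" and r: "0 < r1" "r1 < R" "0 < r3" "r3 < R"
    and G1: "\<And>z. norm (z - c) \<le> r1 \<Longrightarrow> norm (g z) \<le> G1"
    and G3: "\<And>z. norm (z - c) \<le> r3 \<Longrightarrow> norm (g z) \<le> G3"
    and z: "norm (z - c) \<le> r2" "r2 < r3"
  shows "norm (g z) \<le> G1 * (\<Sum>k<N. (r2 / r1) ^ k) + G3 * ((r2 / r3) ^ N / (1 - r2 / r3))"
proof -
  define a where "a = (\<lambda>n. (deriv ^^ n) g c / fact n)"
  have cb: "norm (a n) \<le> G / r ^ n" if "0 < r" "r < R" "\<And>z. norm (z - c) \<le> r \<Longrightarrow> norm (g z) \<le> G" for n r G
  proof -
    have sub: "cball c r \<subseteq> ball c R" using that by auto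
    have "norm ((deriv ^^ n) g c) \<le> fact n * G / r ^ n"
    proof (rule Cauchy_inequality)
      show "g holomorphic_on ball c r" using hol by (rule holomorphic_on_subset) (use that in auto)
      show "continuous_on (cball c r) g"
        by (rule continuous_on_subset[OF holomorphic_on_imp_continuous_on[OF hol] sub])
      show "norm (g x) \<le> G" if "norm (c - x) = r" for x
        using that \<open>\<And>z. norm (z - c) \<le> r \<Longrightarrow> norm (g z) \<le> G\<close>[of x] by (simp add: norm_minus_commute)
    qed fact
    thus ?thesis by (simp add: a_def norm_divide field_simps)
  qed
  have r2: "0 \<le> r2" using z(1) norm_ge_zero order_trans by blast
  have G0: "0 \<le> G1" "0 \<le> G3" using order_trans[OF norm_ge_zero G1[of c]] order_trans[OF norm_ge_zero G3[of c]] r by auto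
  have zin: "z \<in> ball c R" using z r by (simp add: dist_norm norm_minus_commute)
  have s: "(\<lambda>n. a n * (z - c) ^ n) sums g z"
    using holomorphic_power_series[OF hol zin] by (simp add: a_def)
  have b1: "norm (a n * (z - c) ^ n) \<le> G1 * (r2 / r1) ^ n" for n
  proof -
    have "norm (a n) * norm (z - c) ^ n \<le> (G1 / r1 ^ n) * r2 ^ n"
      using cb[OF r(1,2) G1] z G0 r by (intro mult_mono power_mono) auto
    thus ?thesis by (simp add: norm_mult norm_power power_divide)
  qed
  have b3: "norm (a n * (z - c) ^ n) \<le> G3 * (r2 / r3) ^ n" for n
  proof -
    have "norm (a n) * norm (z - c) ^ n \<le> (G3 / r3 ^ n) * r2 ^ n"
      using cb[OF r(3,4) G3] z G0 r by (intro mult_mono power_mono) auto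
    thus ?thesis by (simp add: norm_mult norm_power power_divide)
  qed
  have q: "0 \<le> r2 / r3" "r2 / r3 < 1" using r2 z r by auto
  have "(\<lambda>n. G3 * ((r2 / r3) ^ N * (r2 / r3) ^ n)) sums (G3 * ((r2 / r3) ^ N * (1 / (1 - r2 / r3))))"
    using q by (intro sums_mult geometric_sums) auto
  hence gs: "(\<lambda>n. G3 * (r2 / r3) ^ (n + N)) sums (G3 * ((r2 / r3) ^ N / (1 - r2 / r3)))"
    by (simp add: power_add mult_ac)
  have tail: "(\<lambda>n. a (n + N) * (z - c) ^ (n + N)) sums (g z - (\<Sum>n<N. a n * (z - c) ^ n))"
    using s by (subst sums_iff_shift) simp
  have "norm (g z - (\<Sum>n<N. a n * (z - c) ^ n)) \<le> G3 * ((r2 / r3) ^ N / (1 - r2 / r3))"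
    by (rule norm_sums_le[OF tail gs b3])
  moreover have "norm (\<Sum>n<N. a n * (z - c) ^ n) \<le> (\<Sum>n<N. G1 * (r2 / r1) ^ n)"
    by (rule sum_norm_le) (rule b1)
  moreover have "norm (g z) \<le> norm (g z - (\<Sum>n<N. a n * (z - c) ^ n)) + norm (\<Sum>n<N. a n * (z - c) ^ n)"
    by (metis diff_add_cancel norm_triangle_ineq)
  ultimately show ?thesis by (simp add: sum_distrib_left)
qed

text \<open>
  Littlewood's argument on discs around \<open>2 + \<i>t\<close>: a logarithm of \<open>zeta\<close> is bounded on the small disc
  and \<open>O(ln t)\<close> on the large one. Its first \<open>N\<close> Taylor terms inherit the first bound, the others the
  second with a factor that is geometrically small in \<open>N\<close>.
\<close>

lemma zeta_log_growth_disc: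
  assumes RH: riemann_hypothesis and \<delta>: "0 < \<delta>" "\<delta> < 1" and e: "e > 0"
  obtains C where "\<And>s. 1/2 + \<delta> \<le> Re s \<Longrightarrow> Re s \<le> 2 \<Longrightarrow> \<bar>Im s\<bar> \<ge> 2 \<Longrightarrow>
      \<bar>ln (norm (zeta s))\<bar> \<le> C + e * ln (\<bar>Im s\<bar> + 5)"
proof -
  obtain B where B: "B \<ge> 1" "\<And>s. Re s \<ge> 3/2 \<Longrightarrow> norm (zeta s) \<le> B" "\<And>s. Re s \<ge> 3/2 \<Longrightarrow> norm (1 / zeta s) \<le> B"
    using zeta_bounds_right[of "3/2"] by auto
  obtain C where C: "C > 0" "\<And>s. Re s \<ge> 1/2 \<Longrightarrow> norm (zeta_reg s) \<le> C * (1 + norm s) ^ 2"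
    using zeta_reg_bound by blast
  \<comment> \<open>Centred at real part 2, the disc of radius \<open>R\<close> stays to the right
    of 1/2, \<open>r2\<close> reaches the required points down to 1/2 + \<delta>, and
    \<open>r3\<close> lies strictly between.\<close>
  define R where "R = 3/2 - \<delta>/2"
  define r2 where "r2 = 3/2 - \<delta>"
  define r3 where "r3 = 3/2 - 3 * \<delta> / 4"
  have rs: "0 < r2" "r2 < r3" "r3 < R" "R < 3/2" "1/2 < R" "0 < R" "0 < r3" using \<delta> by (auto simp: R_def r2_def r3_def)
  define \<rho> where "\<rho> = r3 / R"
  have \<rho>: "0 < \<rho>" "\<rho> < 1" using rs by (auto simp: \<rho>_def)
  define lB where "lB = ln B"
  have lB: "\<bar>ln (norm (zeta s))\<bar> \<le> lB" if "Re s \<ge> 3/2" for s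
  proof -
    have nz: "zeta s \<noteq> 0" using has_sum_mu(2)[of s] that by simp
    have "ln (norm (zeta s)) \<le> lB" unfolding lB_def using B(1,2) that nz by (subst ln_le_cancel_iff) auto
    moreover have "ln (norm (1 / zeta s)) \<le> lB" unfolding lB_def using B(1,3) that nz by (subst ln_le_cancel_iff) auto
    ultimately show ?thesis using nz by (simp add: norm_divide ln_div)
  qed
  have lB0: "lB \<ge> 0" using B by (simp add: lB_def)
  define G1 where "G1 = 4 * (lB + 1)"
  define k3 where "k3 = 2 * \<rho> / (1 - \<rho>)"
  have k3: "k3 > 0" using \<rho> by (simp add: k3_def)
  \<comment> \<open>\<open>N\<close> is fixed here, independently of the ordinate, so that the part
    of the tail growing with ln t has a coefficient below \<open>e\<close>. The factor 2 is that of
    the logarithm in \<open>A\<close>, which comes from the exponent in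
    \<open>zeta_reg_bound\<close>.\<close>
  have "((\<lambda>N. k3 * 2 * ((r2 / r3) ^ N / (1 - r2 / r3))) \<longlongrightarrow> k3 * 2 * (0 / (1 - r2 / r3))) sequentially"
    using rs by (intro tendsto_intros LIMSEQ_realpow_zero) auto
  hence "\<forall>\<^sub>F N in sequentially. k3 * 2 * ((r2 / r3) ^ N / (1 - r2 / r3)) < e"
    using e by (intro order_tendstoD) auto
  then obtain N where N: "k3 * 2 * ((r2 / r3) ^ N / (1 - r2 / r3)) < e"
    unfolding eventually_sequentially by blast
  let ?g = "(r2 / r3) ^ N / (1 - r2 / r3)"
  define D where "D = lB + G1 * (\<Sum>k<N. (r2 / (1/4)) ^ k) + k3 * (\<bar>ln (2 * C)\<bar> + 1 + lB) * ?g"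
  have main: "\<bar>ln (norm (zeta s))\<bar> \<le> D + e * ln (\<bar>Im s\<bar> + 5)"
    if s: "1/2 + \<delta> \<le> Re s" "Re s \<le> 2" "\<bar>Im s\<bar> \<ge> 2" for s
  proof -
    define t where "t = Im s"
    define c where "c = Complex 2 t"
    have t: "\<bar>t\<bar> \<ge> 2" using s by (simp add: t_def)
    \<comment> \<open>The ordinate is at least 2 and the radius below 3/2, so the disc keeps
      distance 1/2 from the pole.\<close>
    have inball: "Re w > 1/2" "w \<noteq> 1" "norm (w - 1) \<ge> 1/2" "norm w \<le> \<bar>t\<bar> + 4" if "w \<in> ball c R" for w
    proof -
      have d: "norm (w - c) < 3/2" using that rs by (simp add: dist_norm norm_minus_commute)
      have "\<bar>Re (w - c)\<bar> < R" using that abs_Re_le_cmod[of "w - c"] by (simp add: dist_norm norm_minus_commute)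
      thus "Re w > 1/2" using rs by (simp add: c_def)
      have "\<bar>Im (w - c)\<bar> < 3/2" using d abs_Im_le_cmod[of "w - c"] by linarith
      hence "\<bar>Im w\<bar> \<ge> 1/2" using t abs_triangle_ineq2[of t "Im w"] by (simp add: c_def abs_minus_commute)
      thus n: "norm (w - 1) \<ge> 1/2" using abs_Im_le_cmod[of "w - 1"] by simp
      thus "w \<noteq> 1" by auto
      have "norm c \<le> 2 + \<bar>t\<bar>" using cmod_le[of c] by (simp add: c_def)
      thus "norm w \<le> \<bar>t\<bar> + 4" using d norm_triangle_sub[of w c] by linarith
    qed
    have nz: "zeta w \<noteq> 0" if "w \<in> ball c R" for w
      using zeta_reg_nonzero[OF RH inball(1)[OF that]] inball(1,2)[OF that] zeta_reg_eq[of w] by auto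
    have holz: "zeta holomorphic_on ball c R"
    proof (rule holomorphic_on_subset)
      show "zeta holomorphic_on - {1}" using zeta_props by blast
      show "ball c R \<subseteq> - {1}" using inball(2) by blast
    qed
    obtain f where f: "f holomorphic_on ball c R" "\<And>w. w \<in> ball c R \<Longrightarrow> zeta w = exp (f w)"
      using simply_connected_eq_holomorphic_log[OF open_ball, of c R] convex_imp_simply_connected[OF convex_ball] holz nz by blast
    have Ref: "Re (f w) = ln (norm (zeta w))" if "w \<in> ball c R" for w
      using f(2)[OF that] by simp
    define A where "A = \<bar>ln (2 * C)\<bar> + 2 * ln (\<bar>t\<bar> + 5) + 1"
    have ReA: "Re (f w) < A" if w: "w \<in> ball c R" for w
    proof -
      have "norm (zeta w) = norm (zeta_reg w) / norm (w - 1)"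
        using inball(1,2)[OF w] by (simp add: zeta_eq_zeta_reg norm_divide)
      also have "\<dots> \<le> (C * (1 + norm w)^2) / (1/2)"
        using C inball[OF w] by (intro frac_le) auto
      also have "\<dots> \<le> 2 * C * (\<bar>t\<bar> + 5)^2"
        using C(1) inball(4)[OF w] by (auto intro!: power_mono)
      finally have "ln (norm (zeta w)) \<le> ln (2 * C * (\<bar>t\<bar> + 5)^2)"
        using nz[OF w] by (intro ln_mono) auto
      also have "\<dots> = ln (2 * C) + 2 * ln (\<bar>t\<bar> + 5)"
        using C(1) by (simp add: ln_mult ln_realpow)
      finally show ?thesis unfolding Ref[OF w] A_def by linarith
    qed
    define g where "g = (\<lambda>w. f w - f c)"
    have cin: "c \<in> ball c R" using rs by simp
    have Rec: "\<bar>Re (f c)\<bar> \<le> lB" unfolding Ref[OF cin] by (rule lB) (simp add: c_def)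
    have g3: "norm (g w) \<le> k3 * (A + lB)" if w: "norm (w - c) \<le> r3" for w
    proof -
      have wb: "w \<in> ball c R" using w rs by (simp add: dist_norm norm_minus_commute)
      have "norm (g w) \<le> 2 * (A - Re (f c)) * \<rho> / (1 - \<rho>)"
        unfolding g_def by (rule borel_caratheodory[OF f(1) ReA \<rho>(2)]) (use w wb rs in \<open>auto simp: \<rho>_def\<close>)
      also have "\<dots> = k3 * (A - Re (f c))" by (simp add: k3_def)
      also have "\<dots> \<le> k3 * (A + lB)" using k3 Rec by (intro mult_left_mono) auto
      finally show ?thesis .
    qed
    have g1: "norm (g w) \<le> G1" if w: "norm (w - c) \<le> 1/4" for w
    proof -
      have sub: "ball c (1/2) \<subseteq> ball c R" using rs by (intro subset_ball) simp
      have lt: "Re (f u) < lB + 1" if u: "u \<in> ball c (1/2)" for u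
      proof -
        have "\<bar>Re (u - c)\<bar> < 1/2" using u abs_Re_le_cmod[of "u - c"] by (simp add: dist_norm norm_minus_commute)
        hence "- (1/2) < Re (u - c)" by linarith
        hence "Re u \<ge> 3/2" by (simp add: c_def)
        thus ?thesis using lB[of u] Ref[of u] u sub by auto
      qed
      have "norm (g w) \<le> 2 * (lB + 1 - Re (f c)) * (1/2) / (1 - 1/2)"
        unfolding g_def
        by (rule borel_caratheodory[OF holomorphic_on_subset[OF f(1) sub] lt])
           (use w in \<open>auto simp: dist_norm norm_minus_commute\<close>)
      also have "\<dots> \<le> G1" using Rec by (simp add: G1_def)
      finally show ?thesis .
    qed
    have sc: "norm (s - c) \<le> r2"
    proof -
      have "s - c = of_real (Re s - 2)" by (simp add: c_def t_def complex_eq_iff)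
      hence "norm (s - c) = \<bar>Re s - 2\<bar>" by (metis norm_of_real)
      thus ?thesis using s by (simp add: r2_def)
    qed
    hence sin: "s \<in> ball c R" using rs by (simp add: dist_norm norm_minus_commute)
    have "norm (g s) \<le> G1 * (\<Sum>k<N. (r2 / (1/4)) ^ k) + k3 * (A + lB) * ?g"
    proof (rule two_radii_bound[OF _ _ _ rs(7) rs(3) g1 g3 sc rs(2)])
      show "g holomorphic_on ball c R" unfolding g_def by (intro holomorphic_intros f)
    qed (use rs in auto)
    also have "k3 * (A + lB) * ?g = 
        k3 * (\<bar>ln (2 * C)\<bar> + 1 + lB) * ?g +
        (k3 * 2 * ?g) * ln (\<bar>t\<bar> + 5)"
      by (simp add: A_def algebra_simps)
    also have "(k3 * 2 * ?g) * ln (\<bar>t\<bar> + 5) \<le> e * ln (\<bar>t\<bar> + 5)"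
      using N by (intro mult_right_mono) auto
    finally have "norm (g s) \<le> D - lB + e * ln (\<bar>t\<bar> + 5)" by (simp add: D_def)
    moreover have "\<bar>Re (f s) - Re (f c)\<bar> \<le> norm (g s)"
      using abs_Re_le_cmod[of "g s"] by (simp add: g_def)
    ultimately have "\<bar>Re (f s)\<bar> \<le> D + e * ln (\<bar>t\<bar> + 5)" using Rec by linarith
    thus ?thesis unfolding Ref[OF sin] t_def .
  qed
  show ?thesis by (rule that[OF main])
qed

text \<open>Treats \<open>zeta\<close> and its reciprocal alike: absolute convergence for Re s \<ge>
  2, compactness near the real axis, the logarithmic bound elsewhere. A positive \<eta> cuts out the
  pole of \<open>zeta\<close>; the reciprocal is taken with \<eta> = 0.\<close>

lemma growth_from_log_bound:
  fixes F :: "complex \<Rightarrow> complex"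
  assumes RH: riemann_hypothesis and \<delta>: "0 < \<delta>" "\<delta> < 1" and e: "e > 0"
    and right: "\<And>s. Re s \<ge> 2 \<Longrightarrow> norm (F s) \<le> B"
    and log: "\<And>s. Re s > 1/2 \<Longrightarrow> s \<noteq> 1 \<Longrightarrow> norm (F s) \<le> exp \<bar>ln (norm (zeta s))\<bar>"
    and cont: "continuous_on {s. 1/2 + \<delta> \<le> Re s \<and> Re s \<le> 2 \<and> \<bar>Im s\<bar> \<le> 2 \<and> norm (s - 1) \<ge> \<eta>} F"
  obtains C where "C > 0" "\<And>s. 1/2 + \<delta> \<le> Re s \<Longrightarrow> norm (s - 1) \<ge> \<eta> \<Longrightarrow> norm (F s) \<le> C * (1 + \<bar>Im s\<bar>) powr e"
proof -
  let ?K = "{s. 1/2 + \<delta> \<le> Re s \<and> Re s \<le> 2 \<and> \<bar>Im s\<bar> \<le> 2 \<and> norm (s - 1) \<ge> \<eta>}"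
  obtain C1 where C1: "\<And>s. 1/2 + \<delta> \<le> Re s \<Longrightarrow> Re s \<le> 2 \<Longrightarrow> \<bar>Im s\<bar> \<ge> 2 \<Longrightarrow>
      \<bar>ln (norm (zeta s))\<bar> \<le> C1 + e * ln (\<bar>Im s\<bar> + 5)"
    using zeta_log_growth_disc[OF RH \<delta> e] by blast
  have Keq: "?K = cbox (Complex (1/2 + \<delta>) (-2)) (Complex 2 2) \<inter> {s. norm (s - 1) \<ge> \<eta>}"
    by (auto simp: in_cbox_complex_iff)
  have "closed {s::complex. norm (s - 1) \<ge> \<eta>}"
    by (intro closed_Collect_le continuous_intros)
  hence "compact ?K" unfolding Keq by (intro compact_Int_closed) auto
  hence "bounded (F ` ?K)" by (intro compact_imp_bounded compact_continuous_image cont)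
  then obtain C2 where C2: "C2 > 0" "\<And>s. s \<in> ?K \<Longrightarrow> norm (F s) \<le> C2" unfolding bounded_pos by blast
  define C where "C = \<bar>B\<bar> + C2 + exp C1 * 5 powr e"
  have C: "\<bar>B\<bar> \<le> C" "C2 \<le> C" "exp C1 * 5 powr e \<le> C" "C > 0"
    using C2(1) by (auto simp: C_def add_nonneg_pos)
  have ge1: "1 \<le> (1 + \<bar>Im s\<bar>) powr e" for s using e by (intro ge_one_powr_ge_zero) auto
  have mul: "x \<le> C * (1 + \<bar>Im s\<bar>) powr e" if "x \<le> C" for x s
    using mult_left_mono[OF ge1[of s], of C] that C by linarith
  show ?thesis
  proof (rule that[OF C(4)])
    fix s assume s: "1/2 + \<delta> \<le> Re s" "norm (s - 1) \<ge> \<eta>"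
    consider "Re s \<ge> 2" | "Re s \<le> 2" "\<bar>Im s\<bar> \<le> 2" | "Re s \<le> 2" "\<bar>Im s\<bar> \<ge> 2" by linarith
    thus "norm (F s) \<le> C * (1 + \<bar>Im s\<bar>) powr e"
    proof cases
      case 1
      thus ?thesis using right[of s] C by (intro mul) linarith
    next
      case 2
      thus ?thesis using C2(2)[of s] s C by (intro mul) auto
    next
      case 3
      hence "s \<noteq> 1" by auto
      hence "norm (F s) \<le> exp \<bar>ln (norm (zeta s))\<bar>" using s \<delta> by (intro log) auto
      also have "\<dots> \<le> exp (C1 + e * ln (\<bar>Im s\<bar> + 5))" using C1[OF s(1) 3] by simp
      also have "\<dots> = exp C1 * (\<bar>Im s\<bar> + 5) powr e" by (simp add: exp_add powr_def)
      also have "\<dots> \<le> exp C1 * (5 * (1 + \<bar>Im s\<bar>)) powr e"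
        using e by (intro mult_left_mono powr_mono2) auto
      also have "\<dots> = (exp C1 * 5 powr e) * (1 + \<bar>Im s\<bar>) powr e" by (subst powr_mult) auto
      also have "\<dots> \<le> C * (1 + \<bar>Im s\<bar>) powr e" using C by (intro mult_right_mono) auto
      finally show ?thesis .
    qed
  qed
qed

text \<open>Also true at \<open>1\<close>, where \<open>zeta 1 = 0\<close> and \<open>1 / 0 = 0\<close> give the correct value of \<open>1 / zeta\<close>.\<close>

lemma zeta_inverse_eq: "Re s > 0 \<Longrightarrow> 1 / zeta s = (s - 1) / zeta_reg s"
  by (cases "s = 1") (auto simp: zeta_reg_eq)

lemma holomorphic_zeta_inverse:
  assumes RH: riemann_hypothesis
  shows "(\<lambda>s. 1 / zeta s) holomorphic_on {s. Re s > 1/2}"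
proof -
  have "(\<lambda>s. (s - 1) / zeta_reg s) holomorphic_on {s. Re s > 1/2}"
    using zeta_reg_nonzero[OF RH]
    by (intro holomorphic_intros holomorphic_on_subset[OF holomorphic_zeta_reg]) auto
  thus ?thesis by (rule holomorphic_transform) (simp add: zeta_inverse_eq)
qed

lemma exp_abs_ln_bounds:
  assumes "x > (0::real)"
  shows "x \<le> exp \<bar>ln x\<bar>" "1 / x \<le> exp \<bar>ln x\<bar>"
proof -
  have "exp (ln x) \<le> exp \<bar>ln x\<bar>" "exp (- ln x) \<le> exp \<bar>ln x\<bar>" by simp_all
  thus "x \<le> exp \<bar>ln x\<bar>" "1 / x \<le> exp \<bar>ln x\<bar>" using assms by (simp_all add: exp_minus inverse_eq_divide)
qed

lemma zeta_growth:
  assumes RH: riemann_hypothesis and \<delta>: "0 < \<delta>" and e: "e > 0" and \<eta>: "\<eta> > 0"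
  obtains C where "C > 0" "\<And>s. 1/2 + \<delta> \<le> Re s \<Longrightarrow> norm (s - 1) \<ge> \<eta> \<Longrightarrow> norm (zeta s) \<le> C * (1 + \<bar>Im s\<bar>) powr e"
proof -
  \<comment> \<open>The logarithmic bound requires \<delta> < 1; a smaller \<delta> only enlarges
    the half-plane.\<close>
  define d where "d = min \<delta> (1/2)"
  have d: "0 < d" "d < 1" "d \<le> \<delta>" using \<delta> by (auto simp: d_def)
  obtain B where B: "\<And>s. Re s \<ge> 2 \<Longrightarrow> norm (zeta s) \<le> B"
    using zeta_bounds_right[of 2, simplified] by blast
  \<comment> \<open>At a zero of \<open>zeta\<close> the convention \<open>ln 0 = 0\<close> makes
    the right-hand side 1.\<close>
  have log: "norm (zeta s) \<le> exp \<bar>ln (norm (zeta s))\<bar>" if "Re s > 1/2" "s \<noteq> 1" for s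
    using exp_abs_ln_bounds(1)[of "norm (zeta s)"] by (cases "zeta s = 0") auto
  have "continuous_on (- {1}) zeta" using zeta_props by (intro holomorphic_on_imp_continuous_on) blast
  hence cont: "continuous_on {s. 1/2 + d \<le> Re s \<and> Re s \<le> 2 \<and> \<bar>Im s\<bar> \<le> 2 \<and> norm (s - 1) \<ge> \<eta>} zeta"
    by (rule continuous_on_subset) (use \<eta> in auto)
  obtain C where C: "C > 0" "\<And>s. 1/2 + d \<le> Re s \<Longrightarrow> norm (s - 1) \<ge> \<eta> \<Longrightarrow> norm (zeta s) \<le> C * (1 + \<bar>Im s\<bar>) powr e"
    using growth_from_log_bound[OF RH d(1,2) e B log cont] by blast
  show ?thesis by (rule that[OF C(1)]) (use C(2) d in auto)
qed

lemma zeta_inverse_growth: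
  assumes RH: riemann_hypothesis and \<delta>: "0 < \<delta>" and e: "e > 0"
  obtains C where "C > 0" "\<And>s. 1/2 + \<delta> \<le> Re s \<Longrightarrow> norm (1 / zeta s) \<le> C * (1 + \<bar>Im s\<bar>) powr e"
proof -
  define d where "d = min \<delta> (1/2)"
  have d: "0 < d" "d < 1" "d \<le> \<delta>" using \<delta> by (auto simp: d_def)
  obtain B where B: "\<And>s. Re s \<ge> 2 \<Longrightarrow> norm (1 / zeta s) \<le> B"
    using zeta_bounds_right[of 2, simplified] by blast
  have log: "norm (1 / zeta s) \<le> exp \<bar>ln (norm (zeta s))\<bar>" if "Re s > 1/2" "s \<noteq> 1" for s
    using exp_abs_ln_bounds(2)[of "norm (zeta s)"] by (cases "zeta s = 0") (auto simp: norm_divide)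
  have cont: "continuous_on {s. 1/2 + d \<le> Re s \<and> Re s \<le> 2 \<and> \<bar>Im s\<bar> \<le> 2 \<and> norm (s - 1) \<ge> 0} (\<lambda>s. 1 / zeta s)"
    by (rule continuous_on_subset[OF holomorphic_on_imp_continuous_on[OF holomorphic_zeta_inverse[OF RH]]])
       (use d in auto)
  obtain C where C: "C > 0" "\<And>s. 1/2 + d \<le> Re s \<Longrightarrow> norm (s - 1) \<ge> 0 \<Longrightarrow> norm (1 / zeta s) \<le> C * (1 + \<bar>Im s\<bar>) powr e"
    using growth_from_log_bound[OF RH d(1,2) e B log cont] by blast
  show ?thesis by (rule that[OF C(1)]) (use C(2) d in auto)
qed

section \<open>Smoothed tails of the Moebius series\<close>

lemma norm_ge_line:
  assumes "Re s = c" "c \<noteq> 0"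
  shows "norm s \<ge> min \<bar>c\<bar> 1 / 2 * (1 + \<bar>Im s\<bar>)"
proof -
  have 1: "norm s \<ge> \<bar>c\<bar>" "norm s \<ge> \<bar>Im s\<bar>" using assms abs_Re_le_cmod[of s] abs_Im_le_cmod[of s] by auto
  have "min \<bar>c\<bar> 1 * (1 + \<bar>Im s\<bar>) = min \<bar>c\<bar> 1 + min \<bar>c\<bar> 1 * \<bar>Im s\<bar>" by (simp add: algebra_simps)
  also have "\<dots> \<le> \<bar>c\<bar> + 1 * \<bar>Im s\<bar>" by (intro add_mono mult_right_mono) auto
  also have "\<dots> \<le> 2 * norm s" using 1 by linarith
  finally show ?thesis by simp
qed

lemma one_plus_abs_add: "1 + \<bar>a + b\<bar> \<le> (1 + \<bar>a\<bar>) * (1 + \<bar>b :: real\<bar>)"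
proof -
  have "0 \<le> \<bar>a\<bar> * \<bar>b\<bar>" by simp
  moreover have "(1 + \<bar>a\<bar>) * (1 + \<bar>b\<bar>) = 1 + \<bar>a\<bar> + \<bar>b\<bar> + \<bar>a\<bar> * \<bar>b\<bar>" by (simp add: algebra_simps)
  ultimately show ?thesis using abs_triangle_ineq[of a b] by linarith
qed

text \<open>The weight is 1 - (m/y)^K for m = \<open>Suc n\<close> below \<open>y\<close> and 0 from
  there on, so stopping at the ceiling of \<open>y\<close> loses nothing.\<close>

definition mu_head :: "real \<Rightarrow> real \<Rightarrow> complex \<Rightarrow> complex" where
  "mu_head K y w = (\<Sum>n<nat \<lceil>y\<rceil>. of_real (mu (Suc n) * rweight K (y / real (Suc n))) * npow w (Suc n))"

text \<open>The function G of the overview. As the difference of 1 / zeta and a finite sum it is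
  available to the left of the line of abscissa 1 as well, beyond the absolute convergence of its
  series.\<close>

definition mu_tail :: "real \<Rightarrow> real \<Rightarrow> complex \<Rightarrow> complex" where
  "mu_tail K y w = 1 / zeta w - mu_head K y w"

text \<open>Abscissa 1 serves all w with positive real part, because w + s then lies in the region
  of absolute convergence.\<close>

lemma perron_mu:
  assumes w: "Re w > 0" and K: "K > 0" and y: "y > 0"
  shows "((\<lambda>T. vline 1 T (\<lambda>s. 1 / zeta (w + s) * of_real y powr s / (s * (s + of_real K)))) \<longlongrightarrow>
     2 * pi / K * mu_head K y w) at_top"
proof -
  let ?a = "\<lambda>n. of_real (mu (Suc n)) * npow w (Suc n)"
  have A: "(\<lambda>n. ?a n * of_nat (Suc n) powr (-s)) sums (1 / zeta (w + s))" if "Re s = 1" for s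
  proof -
    have r: "Re (w + s) > 1" using w that by simp
    have sm: "(\<lambda>n. norm (of_real (mu n) * npow (w + s) n)) summable_on {0<..}"
      by (rule norm_summable_npow[OF r, of _ 1]) (simp add: abs_mu_le)
    have "(\<lambda>n. of_real (mu (Suc n)) * npow (w + s) (Suc n)) sums (1 / zeta (w + s))"
      using has_sum_mu(1)[OF r] unfolding has_sum_Suc_iff_sums[OF sm] .
    thus ?thesis by (simp add: npow_add mult.assoc npow_def[of s, symmetric] del: of_nat_Suc)
  qed
  have "Re (w + 1) > 1" using w by simp
  hence "(\<lambda>n. norm (of_real (mu n) * npow (w + 1) n)) summable_on {0<..}"
    by (rule norm_summable_npow[where B = 1]) (simp add: abs_mu_le)
  hence "summable (\<lambda>n. norm (of_real (mu (Suc n)) * npow (w + 1) (Suc n)))"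
    by (simp only: norm_summable_on_Suc_iff)
  hence sm: "summable (\<lambda>n. norm (?a n) * real (Suc n) powr (-1))"
    by (simp add: npow_add norm_mult norm_npow mult.assoc powr_minus del: of_nat_Suc)
  have "((\<lambda>T. vline 1 T (\<lambda>s. 1 / zeta (w + s) * of_real y powr s / (s * (s + of_real K)))) \<longlongrightarrow>
     2 * pi / K * (\<Sum>n<nat \<lceil>y\<rceil>. ?a n * rweight K (y / real (Suc n)))) at_top"
    by (rule perron_series[OF K _ y sm A]) (use y in \<open>auto simp: of_nat_ceiling\<close>)
  also have "(\<Sum>n<nat \<lceil>y\<rceil>. ?a n * rweight K (y / real (Suc n))) = mu_head K y w"
    unfolding mu_head_def by (intro sum.cong) (auto simp: mult_ac)
  finally show ?thesis .
qed

text \<open>The Perron integral of \<open>mu_head\<close> is moved from abscissa 1 to c = 1/2 +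
  \<delta> - a, where w + s has real part 1/2 + \<delta>. The pole at 0 contributes 1 / zeta w, so
  the integral that remains is the tail up to a constant factor, of size y^c. \<open>K > a\<close>
  leaves the pole at -K to the left, and \<open>e \<le> 1/2\<close> makes the integrand absolutely
  integrable.\<close>

lemma mu_tail_bound:
  assumes RH: riemann_hypothesis and a: "a > 1/2 + \<delta>" and \<delta>: "\<delta> > 0" and e: "0 < e" "e \<le> 1/2" and K: "K > a"
  obtains C where "C > 0" "\<And>y w. y \<ge> 1 \<Longrightarrow> Re w = a \<Longrightarrow>
     norm (mu_tail K y w) \<le> C * y powr (1/2 + \<delta> - a) * (1 + \<bar>Im w\<bar>) powr e"
proof -
  obtain C0 where C0: "C0 > 0" "\<And>s. 1/2 + \<delta> \<le> Re s \<Longrightarrow> norm (1 / zeta s) \<le> C0 * (1 + \<bar>Im s\<bar>) powr e"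
    using zeta_inverse_growth[OF RH \<delta> e(1)] by blast
  define c where "c = 1/2 + \<delta> - a"
  have c: "c < 0" "c + K > 0" using a K \<delta> by (auto simp: c_def)
  define \<kappa> where "\<kappa> = min \<bar>c\<bar> 1 / 2 * (min \<bar>c + K\<bar> 1 / 2)"
  have \<kappa>: "\<kappa> > 0" using c by (simp add: \<kappa>_def)
  have K0: "K > 0" using K a \<delta> by linarith
  define C where "C = 4 * (C0 / \<kappa>) * K / (2 * pi)"
  have C: "C > 0" using C0 \<kappa> K0 by (simp add: C_def)
  have main: "norm (mu_tail K y w) \<le> C * y powr c * (1 + \<bar>Im w\<bar>) powr e" if y: "y \<ge> 1" and w: "Re w = a" for y w
  proof -
    define h where "h = (\<lambda>s. 1 / zeta (w + s) * of_real y powr s / (s + of_real K))"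
    have fh: "1 / zeta (w + s) * of_real y powr s / (s * (s + of_real K)) = h s / (s - 0)" for s
      by (simp add: h_def mult_ac)
    let ?h = "\<lambda>s. h s / (s - 0)"
    \<comment> \<open>Right of 1/2 - a the reciprocal of \<open>zeta (w + s)\<close> is holomorphic,
      right of -K the factor 1 / (s + K).\<close>
    define c0 where "c0 = max (1/2 - a) (-K)"
    have c0: "c0 < c" using \<delta> c by (auto simp: c0_def c_def)
    have hol: "h holomorphic_on {s. Re s > c0}"
    proof -
      have 1: "(\<lambda>s. 1 / zeta (w + s)) holomorphic_on {s. Re s > c0}"
        by (rule holomorphic_on_compose_gen[OF _ holomorphic_zeta_inverse[OF RH], unfolded o_def])
           (auto intro!: holomorphic_intros simp: c0_def w)
      have 2: "(\<lambda>s. complex_of_real y powr s) holomorphic_on {s. Re s > c0}"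
        using y by (intro holomorphic_intros) auto
      have "s + of_real K \<noteq> 0" if "Re s > c0" for s
        using that by (auto simp: complex_eq_iff c0_def)
      thus ?thesis unfolding h_def
        by (intro holomorphic_on_divide[OF holomorphic_on_mult[OF 1 2]] holomorphic_intros) auto
    qed
    have zb: "norm (1 / zeta (w + s)) \<le> C0 * ((1 + \<bar>Im w\<bar>) powr e * (1 + \<bar>Im s\<bar>) powr e)" if "Re s \<ge> c" for s
    proof -
      have "norm (1 / zeta (w + s)) \<le> C0 * (1 + \<bar>Im w + Im s\<bar>) powr e"
        using C0(2)[of "w + s"] that w by (simp add: c_def)
      also have "\<dots> \<le> C0 * ((1 + \<bar>Im w\<bar>) * (1 + \<bar>Im s\<bar>)) powr e"
        using C0(1) e one_plus_abs_add[of "Im w" "Im s"] by (intro mult_left_mono powr_mono2) auto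
      finally show ?thesis by (simp add: powr_mult)
    qed
    define W where "W = (1 + \<bar>Im w\<bar>) powr e"
    have W: "W \<ge> 0" by (simp add: W_def)
    let ?B = "C0 / \<kappa> * W * y powr c"
    have lim1: "((\<lambda>T. vline 1 T ?h) \<longlongrightarrow> 2 * pi / K * mu_head K y w) at_top"
      using perron_mu[of w K y] w a \<delta> K0 y unfolding fh by simp
    have lim2: "((\<lambda>T. vline 1 T ?h - vline c T ?h) \<longlongrightarrow> 2 * pi * h 0) at_top"
    proof (rule vline_shift_limit[OF _ _ c0 hol])
      fix s assume s: "c \<le> Re s" "Re s \<le> 1" "\<bar>Im s\<bar> \<ge> (1::real)"
      have n: "norm s \<ge> \<bar>Im s\<bar>" "norm (s + of_real K) \<ge> \<bar>Im s\<bar>"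
        using abs_Im_le_cmod[of s] abs_Im_le_cmod[of "s + of_real K"] by auto
      have "norm (h s / (s - 0)) = norm (1 / zeta (w + s)) * y powr Re s / (norm (s + of_real K) * norm s)"
        unfolding h_def norm_mult norm_divide using y by (simp add: norm_of_real_powr)
      also have "\<dots> \<le> (C0 * (W * (1 + \<bar>Im s\<bar>) powr e)) * y / (\<bar>Im s\<bar> * \<bar>Im s\<bar>)"
      proof (intro frac_le mult_mono)
        show "norm (1 / zeta (w + s)) \<le> C0 * (W * (1 + \<bar>Im s\<bar>) powr e)" using zb[OF s(1)] by (simp add: W_def)
        show "0 < \<bar>Im s\<bar> * \<bar>Im s\<bar>" using s by (intro mult_pos_pos) auto
        show "y powr Re s \<le> y" using powr_mono[of "Re s" 1 y] s y by simp
      qed (use n s C0 W y in auto)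
      also have "(1 + \<bar>Im s\<bar>) powr e \<le> (2 * \<bar>Im s\<bar>) powr e" using s e by (intro powr_mono2) auto
      also have "(2 * \<bar>Im s\<bar>) powr e = 2 powr e * \<bar>Im s\<bar> powr e" by (simp add: powr_mult)
      also have "C0 * (W * (2 powr e * \<bar>Im s\<bar> powr e)) * y / (\<bar>Im s\<bar> * \<bar>Im s\<bar>) =
         (C0 * W * 2 powr e * y) * (\<bar>Im s\<bar> powr e / \<bar>Im s\<bar> powr 2)"
        using s by (simp add: power2_eq_square)
      also have "\<bar>Im s\<bar> powr e / \<bar>Im s\<bar> powr 2 = \<bar>Im s\<bar> powr (- (2 - e))"
        by (simp only: powr_diff[symmetric] minus_diff_eq)
      finally show "norm (h s / (s - 0)) \<le> (C0 * W * 2 powr e * y) * \<bar>Im s\<bar> powr (- (2 - e))"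
        using C0 W y by (simp add: mult_left_mono mult_right_mono divide_right_mono)
    qed (use c e in auto)
    have lim: "((\<lambda>T. vline c T ?h) \<longlongrightarrow> 2 * pi / K * mu_head K y w - 2 * pi * h 0) at_top"
      using tendsto_diff[OF lim1 lim2] by simp
    have bd: "norm (vline c T ?h) \<le> 2 * ?B / (1/2)" if T: "T \<ge> 0" for T
    proof (rule vline_bound[OF _ _ T])
      have "continuous_on {s. Re s = c \<and> \<bar>Im s\<bar> \<le> T} h"
        by (rule continuous_on_subset[OF holomorphic_on_imp_continuous_on[OF hol]]) (use c0 in auto)
      thus "continuous_on {s. Re s = c \<and> \<bar>Im s\<bar> \<le> T} ?h"
        by (rule continuous_on_divide) (use c in \<open>auto intro!: continuous_intros\<close>)
      fix s assume s: "Re s = c"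
      have n1: "norm s \<ge> min \<bar>c\<bar> 1 / 2 * (1 + \<bar>Im s\<bar>)" by (rule norm_ge_line) (use s c in auto)
      have n2: "norm (s + of_real K) \<ge> min \<bar>c + K\<bar> 1 / 2 * (1 + \<bar>Im s\<bar>)"
        using norm_ge_line[of "s + of_real K" "c + K"] s c by simp
      have "norm (h s / (s - 0)) = norm (1 / zeta (w + s)) * y powr Re s / (norm s * norm (s + of_real K))"
        unfolding h_def norm_mult norm_divide using y by (simp add: norm_of_real_powr mult_ac)
      also have "\<dots> \<le> (C0 * (W * (1 + \<bar>Im s\<bar>) powr e)) * y powr c /
          ((min \<bar>c\<bar> 1 / 2 * (1 + \<bar>Im s\<bar>)) * (min \<bar>c + K\<bar> 1 / 2 * (1 + \<bar>Im s\<bar>)))"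
      proof (intro frac_le mult_mono n1 n2)
        show "norm (1 / zeta (w + s)) \<le> C0 * (W * (1 + \<bar>Im s\<bar>) powr e)" using zb[of s] s by (simp add: W_def)
      qed (use s C0 W y c in \<open>auto intro!: mult_pos_pos mult_nonneg_nonneg\<close>)
      also have "\<dots> = ?B * ((1 + \<bar>Im s\<bar>) powr e / (1 + \<bar>Im s\<bar>) powr 2)"
        by (simp add: \<kappa>_def power2_eq_square mult_ac)
      also have "(1 + \<bar>Im s\<bar>) powr e / (1 + \<bar>Im s\<bar>) powr 2 = (1 + \<bar>Im s\<bar>) powr (e - 2)"
        by (simp only: powr_diff)
      also have "?B * (1 + \<bar>Im s\<bar>) powr (e - 2) \<le>
          ?B * (1 + \<bar>Im s\<bar>) powr (-1 - 1/2)"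
        using e C0 \<kappa> W by (intro mult_left_mono powr_mono) auto
      finally show "norm (h s / (s - 0)) \<le> ?B * (1 + \<bar>Im s\<bar>) powr (-1 - 1/2)" .
    qed simp
    have "norm (2 * pi / K * mu_head K y w - 2 * pi * h 0) \<le> 2 * ?B / (1/2)"
    proof (rule Lim_norm_ubound[OF _ lim])
      show "\<forall>\<^sub>F T in at_top. norm (vline c T ?h) \<le> 2 * ?B / (1/2)"
        by (rule eventually_at_top_linorderI[of 0]) (rule bd)
    qed simp
    moreover have "2 * pi / K * mu_head K y w - 2 * pi * h 0 = - (of_real (2 * pi / K) * mu_tail K y w)"
      using K0 y by (simp add: h_def mu_tail_def field_simps)
    ultimately have "(2 * pi / K) * norm (mu_tail K y w) \<le> 4 * ?B"
      using K0 by (simp add: norm_mult norm_divide)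
    hence "(K / (2 * pi)) * ((2 * pi / K) * norm (mu_tail K y w)) \<le> (K / (2 * pi)) * (4 * ?B)"
      using K0 by (intro mult_left_mono) auto
    thus ?thesis using K0 by (simp add: C_def W_def mult_ac)
  qed
  show ?thesis by (rule that[OF C]) (use main in \<open>simp add: c_def\<close>)
qed

section \<open>Riesz sums of the tail\<close>

lemma rweight_bounds: "K > 0 \<Longrightarrow> u > 0 \<Longrightarrow> 0 \<le> rweight K u \<and> rweight K u \<le> 1"
  by (simp add: rweight_def)

text \<open>For m > 0 this is mu m * min 1 ((m/y)^K): the large m in full, the small ones with the
  weight missing from \<open>mu_head\<close>.\<close>

definition mu_tail_coeff :: "real \<Rightarrow> real \<Rightarrow> nat \<Rightarrow> real" where
  "mu_tail_coeff K y m = mu m * (1 - rweight K (y / real m))"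

text \<open>The coefficients of zeta(s) zeta(r s) G(2 r s).\<close>

definition tail_coeff :: "nat \<Rightarrow> real \<Rightarrow> real \<Rightarrow> nat \<Rightarrow> real" where
  "tail_coeff r K y n = (\<Sum>m\<in>root_divs (2 * r) n. real (card (root_divs r (n div m ^ (2 * r)))) * mu_tail_coeff K y m)"

text \<open>The integral of the summatory function of \<open>c\<close> from 0 to X, an unnormalised
  Riesz mean of order one.\<close>

definition riesz :: "(nat \<Rightarrow> real) \<Rightarrow> real \<Rightarrow> real" where
  "riesz c X = (\<Sum>n<nat \<lceil>X\<rceil>. c (Suc n) * max 0 (X - real (Suc n)))"

text \<open>The average of the summatory function over the interval from \<open>a\<close> to
  \<open>b\<close>.\<close>

abbreviation riesz_slope :: "(nat \<Rightarrow> real) \<Rightarrow> real \<Rightarrow> real \<Rightarrow> real" where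
  "riesz_slope c a b \<equiv> (riesz c b - riesz c a) / (b - a)"

lemma abs_mu_tail_coeff_le: "K > 0 \<Longrightarrow> y > 0 \<Longrightarrow> \<bar>mu_tail_coeff K y m\<bar> \<le> 1"
proof (cases "m = 0")
  case False
  assume "K > 0" "y > 0"
  hence "0 \<le> rweight K (y / real m)" "rweight K (y / real m) \<le> 1" using False rweight_bounds[of K "y / real m"] by auto
  thus ?thesis unfolding mu_tail_coeff_def abs_mult using abs_mu_le[of m] by (intro mult_le_one) auto
qed (simp add: mu_tail_coeff_def mu_def)

lemma npow_scale:
  assumes n: "n > 0" and q: "q > 0" and d: "j ^ q dvd n"
  shows "npow s (n div j ^ q) * npow (of_nat q * s) j = npow s n"
proof -
  obtain k where k: "n = j ^ q * k" using d by blast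
  have "k > 0" using n k by (cases k) auto
  moreover have "j > 0" using n q k by (cases j) auto
  ultimately show ?thesis by (simp add: k npow_mult npow_power mult.commute)
qed

lemma has_sum_divisor_count:
  assumes s: "Re s > 1" and r: "r \<ge> 2"
  shows "((\<lambda>n. of_nat (card (root_divs r n)) * npow s n) has_sum (zeta s * zeta (of_nat r * s))) {0<..}"
    "(\<lambda>n. norm (of_nat (card (root_divs r n)) * npow s n)) summable_on {0<..}"
proof -
  have "1 * 1 < real r * Re s" using r s by (intro mult_strict_mono) auto
  hence rs: "Re (of_nat r * s) > 1" by simp
  have r0: "r > 0" using r by simp
  have eq: "(\<Sum>j\<in>root_divs r n. npow s (n div j ^ r) * npow (of_nat r * s) j) = of_nat (card (root_divs r n)) * npow s n"
    if "n \<in> {0<..}" for n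
    using that r0 by (simp add: npow_scale root_divs_def)
  show "((\<lambda>n. of_nat (card (root_divs r n)) * npow s n) has_sum (zeta s * zeta (of_nat r * s))) {0<..}"
    using has_sum_dirichlet_conv[OF has_sum_zeta[OF s] norm_summable_npow'[OF s] has_sum_zeta[OF rs] norm_summable_npow'[OF rs] r0]
    by (subst (asm) has_sum_cong[OF eq]) auto
  show "(\<lambda>n. norm (of_nat (card (root_divs r n)) * npow s n)) summable_on {0<..}"
    using abs_summable_dirichlet_conv[OF norm_summable_npow'[OF s] norm_summable_npow'[OF rs] r0]
    by (subst (asm) summable_on_cong[where g = "\<lambda>n. norm (of_nat (card (root_divs r n)) * npow s n)"]) (simp_all add: eq)
qed

lemma has_sum_mu_tail:
  assumes w: "Re w > 1" and K: "K > 0" and y: "y > 0"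
  shows "((\<lambda>m. of_real (mu_tail_coeff K y m) * npow w m) has_sum mu_tail K y w) {0<..}"
    "(\<lambda>m. norm (of_real (mu_tail_coeff K y m) * npow w m)) summable_on {0<..}"
proof -
  let ?f = "\<lambda>m. of_real (mu m * rweight K (y / real m)) * npow w m"
  have "(?f has_sum mu_head K y w) {0<..}"
  proof (rule has_sum_finite_neutralI[of "{Suc 0..nat \<lceil>y\<rceil>}"])
    show "mu_head K y w = sum ?f {Suc 0..nat \<lceil>y\<rceil>}"
      unfolding mu_head_def by (simp only: sum.atLeast1_atMost_eq)
    fix m assume m: "m \<in> {0<..} - {Suc 0..nat \<lceil>y\<rceil>}"
    hence "y \<le> real m" "m > 0" by (auto simp: nat_less_iff ceiling_less_iff) linarith
    hence "rweight K (y / real m) = 0" using y K by (intro rweight_eq_0) auto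
    thus "?f m = 0" by simp
  qed auto
  from has_sum_add[OF has_sum_mu(1)[OF w] has_sum_cmult_right[OF this, of "-1"]]
  show "((\<lambda>m. of_real (mu_tail_coeff K y m) * npow w m) has_sum mu_tail K y w) {0<..}"
    by (simp add: mu_tail_def mu_tail_coeff_def algebra_simps)
  show "(\<lambda>m. norm (of_real (mu_tail_coeff K y m) * npow w m)) summable_on {0<..}"
    by (rule norm_summable_npow[OF w, of _ 1]) (simp add: abs_mu_tail_coeff_le[OF K y])
qed

lemma has_sum_tail_coeff:
  assumes s: "Re s > 1" and r: "r \<ge> 2" and K: "K > 0" and y: "y > 0"
  shows "((\<lambda>n. of_real (tail_coeff r K y n) * npow s n) has_sum (zeta s * zeta (of_nat r * s) * mu_tail K y (of_nat (2 * r) * s))) {0<..}"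
    "(\<lambda>n. norm (of_real (tail_coeff r K y n) * npow s n)) summable_on {0<..}"
proof -
  have "1 * 1 < real (2 * r) * Re s" using r s by (intro mult_strict_mono) auto
  hence rs: "Re (of_nat (2 * r) * s) > 1" by simp
  have r0: "2 * r > 0" using r by simp
  let ?f = "\<lambda>n. of_nat (card (root_divs r n)) * npow s n"
  let ?g = "\<lambda>m. of_real (mu_tail_coeff K y m) * npow (of_nat (2 * r) * s) m"
  have eq: "(\<Sum>j\<in>root_divs (2 * r) n. ?f (n div j ^ (2 * r)) * ?g j) = of_real (tail_coeff r K y n) * npow s n"
    if n: "n \<in> {0<..}" for n
  proof -
    have "?f (n div j ^ (2 * r)) * ?g j = of_real (real (card (root_divs r (n div j ^ (2 * r)))) * mu_tail_coeff K y j) * npow s n"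
      if "j \<in> root_divs (2 * r) n" for j
    proof -
      have "npow s (n div j ^ (2 * r)) * npow (of_nat (2 * r) * s) j = npow s n"
        using n that r0 by (intro npow_scale) (auto simp: root_divs_def)
      thus ?thesis by (simp add: mult_ac)
    qed
    hence "(\<Sum>j\<in>root_divs (2 * r) n. ?f (n div j ^ (2 * r)) * ?g j) =
        (\<Sum>j\<in>root_divs (2 * r) n. of_real (real (card (root_divs r (n div j ^ (2 * r)))) * mu_tail_coeff K y j) * npow s n)"
      by (rule sum.cong[OF refl])
    also have "\<dots> = of_real (tail_coeff r K y n) * npow s n" unfolding tail_coeff_def of_real_sum sum_distrib_right ..
    finally show ?thesis .
  qed
  show "((\<lambda>n. of_real (tail_coeff r K y n) * npow s n) has_sum (zeta s * zeta (of_nat r * s) * mu_tail K y (of_nat (2 * r) * s))) {0<..}"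
    using has_sum_dirichlet_conv[OF has_sum_divisor_count[OF s r] has_sum_mu_tail[OF rs K y] r0]
    by (subst (asm) has_sum_cong[OF eq]) auto
  show "(\<lambda>n. norm (of_real (tail_coeff r K y n) * npow s n)) summable_on {0<..}"
    using abs_summable_dirichlet_conv[OF has_sum_divisor_count(2)[OF s r] has_sum_mu_tail(2)[OF rs K y] r0]
    by (subst (asm) summable_on_cong[OF arg_cong[OF eq, of _ norm]]) auto
qed

text \<open>Riesz sums are the case K = 1 of the Perron weight, which is the source of the kernel 1
  / (s (s + 1)).\<close>

lemma riesz_eq_rweight:
  assumes "X > 0"
  shows "riesz c X = X * (\<Sum>n<nat \<lceil>X\<rceil>. c (Suc n) * rweight 1 (X / real (Suc n)))"
proof -
  have "max 0 (X - real (Suc n)) = X * rweight 1 (X / real (Suc n))" for n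
    using assms by (simp add: rweight_def powr_minus max_mult_distrib_left right_diff_distrib del: of_nat_Suc)
  thus ?thesis by (simp add: riesz_def sum_distrib_left mult_ac del: of_nat_Suc)
qed

lemma perron_riesz_tail:
  assumes r: "r \<ge> 2" and K: "K > 0" and y: "y > 0" and X: "X > 0"
  shows "((\<lambda>T. of_real X * vline 2 T (\<lambda>s. zeta s * zeta (of_nat r * s) * mu_tail K y (of_nat (2 * r) * s) * of_real X powr s / (s * (s + 1)))) \<longlongrightarrow>
     2 * pi * riesz (tail_coeff r K y) X) at_top"
proof -
  let ?F = "\<lambda>s. zeta s * zeta (of_nat r * s) * mu_tail K y (of_nat (2 * r) * s)"
  let ?a = "\<lambda>n. complex_of_real (tail_coeff r K y (Suc n))"
  have A: "(\<lambda>n. ?a n * of_nat (Suc n) powr (-s)) sums ?F s" if "Re s = 2" for s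
  proof -
    have s: "Re s > 1" using that by simp
    have "(\<lambda>n. of_real (tail_coeff r K y (Suc n)) * npow s (Suc n)) sums ?F s"
      using has_sum_tail_coeff(1)[OF s r K y] unfolding has_sum_Suc_iff_sums[OF has_sum_tail_coeff(2)[OF s r K y]] .
    thus ?thesis unfolding npow_def .
  qed
  have "summable (\<lambda>n. norm (of_real (tail_coeff r K y (Suc n)) * npow 2 (Suc n)))"
    using has_sum_tail_coeff(2)[of 2, OF _ r K y] by (simp only: norm_summable_on_Suc_iff) simp
  hence sm: "summable (\<lambda>n. norm (?a n) * real (Suc n) powr (-2))"
    by (simp add: norm_mult norm_npow del: of_nat_Suc)
  have "((\<lambda>T. vline 2 T (\<lambda>s. ?F s * of_real X powr s / (s * (s + of_real 1)))) \<longlongrightarrow>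
      2 * pi / 1 * (\<Sum>n<nat \<lceil>X\<rceil>. ?a n * rweight 1 (X / real (Suc n)))) at_top"
    by (rule perron_series[OF _ _ X sm A]) (use X in \<open>auto simp: of_nat_ceiling\<close>)
  from tendsto_mult_left[OF this, of "of_real X"]
  show ?thesis unfolding riesz_eq_rweight[OF X] by (simp add: mult_ac sum_distrib_left del: of_nat_Suc)
qed

lemma vline_linear:
  fixes f g :: "complex \<Rightarrow> complex"
  assumes "continuous_on {s. Re s = c \<and> \<bar>Im s\<bar> \<le> T} f" "continuous_on {s. Re s = c \<and> \<bar>Im s\<bar> \<le> T} g"
  shows "vline c T (\<lambda>s. p * f s - q * g s) = p * vline c T f - q * vline c T g"
  unfolding vline_def using vline_integrable[OF assms(1)] vline_integrable[OF assms(2)]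
  by (subst integral_diff) (auto intro: integrable_on_mult_right)

text \<open>Trades the bound of the difference quotient for decay in the ordinate at the cost of a small power.\<close>

lemma min_one_le_powr:
  assumes "x \<ge> 0" "0 \<le> \<theta>" "\<theta> \<le> (1::real)" "v \<le> 1" "v \<le> x"
  shows "v \<le> x powr \<theta>"
proof (cases "x \<ge> 1")
  case True
  thus ?thesis using ge_one_powr_ge_zero[of x \<theta>] assms by linarith
next
  case False
  show ?thesis
  proof (cases "x = 0")
    case False
    have "x powr 1 \<le> x powr \<theta>" using \<open>\<not> x \<ge> 1\<close> assms by (intro powr_mono') auto
    thus ?thesis using assms by simp
  qed (use assms in auto)
qed

text \<open>The first bound, from the mean value inequality, suits small ordinates but cancels one
  of the two decaying factors of the kernel; the second keeps the decay but is too large by about b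
  / (b - a). Interpolating between them gives convergence at the cost of a small power of b / (b -
  a).\<close>

lemma power_difference_bound:
  assumes "0 < a" "a < b" "Re s \<ge> 0"
  shows "norm (of_real b * of_real b powr s - of_real a * of_real a powr s) \<le> norm (s + 1) * b powr Re s * (b - a)" (is "?N \<le> _")
    "norm (of_real b * of_real b powr s - of_real a * of_real a powr s) \<le> 2 * (b * b powr Re s)"
proof -
  define S where "S = closed_segment (complex_of_real a) (of_real b)"
  have S: "z \<in> \<real>" "Re z \<ge> a" "Re z \<le> b" "z \<notin> \<real>\<^sub>\<le>\<^sub>0" if "z \<in> S" for z
  proof -
    have "Im z = 0" "Re z \<in> {a..b}"
      using that assms by (auto simp: S_def closed_segment_same_Im closed_segment_eq_real_ivl)
    thus "z \<in> \<real>" "Re z \<ge> a" "Re z \<le> b" "z \<notin> \<real>\<^sub>\<le>\<^sub>0" using assms by (auto simp: complex_is_Real_iff complex_nonpos_Reals_iff)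
  qed
  have eq: "of_real x * of_real x powr s = complex_of_real x powr (s + 1)" if "x > 0" for x
    using that by (simp add: powr_add)
  have "norm (of_real b powr (s + 1) - complex_of_real a powr (s + 1)) \<le> (norm (s + 1) * b powr Re s) * norm (of_real b - complex_of_real a)"
  proof (rule field_differentiable_bound[where S = S])
    fix z assume z: "z \<in> S"
    show "((\<lambda>z. z powr (s + 1)) has_field_derivative ((s + 1) * z powr (s + 1 - 1))) (at z within S)"
      by (rule DERIV_subset[OF has_field_derivative_powr[OF S(4)[OF z]]]) simp
    have "norm (z powr s) = Re z powr Re s" using S[OF z] assms by (intro norm_powr_real_powr) auto
    also have "\<dots> \<le> b powr Re s" using S[OF z] assms by (intro powr_mono2) auto
    finally show "norm ((s + 1) * z powr (s + 1 - 1)) \<le> norm (s + 1) * b powr Re s"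
      unfolding norm_mult by (intro mult_left_mono) auto
  qed (auto simp: S_def)
  also have "norm (of_real b - complex_of_real a) = b - a"
    using assms by (metis abs_of_pos diff_gt_0_iff_gt norm_of_real of_real_diff)
  finally show "?N \<le> norm (s + 1) * b powr Re s * (b - a)"
    using assms by (simp add: eq)
  have "?N \<le> b * b powr Re s + a * a powr Re s"
    by (rule order_trans[OF norm_triangle_ineq4]) (use assms in \<open>simp add: norm_mult norm_of_real_powr\<close>)
  also have "a * a powr Re s \<le> b * b powr Re s" using assms by (intro mult_mono powr_mono2) auto
  finally show "?N \<le> 2 * (b * b powr Re s)" by simp
qed

section \<open>Splitting the summatory function\<close>

lemma tau_eq_power:
  assumes n: "n > 0" and r: "r \<ge> 1"
  shows "tau (r - 1) n = 2 ^ card {p. prime p \<and> p ^ r dvd n}"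
proof -
  let ?A = "{p \<in> prime_factors n. \<not> multiplicity p n \<le> r - 1}"
  have "?A = {p. prime p \<and> p ^ r dvd n}"
  proof (intro equalityI subsetI)
    fix p assume p: "p \<in> ?A"
    hence "prime p" "r \<le> multiplicity p n" using r by auto
    thus "p \<in> {p. prime p \<and> p ^ r dvd n}" by (simp add: multiplicity_dvd')
  next
    fix p assume p: "p \<in> {p. prime p \<and> p ^ r dvd n}"
    hence "p dvd p ^ r" using r by (intro dvd_power) auto
    hence "p dvd n" using p dvd_trans by blast
    moreover have "r \<le> multiplicity p n"
      using p n by (intro multiplicity_geI) (auto simp: prime_gt_1_nat)
    ultimately show "p \<in> ?A" using p n r by (auto simp: in_prime_factors_iff)
  qed
  moreover have "tau (r - 1) n = (\<Prod>p\<in>?A. 2)"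
    unfolding tau_def by (rule prod.mono_neutral_cong_right) auto
  ultimately show ?thesis by simp
qed

text \<open>m^2 divides d iff m divides its square part, so the divisor sum of \<open>mu\<close>
  over the square part detects squarefreeness.\<close>

lemma sum_mu_square_divs:
  assumes "d > 0"
  shows "(\<Sum>m\<in>root_divs 2 d. mu m) = (if squarefree d then 1 else 0)"
proof -
  have "root_divs 2 d = {m. m dvd square_part d}"
    by (simp add: root_divs_def dvd_square_part_iff)
  moreover have "squarefree d \<longleftrightarrow> square_part d = 1"
  proof
    assume "squarefree d"
    from squarefreeD[OF this square_part_square_dvd] show "square_part d = 1" by simp
  next
    assume *: "square_part d = 1"
    show "squarefree d"
    proof (rule squarefreeI)
      fix x assume "x ^ 2 dvd d"
      hence "x dvd square_part d" by (simp only: dvd_square_part_iff)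
      thus "x dvd 1" by (simp only: *)
    qed
  qed
  moreover have "square_part d > 0" using assms by (intro Nat.gr0I) auto
  ultimately show ?thesis by (simp add: sum_mu_divs)
qed

text \<open>The identity of coefficients behind zeta(s) zeta(r s) / zeta(2 r s). The value 2^k, with
  k the number of primes whose r-th power divides n, counts the squarefree d with d^r dividing n;
  squarefreeness is detected by the sum of \<open>mu\<close> over m^2 dividing d, and d = m^2 l
  turns the double sum into the convolution.\<close>

lemma tau_eq_sum_mu:
  assumes n: "n > 0" and r: "r \<ge> 1"
  shows "real (tau (r - 1) n) = (\<Sum>m\<in>root_divs (2 * r) n. real (card (root_divs r (n div m ^ (2 * r)))) * mu m)"
proof -
  let ?S = "SIGMA m:root_divs (2 * r) n. root_divs r (n div m ^ (2 * r))"
  have fin: "finite (root_divs r n)" using n r by (intro finite_root_divs) auto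
  have pos: "d > 0" if "d \<in> root_divs r n" for d
    using root_divs_pos[OF n _ that] r by simp
  have "tau (r - 1) n = card (Pow {p. prime p \<and> p ^ r dvd n})"
  proof -
    have "finite {p. prime p \<and> p ^ r dvd n}" by (rule finite_subset[OF _ fin]) (auto simp: root_divs_def)
    thus ?thesis using tau_eq_power[OF n r] by (simp add: card_Pow)
  qed
  also have "\<dots> = card {d. squarefree d \<and> d ^ r dvd n}"
    by (rule bij_betw_same_card[OF bij_betw_squarefree_divs, symmetric]) (use n r in auto)
  also have "real \<dots> = (\<Sum>d\<in>root_divs r n. if squarefree d then 1 else 0)"
  proof -
    have "{d. squarefree d \<and> d ^ r dvd n} = {d \<in> root_divs r n. squarefree d}" by (auto simp: root_divs_def)
    thus ?thesis using fin by (simp add: sum.If_cases Int_def)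
  qed
  also have "\<dots> = (\<Sum>d\<in>root_divs r n. \<Sum>m\<in>root_divs 2 d. mu m)"
    by (intro sum.cong refl) (simp add: sum_mu_square_divs pos)
  also have "\<dots> = (\<Sum>(d,m)\<in>(SIGMA d:root_divs r n. root_divs 2 d). mu m)"
    using fin by (intro sum.Sigma) (auto intro: finite_root_divs pos)
  also have "\<dots> = (\<Sum>(m,l)\<in>?S. mu m)"
  proof (rule sum.reindex_bij_witness[of _ "\<lambda>(m,l). (m ^ 2 * l, m)" "\<lambda>(d,m). (m, d div m ^ 2)"])
    fix z assume z: "z \<in> (SIGMA d:root_divs r n. root_divs 2 d)"
    obtain d m where zd: "z = (d, m)" by force
    have dm: "d ^ r dvd n" "m ^ 2 dvd d" using z by (auto simp: zd root_divs_def)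
    then obtain l where l: "d = m ^ 2 * l" by blast
    have d0: "d > 0" by (rule root_divs_pos[OF n]) (use r dm in \<open>auto simp: root_divs_def\<close>)
    hence m0: "m > 0" using l by (cases "m = 0") auto
    have "m ^ (2 * r) * l ^ r dvd n" using dm(1) by (simp add: l power_mult_distrib power_mult)
    then obtain k where k: "n = m ^ (2 * r) * l ^ r * k" by blast
    show "(case case z of (d, m) \<Rightarrow> (m, d div m\<^sup>2) of (m, l) \<Rightarrow> (m\<^sup>2 * l, m)) = z"
      using dm by (simp add: zd)
    show "(case z of (d, m) \<Rightarrow> (m, d div m\<^sup>2)) \<in> ?S"
      using m0 by (simp add: zd root_divs_def k l mult.assoc)
  next
    fix z assume z: "z \<in> ?S"
    obtain m l where zd: "z = (m, l)" by force
    have ml: "m ^ (2 * r) dvd n" "l ^ r dvd n div m ^ (2 * r)" using z by (auto simp: zd root_divs_def)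
    then obtain k where k: "n = m ^ (2 * r) * k" by blast
    have m0: "m > 0" by (rule root_divs_pos[OF n, of "2 * r"]) (use r ml in \<open>auto simp: root_divs_def\<close>)
    show "(case case z of (m, l) \<Rightarrow> (m\<^sup>2 * l, m) of (d, m) \<Rightarrow> (m, d div m\<^sup>2)) = z"
      using m0 by (simp add: zd)
    have "l ^ r dvd k" using ml(2) m0 by (simp add: k)
    thus "(case z of (m, l) \<Rightarrow> (m\<^sup>2 * l, m)) \<in> (SIGMA d:root_divs r n. root_divs 2 d)"
      by (simp add: zd root_divs_def k power_mult_distrib power_mult mult_dvd_mono)
  qed auto
  also have "\<dots> = (\<Sum>m\<in>root_divs (2 * r) n. \<Sum>l\<in>root_divs r (n div m ^ (2 * r)). mu m)"
  proof (rule sum.Sigma[symmetric])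
    show "\<forall>m\<in>root_divs (2 * r) n. finite (root_divs r (n div m ^ (2 * r)))"
    proof
      fix m assume "m \<in> root_divs (2 * r) n"
      hence "m ^ (2 * r) dvd n" by (simp add: root_divs_def)
      hence "n div m ^ (2 * r) > 0" using n by (metis dvd_div_eq_0_iff gr0I less_numeral_extra(3))
      thus "finite (root_divs r (n div m ^ (2 * r)))" using r by (intro finite_root_divs) auto
    qed
  qed (use n r in \<open>auto intro: finite_root_divs\<close>)
  finally show ?thesis by simp
qed

definition head_coeff :: "nat \<Rightarrow> real \<Rightarrow> real \<Rightarrow> nat \<Rightarrow> real" where
  "head_coeff r K y n = (\<Sum>m\<in>root_divs (2 * r) n. real (card (root_divs r (n div m ^ (2 * r)))) * (mu m * rweight K (y / real m)))"

lemma tau_eq_head_plus_tail: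
  assumes "n > 0" "r \<ge> 1"
  shows "real (tau (r - 1) n) = head_coeff r K y n + tail_coeff r K y n"
  unfolding tau_eq_sum_mu[OF assms] head_coeff_def tail_coeff_def mu_tail_coeff_def sum.distrib[symmetric]
  by (intro sum.cong) (auto simp: algebra_simps)

section \<open>Averages of summatory functions\<close>

definition summatory :: "(nat \<Rightarrow> real) \<Rightarrow> real \<Rightarrow> real" where
  "summatory c u = (\<Sum>n | n \<ge> 1 \<and> real n \<le> u. c n)"

lemma summatory_eq: "real N \<ge> u \<Longrightarrow> summatory c u = (\<Sum>n<N. c (Suc n) * (if real (Suc n) \<le> u then 1 else 0))"
proof -
  assume N: "real N \<ge> u"
  have "summatory c u = (\<Sum>n\<in>{Suc 0..N}. c n * (if real n \<le> u then 1 else 0))"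
    unfolding summatory_def by (rule sum.mono_neutral_cong_left) (use N in auto)
  thus ?thesis by (simp only: sum.atLeast1_atMost_eq)
qed

lemma riesz_eq: "real N \<ge> X \<Longrightarrow> riesz c X = (\<Sum>n<N. c (Suc n) * max 0 (X - real (Suc n)))"
  unfolding riesz_def
proof (rule sum.mono_neutral_left)
  assume N: "real N \<ge> X"
  thus "{..<nat \<lceil>X\<rceil>} \<subseteq> {..<N}" by auto
  show "\<forall>n\<in>{..<N} - {..<nat \<lceil>X\<rceil>}. c (Suc n) * max 0 (X - real (Suc n)) = 0"
  proof
    fix n assume "n \<in> {..<N} - {..<nat \<lceil>X\<rceil>}"
    hence "X \<le> real (Suc n)" by (auto simp: nat_le_iff ceiling_le_iff)
    thus "c (Suc n) * max 0 (X - real (Suc n)) = 0" by simp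
  qed
qed auto

text \<open>Nonnegativity makes the summatory function monotone, so its average over an interval
  lies between the end values. This is what finally removes the averaging.\<close>

lemma summatory_riesz_sandwich:
  assumes c: "\<And>n. c n \<ge> 0" and ab: "a < b"
  shows "summatory c a * (b - a) \<le> riesz c b - riesz c a" "riesz c b - riesz c a \<le> summatory c b * (b - a)"
proof -
  define N where "N = nat \<lceil>b\<rceil>"
  have "real N \<ge> b" unfolding N_def by (rule of_nat_ceiling)
  hence N: "real N \<ge> b" "real N \<ge> a" using ab by simp_all
  have R: "riesz c b - riesz c a = (\<Sum>n<N. c (Suc n) * (max 0 (b - real (Suc n)) - max 0 (a - real (Suc n))))"
    unfolding riesz_eq[OF N(1)] riesz_eq[OF N(2)] by (simp add: sum_subtractf[symmetric] right_diff_distrib)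
  show "summatory c a * (b - a) \<le> riesz c b - riesz c a"
    unfolding R summatory_eq[OF N(2)] sum_distrib_right mult.assoc
    using ab by (intro sum_mono mult_left_mono c) auto
  show "riesz c b - riesz c a \<le> summatory c b * (b - a)"
    unfolding R summatory_eq[OF N(1)] sum_distrib_right mult.assoc
    using ab by (intro sum_mono mult_left_mono c) auto
qed

lemma has_integral_step:
  fixes a b n :: real
  assumes "a \<le> b"
  shows "((\<lambda>u. if n \<le> u then 1 else 0) has_integral (max 0 (b - n) - max 0 (a - n))) {a..b}"
proof (rule fundamental_theorem_of_calculus_interior_strong[where S = "{n}"])
  show "continuous_on {a..b} (\<lambda>u. max 0 (u - n))" by (intro continuous_intros)
  fix u assume u: "u \<in> {a<..<b} - {n}"
  show "((\<lambda>u. max 0 (u - n)) has_vector_derivative (if n \<le> u then 1 else 0)) (at u)"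
  proof (cases "n < u")
    case True
    have "((\<lambda>u. u - n) has_real_derivative 1) (at u)" by (auto intro!: derivative_eq_intros)
    hence "((\<lambda>u. max 0 (u - n)) has_real_derivative 1) (at u)"
      by (rule has_field_derivative_transform_within_open[where S = "{n<..}"]) (use True in auto)
    thus ?thesis using True by (simp add: has_real_derivative_iff_has_vector_derivative)
  next
    case False
    have "((\<lambda>u. 0) has_real_derivative 0) (at u)" by simp
    hence "((\<lambda>u. max 0 (u - n)) has_real_derivative 0) (at u)"
      by (rule has_field_derivative_transform_within_open[where S = "{..<n}"]) (use False u in auto)
    thus ?thesis using False u by (auto simp: has_real_derivative_iff_has_vector_derivative)
  qed
qed (use assms in auto)

text \<open>Integrates a pointwise estimate, such as the one for the head, over the interval; the
  average of the linear term is its value at the midpoint.\<close>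

lemma riesz_difference_quotient_bound:
  assumes ab: "a < b" and bd: "\<And>u. a \<le> u \<Longrightarrow> u \<le> b \<Longrightarrow> \<bar>summatory c u + q * u - M\<bar> \<le> E"
  shows "\<bar>riesz_slope c a b + q * ((a + b) / 2) - M\<bar> \<le> E"
proof -
  define N where "N = nat \<lceil>b\<rceil>"
  have N: "real N \<ge> b" unfolding N_def by (rule of_nat_ceiling)
  have R: "riesz c b - riesz c a = (\<Sum>n<N. c (Suc n) * (max 0 (b - real (Suc n)) - max 0 (a - real (Suc n))))"
    using riesz_eq[of b N] riesz_eq[of a N] N ab by (simp add: sum_subtractf[symmetric] right_diff_distrib)
  have "((\<lambda>u. \<Sum>n<N. c (Suc n) * (if real (Suc n) \<le> u then 1 else 0)) has_integral (riesz c b - riesz c a)) {a..b}"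
    unfolding R using ab by (intro has_integral_sum has_integral_mult_right has_integral_step) auto
  hence 1: "(summatory c has_integral (riesz c b - riesz c a)) {a..b}"
  proof (rule has_integral_eq[rotated])
    show "(\<Sum>n<N. c (Suc n) * (if real (Suc n) \<le> u then 1 else 0)) = summatory c u" if "u \<in> {a..b}" for u
      by (rule summatory_eq[symmetric]) (use that N in auto)
  qed
  let ?J = "(q * b^2 / 2 - M * b) - (q * a^2 / 2 - M * a)"
  have 2: "((\<lambda>u. q * u - M) has_integral ?J) {a..b}"
    using ab by (intro fundamental_theorem_of_calculus)
      (auto intro!: derivative_eq_intros simp flip: has_real_derivative_iff_has_vector_derivative)
  have "norm ((riesz c b - riesz c a) + ?J) \<le> E * measure lborel {a..b}"
  proof (rule has_integral_bound_real[OF _ finite.emptyI has_integral_add[OF 1 2]])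
    show "0 \<le> E" using bd[of a] ab by linarith
    show "\<And>u. u \<in> {a..b} - {} \<Longrightarrow> norm (summatory c u + (q * u - M)) \<le> E" using bd by (simp add: add_diff_eq)
  qed
  hence "norm ((riesz c b - riesz c a) + ?J) \<le> E * (b - a)"
    using ab by simp
  moreover have "(riesz c b - riesz c a) + ?J =
      (riesz_slope c a b + q * ((a + b) / 2) - M) * (b - a)"
    using ab by (simp add: power2_eq_square field_simps)
  ultimately have "\<bar>riesz_slope c a b + q * ((a + b) / 2) - M\<bar> * (b - a) \<le> E * (b - a)"
    using ab by (simp add: abs_mult)
  thus ?thesis using ab by simp
qed

section \<open>The head as a sum of lattice point counts\<close>

lemma T1_eq:
  assumes r: "r \<ge> 1"
  shows "real (T1 r x) = summatory (\<lambda>n. real (card (root_divs r n))) x"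
proof -
  let ?A = "{(k :: nat, l :: nat). k \<ge> 1 \<and> l \<ge> 1 \<and> real (k * l ^ r) \<le> x}"
  let ?B = "SIGMA n:{n. n \<ge> 1 \<and> real n \<le> x}. root_divs r n"
  have "T1 r x = (\<Sum>z\<in>?A. 1)" by (simp add: T1_def)
  also have "\<dots> = (\<Sum>z\<in>?B. 1)"
  proof (rule sum.reindex_bij_witness[of _ "\<lambda>(n,l). (n div l ^ r, l)" "\<lambda>(k,l). (k * l ^ r, l)"])
    fix z assume z: "z \<in> ?A"
    obtain k l where zd: "z = (k, l)" by force
    have kl: "k \<ge> 1" "l \<ge> 1" "real (k * l ^ r) \<le> x" using z unfolding zd by blast+
    show "(case case z of (k, l) \<Rightarrow> (k * l ^ r, l) of (n, l) \<Rightarrow> (n div l ^ r, l)) = z"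
      using kl by (simp add: zd)
    have "k * l ^ r \<ge> 1" using kl by (simp add: Suc_le_eq)
    thus "(case z of (k, l) \<Rightarrow> (k * l ^ r, l)) \<in> ?B" using kl(3) by (simp add: zd root_divs_def)
  next
    fix z assume z: "z \<in> ?B"
    obtain n l where zd: "z = (n, l)" by force
    have nl: "n \<ge> 1" "real n \<le> x" "l \<in> root_divs r n" using z unfolding zd by blast+
    have l0: "l > 0" by (rule root_divs_pos[OF _ _ nl(3)]) (use nl(1) r in linarith)+
    obtain k where k: "n = l ^ r * k" using nl by (auto simp: root_divs_def)
    have k0: "k \<ge> 1" using nl(1) unfolding k by (cases k) auto
    show "(case case z of (n, l) \<Rightarrow> (n div l ^ r, l) of (k, l) \<Rightarrow> (k * l ^ r, l)) = z"
      using l0 by (simp add: zd k)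
    show "(case z of (n, l) \<Rightarrow> (n div l ^ r, l)) \<in> ?A"
      using l0 k0 nl(2) by (simp add: zd k mult.commute)
  qed auto
  also have "\<dots> = card ?B" by simp
  also have "\<dots> = (\<Sum>n | n \<ge> 1 \<and> real n \<le> x. card (root_divs r n))"
  proof (rule card_SigmaI)
    have "{n. n \<ge> 1 \<and> real n \<le> x} \<subseteq> {..nat \<lfloor>x\<rfloor>}" by (auto intro: le_nat_floor)
    thus "finite {n. n \<ge> 1 \<and> real n \<le> x}" by (rule finite_subset) simp
    show "\<forall>n\<in>{n. n \<ge> 1 \<and> real n \<le> x}. finite (root_divs r n)" using r by (auto intro: finite_root_divs)
  qed
  finally show ?thesis by (simp add: summatory_def)
qed

text \<open>Grouping by n = m^(2 r) k. Any \<open>M \<ge> u\<close> is allowed because the count is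
  0 once m exceeds u; this leaves room to let the weight cut the sum at y.\<close>

lemma summatory_head_coeff:
  assumes r: "r \<ge> 1" and M: "real M \<ge> u"
  shows "summatory (head_coeff r K y) u = (\<Sum>m\<in>{1..M}. mu m * rweight K (y / real m) * real (T1 r (u / real m ^ (2 * r))))"
proof -
  let ?S = "SIGMA m:{1..M}. {k. k \<ge> 1 \<and> real k \<le> u / real m ^ (2 * r)}"
  let ?A = "{n. n \<ge> 1 \<and> real n \<le> u}"
  let ?w = "\<lambda>m. mu m * rweight K (y / real m)"
  let ?d = "\<lambda>k. real (card (root_divs r k))"
  have finA: "finite {n. n \<ge> 1 \<and> real n \<le> v}" for v
  proof -
    have "{n. n \<ge> 1 \<and> real n \<le> v} \<subseteq> {..nat \<lfloor>v\<rfloor>}" by (auto intro: le_nat_floor)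
    thus ?thesis by (rule finite_subset) simp
  qed
  have "summatory (head_coeff r K y) u = (\<Sum>(n,m)\<in>(SIGMA n:?A. root_divs (2 * r) n). ?d (n div m ^ (2 * r)) * ?w m)"
    unfolding summatory_def head_coeff_def using finA r by (intro sum.Sigma) (auto intro: finite_root_divs)
  also have "\<dots> = (\<Sum>(m,k)\<in>?S. ?w m * ?d k)"
  proof (rule sum.reindex_bij_witness[of _ "\<lambda>(m,k). (m ^ (2 * r) * k, m)" "\<lambda>(n,m). (m, n div m ^ (2 * r))"])
    fix z assume z: "z \<in> (SIGMA n:?A. root_divs (2 * r) n)"
    obtain n m where zd: "z = (n, m)" by force
    have nm: "n \<ge> 1" "real n \<le> u" "m \<in> root_divs (2 * r) n" using z by (auto simp: zd)
    have m0: "m > 0" by (rule root_divs_pos[OF _ _ nm(3)]) (use nm(1) r in linarith)+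
    obtain k where k: "n = m ^ (2 * r) * k" using nm by (auto simp: root_divs_def)
    have "m \<le> m ^ (2 * r) * 1" using m0 r by (simp add: self_le_power)
    also have "m ^ (2 * r) * 1 \<le> m ^ (2 * r) * k" using nm(1) unfolding k by (intro mult_le_mono2) (cases k, auto)
    finally have "m \<le> n" by (simp add: k)
    hence "m \<le> M" using nm M by linarith
    moreover have "real k \<le> u / real m ^ (2 * r)"
      using nm(2) m0 unfolding k by (simp add: le_divide_eq mult.commute)
    moreover have "k \<ge> 1" using nm(1) unfolding k by (cases k) auto
    ultimately show "(case z of (n, m) \<Rightarrow> (m, n div m ^ (2 * r))) \<in> ?S"
      using m0 by (simp add: zd k)
    show "(case case z of (n, m) \<Rightarrow> (m, n div m ^ (2 * r)) of (m, k) \<Rightarrow> (m ^ (2 * r) * k, m)) = z"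
      using m0 by (simp add: zd k)
    show "(case (case z of (n, m) \<Rightarrow> (m, n div m ^ (2 * r))) of (m, k) \<Rightarrow> ?w m * ?d k) = (case z of (n, m) \<Rightarrow> ?d (n div m ^ (2 * r)) * ?w m)"
      by (simp add: zd mult_ac)
  next
    fix z assume z: "z \<in> ?S"
    obtain m k where zd: "z = (m, k)" by force
    have mk: "m \<ge> 1" "k \<ge> 1" "real k \<le> u / real m ^ (2 * r)" using z by (auto simp: zd)
    show "(case case z of (m, k) \<Rightarrow> (m ^ (2 * r) * k, m) of (n, m) \<Rightarrow> (m, n div m ^ (2 * r))) = z"
      using mk by (simp add: zd)
    have "real (m ^ (2 * r) * k) \<le> u" using mk by (simp add: le_divide_eq mult.commute)
    moreover have "m ^ (2 * r) * k \<ge> 1" using mk by (simp add: Suc_le_eq)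
    ultimately show "(case z of (m, k) \<Rightarrow> (m ^ (2 * r) * k, m)) \<in> (SIGMA n:?A. root_divs (2 * r) n)"
      by (simp add: zd root_divs_def)
  qed
  also have "\<dots> = (\<Sum>m\<in>{1..M}. \<Sum>k | k \<ge> 1 \<and> real k \<le> u / real m ^ (2 * r). ?w m * ?d k)"
    using finA by (intro sum.Sigma[symmetric]) auto
  also have "\<dots> = (\<Sum>m\<in>{1..M}. ?w m * real (T1 r (u / real m ^ (2 * r))))"
    by (simp add: T1_eq[OF r] summatory_def sum_distrib_left)
  finally show ?thesis .
qed

section \<open>The contour shift for the tail\<close>

lemma holomorphic_mu_head: "mu_head K y holomorphic_on A"
  unfolding mu_head_def npow_def by (intro holomorphic_intros) (simp del: of_nat_Suc)

text \<open>Crude in \<open>y\<close>, but used only on the horizontal sides, which vanish in the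
  limit for fixed \<open>y\<close>.\<close>

lemma norm_mu_head_le:
  assumes "Re w \<ge> 0" "K > 0" "y > 0"
  shows "norm (mu_head K y w) \<le> real (nat \<lceil>y\<rceil>)"
proof -
  have "norm (of_real (mu (Suc n) * rweight K (y / real (Suc n))) * npow w (Suc n)) \<le> 1" for n
  proof -
    have "0 \<le> rweight K (y / real (Suc n))" "rweight K (y / real (Suc n)) \<le> 1" using rweight_bounds[of K "y / real (Suc n)"] assms by auto
    hence "\<bar>mu (Suc n)\<bar> * rweight K (y / real (Suc n)) \<le> 1" using abs_mu_le[of "Suc n"] by (intro mult_le_one) auto
    moreover have "real (Suc n) powr (- Re w) \<le> 1"
      using powr_mono[of "- Re w" 0 "real (Suc n)"] assms by (simp del: of_nat_Suc)
    ultimately show ?thesis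
      using \<open>0 \<le> rweight K (y / real (Suc n))\<close> by (auto simp: norm_mult norm_npow abs_mult intro!: mult_le_one simp del: of_nat_Suc)
  qed
  hence "norm (mu_head K y w) \<le> (\<Sum>n<nat \<lceil>y\<rceil>. 1)" unfolding mu_head_def by (intro sum_norm_le) auto
  thus ?thesis by simp
qed

text \<open>The product that is subtracted is the residue at 1 of the averaged Perron
  integrand.\<close>

abbreviation riesz_defect :: "nat \<Rightarrow> real \<Rightarrow> real \<Rightarrow> real \<Rightarrow> real \<Rightarrow> complex" where
  "riesz_defect r K y a b \<equiv> of_real (riesz_slope (tail_coeff r K y) a b) - zeta (of_nat r) * mu_tail K y (of_nat (2 * r)) * of_real ((a + b) / 2)"

lemma riesz_tail_bound:
  assumes RH: riemann_hypothesis and r: "r \<ge> 2" and \<delta>: "0 < \<delta>" "\<delta> < 1/2" and e: "0 < e" "e \<le> 1/3"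
    and K: "K \<ge> 2 * real r"
  obtains C where "C > 0" "\<And>y a b. y \<ge> 1 \<Longrightarrow> 0 < a \<Longrightarrow> a < b \<Longrightarrow>
     norm (riesz_defect r K y a b)
       \<le> C * (b powr (1/2 + \<delta>) * (b / (b - a)) powr (3 * e) * y powr (1/2 - real r))"
proof -
  define c where "c = 1/2 + \<delta>"
  have c: "c > 1/2" "c < 1" using \<delta> by (auto simp: c_def)
  \<comment> \<open>The real part of 2 r s on the new line. It is below 2 r, hence below
    \<open>K\<close>, as \<open>mu_tail_bound\<close> requires.\<close>
  define A0 where "A0 = 2 * real r * c"
  have A0: "A0 > real r" "A0 < 2 * real r" using r c by (auto simp: A0_def)
  have rc: "real r * x \<ge> 1 + 2 * \<delta>" if "x \<ge> c" for x
  proof -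
    have "2 * c \<le> real r * x" using r c that by (intro mult_mono) auto
    thus ?thesis by (simp add: c_def)
  qed
  have K0: "K > 0" using K r by simp
  obtain C1 where C1: "C1 > 0" "\<And>s. c \<le> Re s \<Longrightarrow> norm (s - 1) \<ge> 1/2 - \<delta> \<Longrightarrow> norm (zeta s) \<le> C1 * (1 + \<bar>Im s\<bar>) powr e"
    using zeta_growth[OF RH \<delta>(1) e(1), of "1/2 - \<delta>"] \<delta> unfolding c_def by auto
  obtain B where B: "B \<ge> 1" "\<And>s. Re s \<ge> 1 + 2 * \<delta> \<Longrightarrow> norm (zeta s) \<le> B" "\<And>s. Re s \<ge> 1 + 2 * \<delta> \<Longrightarrow> norm (1 / zeta s) \<le> B"
    using zeta_bounds_right[of "1 + 2 * \<delta>"] \<delta> by auto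
  obtain C2 where C2: "C2 > 0" "\<And>y w. y \<ge> 1 \<Longrightarrow> Re w = A0 \<Longrightarrow>
     norm (mu_tail K y w) \<le> C2 * y powr (1/2 + \<delta> - A0) * (1 + \<bar>Im w\<bar>) powr e"
    using mu_tail_bound[OF RH _ \<delta>(1) e(1), of A0 K] A0 K c r e \<delta> by auto
  define C where "C = C1 * B * (C2 * (2 * real r) powr e) * (2 powr (3 * e) * 4 powr (3 * e)) * 4 / e"
  have C: "C > 0" using C1 C2 B e r by (simp add: C_def)
  have main: "norm (riesz_defect r K y a b)
       \<le> C * (b powr c * (b / (b - a)) powr (3 * e) * y powr (1/2 - real r))"
    if y: "y \<ge> 1" and ab: "0 < a" "a < b" for y a b
  proof -
    define P where "P = (\<lambda>s. zeta (of_nat r * s) * mu_tail K y (of_nat (2 * r) * s))"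
    define Q where "Q = (\<lambda>s. of_real b * of_real b powr s - complex_of_real a * of_real a powr s)"
    \<comment> \<open>\<open>zeta_reg\<close> in place of \<open>zeta\<close> makes the pole at 1
      explicit: the integrand is h s / (s - 1).\<close>
    define h where "h = (\<lambda>s. zeta_reg s * P s * Q s / (of_real (b - a) * (s * (s + 1))))"
    let ?t = "2 powr (3 * e) * 4 powr (3 * e)"
    let ?D = "C2 * (2 * real r) powr e * y powr (1/2 - real r)"
    let ?M = "C1 * 2 powr e * (B * (B + real (nat \<lceil>y\<rceil>))) * (2 * (b * max 1 b powr 2)) / (b - a)"
    let ?h = "\<lambda>s. h s / (s - 1)"
    define S where "S = {s. Re s > 1/2}"
    have hP: "P holomorphic_on S"
    proof -
      have rs: "Re (of_nat r * s) > 1" "Re (of_nat (2 * r) * s) > 1" if "s \<in> S" for s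
      proof -
        have "2 * (1/2) < real r * Re s" using r that by (intro mult_le_less_imp_less) (auto simp: S_def)
        thus "Re (of_nat r * s) > 1" "Re (of_nat (2 * r) * s) > 1" by simp_all
      qed
      have z: "zeta holomorphic_on {s. Re s > 1}"
        using zeta_props by (auto intro: holomorphic_on_subset)
      have G: "mu_tail K y holomorphic_on {s. Re s > 1}"
        unfolding mu_tail_def using has_sum_mu(2)
        by (intro holomorphic_intros z holomorphic_mu_head) auto
      show ?thesis unfolding P_def
        by (intro holomorphic_on_mult holomorphic_on_compose_gen[OF _ z, unfolded o_def] holomorphic_on_compose_gen[OF _ G, unfolded o_def])
           (auto intro!: holomorphic_intros dest: rs)
    qed
    have hQ: "Q holomorphic_on UNIV" unfolding Q_def using ab by (intro holomorphic_intros) auto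
    have hZ: "zeta_reg holomorphic_on S" by (rule holomorphic_on_subset[OF holomorphic_zeta_reg]) (auto simp: S_def)
    have nz: "of_real (b - a) * (s * (s + 1)) \<noteq> 0" if "s \<in> S" for s
    proof -
      have "s \<noteq> 0" "s + 1 \<noteq> 0" using that by (auto simp: S_def complex_eq_iff)
      thus ?thesis using ab by simp
    qed
    have hol: "h holomorphic_on S"
      unfolding h_def
      by (intro holomorphic_on_divide holomorphic_on_mult hZ hP holomorphic_on_subset[OF hQ] holomorphic_intros nz) auto
    have f1: "h s / (s - 1) = zeta s * P s * Q s / (of_real (b - a) * (s * (s + 1)))" if "Re s > 0" for s
      unfolding h_def zeta_eq_zeta_reg[OF that] by (simp add: mult_ac)
    let ?k = "\<lambda>X s. zeta s * zeta (of_nat r * s) * mu_tail K y (of_nat (2 * r) * s) * of_real X powr s / (s * (s + 1))"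
    have lim1: "((\<lambda>T. vline 2 T ?h) \<longlongrightarrow>
       of_real (2 * pi * (riesz_slope (tail_coeff r K y) a b))) at_top"
    proof -
      have cont: "continuous_on {s. Re s = 2 \<and> \<bar>Im s\<bar> \<le> T} (?k X)" if "X > 0" for X T
      proof -
        let ?L = "{s. Re s = 2 \<and> \<bar>Im s\<bar> \<le> T}"
        have c1: "continuous_on ?L zeta"
        proof (rule continuous_on_subset)
          show "continuous_on (-{1}) zeta" using zeta_props by (intro holomorphic_on_imp_continuous_on) blast
        qed auto
        have c2: "continuous_on ?L P"
          by (rule continuous_on_subset[OF holomorphic_on_imp_continuous_on[OF hP]]) (auto simp: S_def)
        have c3: "continuous_on ?L (\<lambda>s. of_real X powr s)"
          unfolding of_real_powr_exp[OF that] by (intro continuous_intros)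
        have c4: "s * (s + 1) \<noteq> 0" if "s \<in> ?L" for s
          using nz[of s] that by (auto simp: S_def)
        have "continuous_on ?L (\<lambda>s. zeta s * P s * of_real X powr s / (s * (s + 1)))"
          by (rule continuous_on_divide[OF continuous_on_mult[OF continuous_on_mult[OF c1 c2] c3]])
             (use c4 in \<open>auto intro!: continuous_intros\<close>)
        thus ?thesis by (simp add: P_def mult.assoc)
      qed
      have eq: "vline 2 T ?h = (of_real b * vline 2 T (?k b) - of_real a * vline 2 T (?k a)) / of_real (b - a)" for T
      proof -
        have "vline 2 T ?h = vline 2 T (\<lambda>s. (of_real b / of_real (b - a)) * ?k b s - (of_real a / of_real (b - a)) * ?k a s)"
          unfolding vline_def
        proof (rule integral_cong)
          fix t
          have "Re (Complex 2 t) > 0" by simp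
          from f1[OF this]
          show "h (Complex 2 t) / (Complex 2 t - 1) = (of_real b / of_real (b - a)) * ?k b (Complex 2 t) - (of_real a / of_real (b - a)) * ?k a (Complex 2 t)"
            by (simp add: P_def Q_def diff_divide_distrib right_diff_distrib mult_ac)
        qed
        also have "\<dots> = (of_real b / of_real (b - a)) * vline 2 T (?k b) - (of_real a / of_real (b - a)) * vline 2 T (?k a)"
          by (rule vline_linear[OF cont cont]) (use ab in auto)
        finally show ?thesis by (simp add: diff_divide_distrib)
      qed
      have "((\<lambda>T. (of_real b * vline 2 T (?k b) - of_real a * vline 2 T (?k a)) / of_real (b - a)) \<longlongrightarrow>
          (complex_of_real (2 * pi * riesz (tail_coeff r K y) b) - complex_of_real (2 * pi * riesz (tail_coeff r K y) a)) / complex_of_real (b - a)) at_top"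
        by (intro tendsto_divide tendsto_diff perron_riesz_tail r K0 tendsto_const) (use y ab in auto)
      thus ?thesis unfolding eq by (simp add: right_diff_distrib diff_divide_distrib)
    qed
    have lim2: "((\<lambda>T. vline 2 T ?h - vline c T ?h) \<longlongrightarrow> 2 * pi * h 1) at_top"
    proof (rule vline_shift_limit[OF _ _ c(1)])
      show "h holomorphic_on {s. Re s > 1/2}" using hol by (simp add: S_def)
      fix s assume s: "c \<le> Re s" "Re s \<le> 2" "\<bar>Im s\<bar> \<ge> (1::real)"
      have z1: "norm (zeta s) \<le> C1 * (2 * \<bar>Im s\<bar>) powr e"
      proof -
        have "norm (s - 1) \<ge> 1/2 - \<delta>" using abs_Im_le_cmod[of "s - 1"] s \<delta> by simp
        hence "norm (zeta s) \<le> C1 * (1 + \<bar>Im s\<bar>) powr e" using C1(2) s by blast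
        also have "\<dots> \<le> C1 * (2 * \<bar>Im s\<bar>) powr e" using s C1 e by (intro mult_left_mono powr_mono2) auto
        finally show ?thesis .
      qed
      have P1: "norm (P s) \<le> B * (B + real (nat \<lceil>y\<rceil>))"
      proof -
        have "norm (zeta (of_nat r * s)) \<le> B" using rc[OF s(1)] by (intro B(2)) simp
        moreover have "norm (1 / zeta (of_nat (2 * r) * s)) \<le> B"
          using rc[OF s(1)] \<delta> by (intro B(3)) simp
        moreover have "norm (mu_head K y (of_nat (2 * r) * s)) \<le> real (nat \<lceil>y\<rceil>)"
          using s c y K0 by (intro norm_mu_head_le) auto
        ultimately show ?thesis unfolding P_def mu_tail_def norm_mult using B(1)
          by (intro mult_mono order_trans[OF norm_triangle_ineq4] add_mono) auto
      qed
      have Q1: "norm (Q s) \<le> 2 * (b * b powr Re s)" unfolding Q_def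
        by (rule power_difference_bound(2)[OF ab]) (use s c in auto)
      have b2: "b powr Re s \<le> max 1 b powr 2"
        using ab s c by (intro order_trans[OF powr_mono2[of "Re s" b "max 1 b"]] powr_mono) auto
      have Q2: "norm (Q s) \<le> 2 * (b * max 1 b powr 2)" using Q1 b2 ab by (intro order_trans[OF Q1]) auto
      have n: "norm s \<ge> \<bar>Im s\<bar>" "norm (s + 1) \<ge> \<bar>Im s\<bar>" using abs_Im_le_cmod[of s] abs_Im_le_cmod[of "s + 1"] by auto
      have "norm (h s / (s - 1)) = norm (zeta s) * norm (P s) * norm (Q s) / ((b - a) * (norm s * norm (s + 1)))"
        using f1[of s] s c ab by (simp add: norm_mult norm_divide flip: of_real_diff)
      also have "\<dots> \<le> (C1 * (2 * \<bar>Im s\<bar>) powr e) * (B * (B + real (nat \<lceil>y\<rceil>))) * (2 * (b * max 1 b powr 2)) / ((b - a) * (\<bar>Im s\<bar> * \<bar>Im s\<bar>))"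
      proof (intro frac_le mult_mono z1 P1 Q2 n order_refl)
        show "0 < (b - a) * (\<bar>Im s\<bar> * \<bar>Im s\<bar>)" using s ab by (intro mult_pos_pos) auto
      qed (use C1 B ab s in auto)
      also have "\<dots> = ?M * (\<bar>Im s\<bar> powr e / \<bar>Im s\<bar> powr 2)"
        using s by (simp add: powr_mult power2_eq_square mult_ac)
      also have "\<bar>Im s\<bar> powr e / \<bar>Im s\<bar> powr 2 = \<bar>Im s\<bar> powr (- (2 - e))"
        by (simp only: powr_diff[symmetric] minus_diff_eq)
      finally show "norm (h s / (s - 1)) \<le> ?M * \<bar>Im s\<bar> powr (- (2 - e))" .
    qed (use c e in auto)
    have lim: "((\<lambda>T. vline c T ?h) \<longlongrightarrow>
        of_real (2 * pi * (riesz_slope (tail_coeff r K y) a b)) - 2 * pi * h 1) at_top"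
      using tendsto_diff[OF lim1 lim2] by simp
    define W where "W = C1 * B * ?D * (b powr c * (b / (b - a)) powr (3 * e) * ?t) * 4"
    have bd: "norm (vline c T ?h) \<le> 2 * W / e" if T: "T \<ge> 0" for T
    proof (rule vline_bound[OF _ e(1) T])
      have "continuous_on {s. Re s = c \<and> \<bar>Im s\<bar> \<le> T} h"
        by (rule continuous_on_subset[OF holomorphic_on_imp_continuous_on[OF hol]]) (use c in \<open>auto simp: S_def\<close>)
      thus "continuous_on {s. Re s = c \<and> \<bar>Im s\<bar> \<le> T} ?h"
        by (rule continuous_on_divide) (use c in \<open>auto intro!: continuous_intros\<close>)
      fix s assume s: "Re s = c"
      define t where "t = 1 + \<bar>Im s\<bar>"
      have t: "t \<ge> 1" by (simp add: t_def)
      have n: "norm s \<ge> t / 4" "norm (s + 1) \<ge> t / 4"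
      proof -
        have "norm s \<ge> c" "norm s \<ge> \<bar>Im s\<bar>" "norm (s + 1) \<ge> c + 1" "norm (s + 1) \<ge> \<bar>Im s\<bar>"
          using complex_Re_le_cmod[of s] abs_Im_le_cmod[of s] complex_Re_le_cmod[of "s + 1"] abs_Im_le_cmod[of "s + 1"] s by auto
        thus "norm s \<ge> t / 4" "norm (s + 1) \<ge> t / 4" using c by (simp_all add: t_def)
      qed
      have z1: "norm (zeta s) \<le> C1 * t powr e"
      proof -
        have "norm (s - 1) \<ge> 1/2 - \<delta>" using abs_Re_le_cmod[of "s - 1"] s \<delta> by (simp add: c_def)
        thus ?thesis using C1(2)[of s] s by (simp add: t_def)
      qed
      have z2: "norm (zeta (of_nat r * s)) \<le> B" using rc[of "Re s"] s by (intro B(2)) simp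
      have z3: "norm (mu_tail K y (of_nat (2 * r) * s)) \<le> ?D * t powr e"
      proof -
        have "norm (mu_tail K y (of_nat (2 * r) * s)) \<le> C2 * y powr (1/2 + \<delta> - A0) * (1 + 2 * real r * \<bar>Im s\<bar>) powr e"
          using C2(2)[OF y, of "of_nat (2 * r) * s"] s by (simp add: A0_def abs_mult)
        also have "\<dots> \<le> C2 * y powr (1/2 - real r) * (2 * real r * t) powr e"
        proof (intro mult_mono powr_mono powr_mono2)
          \<comment> \<open>The loss of \<delta> in \<open>mu_tail_bound\<close> is made good
            because \<open>A0\<close> exceeds r by 2 r \<delta>.\<close>
          have "\<delta> * 1 \<le> \<delta> * (2 * real r)" using \<delta> r by (intro mult_left_mono) auto
          thus "1/2 + \<delta> - A0 \<le> 1/2 - real r" by (simp add: A0_def c_def algebra_simps)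
          show "1 + 2 * real r * \<bar>Im s\<bar> \<le> 2 * real r * t" using r by (simp add: t_def algebra_simps)
        qed (use C2 y e in auto)
        also have "\<dots> = ?D * t powr e"
          using t by (simp add: powr_mult mult_ac)
        finally show ?thesis .
      qed
      have q: "norm (Q s) / ((b - a) * norm (s + 1)) \<le> b powr c * (b / (b - a)) powr (3 * e) * ?t * t powr (- (3 * e))"
      proof -
        have pos: "0 < (b - a) * norm (s + 1)" using n(2) t ab by (intro mult_pos_pos) auto
        \<comment> \<open>The normalisation of \<open>v\<close> turns the two bounds for the power
          difference into \<open>v \<le> 1\<close> and \<open>v \<le> x\<close>, the form that
          \<open>min_one_le_powr\<close> expects.\<close>
        define x where "x = 2 * b / ((b - a) * norm (s + 1))"
        define v where "v = norm (Q s) / ((b - a) * norm (s + 1)) / b powr c"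
        have bc: "b powr c > 0" using ab by simp
        have "norm (Q s) \<le> (b - a) * norm (s + 1) * b powr c"
          using power_difference_bound(1)[OF ab, of s] s c unfolding Q_def by (simp add: mult_ac)
        hence "v \<le> 1"
          unfolding v_def divide_divide_eq_left using pos bc by (subst divide_le_eq_1_pos) (auto intro: mult_pos_pos)
        moreover have "v \<le> x"
        proof -
          have "norm (Q s) / b powr c \<le> 2 * b"
            using power_difference_bound(2)[OF ab, of s] s c bc unfolding Q_def by (simp add: divide_le_eq mult_ac)
          hence "norm (Q s) / b powr c / ((b - a) * norm (s + 1)) \<le> x"
            unfolding x_def using pos by (intro divide_right_mono) auto
          thus ?thesis by (simp add: v_def mult_ac)
        qed
        moreover have "x \<ge> 0" using pos ab by (simp add: x_def)
        ultimately have "v \<le> x powr (3 * e)" using e by (intro min_one_le_powr) auto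
        also have "x \<le> 2 * b / ((b - a) * (t / 4))"
          unfolding x_def using n(2) pos ab t by (intro divide_left_mono mult_left_mono mult_pos_pos) auto
        hence "x powr (3 * e) \<le> (2 * b / ((b - a) * (t / 4))) powr (3 * e)"
          using \<open>x \<ge> 0\<close> e by (intro powr_mono2) auto
        also have "2 * b / ((b - a) * (t / 4)) = (2 * 4) * (b / (b - a)) / t" by simp
        also have "\<dots> powr (3 * e) = ?t * (b / (b - a)) powr (3 * e) * t powr (- (3 * e))"
          using ab t by (simp only: powr_mult powr_divide powr_minus_divide) simp
        finally have "b powr c * v \<le> b powr c * (?t * (b / (b - a)) powr (3 * e) * t powr (- (3 * e)))"
          by (intro mult_left_mono) auto
        thus ?thesis using ab by (simp add: v_def mult_ac)
      qed
      have "norm (h s / (s - 1)) = norm (zeta s) * norm (zeta (of_nat r * s)) * norm (mu_tail K y (of_nat (2 * r) * s)) * (norm (Q s) / ((b - a) * norm (s + 1))) / norm s"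
        using f1[of s] s c ab by (simp add: norm_mult norm_divide P_def mult_ac flip: of_real_diff)
      also have "\<dots> \<le> (C1 * t powr e) * B * (?D * t powr e) *
         (b powr c * (b / (b - a)) powr (3 * e) * ?t * t powr (- (3 * e))) / (t / 4)"
        by (intro frac_le mult_mono z1 z2 z3 q n) (use C1 C2 B t ab in auto)
      also have "\<dots> = W * (t powr e * t powr e * t powr (- (3 * e)) * t powr (-1))"
        using t by (simp add: W_def powr_minus_divide mult_ac)
      also have "t powr e * t powr e * t powr (- (3 * e)) * t powr (-1) = t powr (-1 - e)"
        by (simp only: powr_add[symmetric]) (rule arg_cong[where f = "\<lambda>x. t powr x"], simp)
      finally show "norm (h s / (s - 1)) \<le> W * (1 + \<bar>Im s\<bar>) powr (-1 - e)" by (simp add: t_def)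
    qed
    have "norm (of_real (2 * pi * (riesz_slope (tail_coeff r K y) a b)) - 2 * pi * h 1) \<le> 2 * W / e"
    proof (rule Lim_norm_ubound[OF _ lim])
      show "\<forall>\<^sub>F T in at_top. norm (vline c T ?h) \<le> 2 * W / e"
        by (rule eventually_at_top_linorderI[of 0]) (rule bd)
    qed simp
    moreover have "h 1 = zeta (of_nat r) * mu_tail K y (of_nat (2 * r)) * of_real ((a + b) / 2)"
    proof -
      \<comment> \<open>Dividing by b - a and by the value 2 of s (s + 1) at 1 turns this into the
        midpoint.\<close>
      have q: "Q 1 = of_real (b - a) * of_real (a + b)"
        using ab by (simp add: Q_def algebra_simps)
      have "of_real (b - a) \<noteq> (0 :: complex)" using ab by simp
      thus ?thesis unfolding h_def q P_def by (simp del: of_real_diff of_real_add)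
    qed
    ultimately have "norm (of_real (2 * pi) * (riesz_defect r K y a b)) \<le> 2 * W / e"
      by (simp only: right_diff_distrib of_real_mult)
    hence 1: "2 * pi * norm (riesz_defect r K y a b) \<le> 2 * W / e"
      by (simp only: norm_mult norm_of_real) simp
    have mono: "v \<le> w" if "2 * pi * v \<le> 2 * w" "v \<ge> 0" for v w :: real
    proof -
      have "1 * v \<le> pi * v" using that pi_gt3 by (intro mult_right_mono) auto
      thus ?thesis using that by linarith
    qed
    have "norm (riesz_defect r K y a b) \<le> W / e"
      by (rule mono) (use 1 in auto)
    thus ?thesis by (simp add: W_def C_def mult_ac)
  qed
  show ?thesis by (rule that[OF C]) (use main in \<open>simp add: c_def\<close>)
qed

section \<open>The error term\<close>

definition mu_head_real :: "real \<Rightarrow> real \<Rightarrow> real \<Rightarrow> real" where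
  "mu_head_real K y w = (\<Sum>n<nat \<lceil>y\<rceil>. mu (Suc n) * rweight K (y / real (Suc n)) * real (Suc n) powr (-w))"

definition mu_tail_real :: "real \<Rightarrow> real \<Rightarrow> real \<Rightarrow> real" where
  "mu_tail_real K y w = 1 / zeta_real w - mu_head_real K y w"

lemma npow_of_real: "n > 0 \<Longrightarrow> npow (of_real w) n = of_real (real n powr (-w))"
  by (simp add: npow_exp powr_def exp_of_real[symmetric] del: exp_of_real)

lemma of_real_mu_tail_real: "of_real (mu_tail_real K y w) = mu_tail K y (of_real w)"
proof -
  have "of_real (mu_head_real K y w) = mu_head K y (of_real w)"
    unfolding mu_head_real_def mu_head_def of_real_sum by (intro sum.cong) (simp_all add: npow_of_real del: of_nat_Suc)
  thus ?thesis by (simp add: mu_tail_real_def mu_tail_def of_real_zeta_real)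
qed

lemma powr_diff_le_diff:
  fixes p q s :: real
  assumes "1 \<le> p" "p \<le> q" "0 \<le> s" "s \<le> 1"
  shows "0 \<le> q powr s - p powr s" "q powr s - p powr s \<le> q - p"
proof -
  show "0 \<le> q powr s - p powr s" using assms by (simp add: powr_mono2)
  have "(q / p) powr s \<le> (q / p) powr 1" using assms by (intro powr_mono) auto
  hence "p powr s * (q / p) powr s \<le> p powr s * (q / p)" using assms by (intro mult_left_mono) auto
  moreover have "p powr s * (q / p) powr s = q powr s" using assms by (simp add: powr_divide)
  ultimately have "q powr s - p powr s \<le> p powr s * ((q - p) / p)"
    using assms by (simp add: diff_divide_distrib right_diff_distrib)
  also have "\<dots> \<le> p * ((q - p) / p)"
    using assms powr_mono[of s 1 p] by (intro mult_right_mono) auto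
  finally show "q powr s - p powr s \<le> q - p" using assms by simp
qed

lemma powr_le_two_powr:
  fixes x u \<theta> :: real
  assumes "x > 0" "x / 2 \<le> u" "u \<le> 2 * x"
  shows "u powr \<theta> \<le> 2 powr \<bar>\<theta>\<bar> * x powr \<theta>"
proof (cases "\<theta> \<ge> 0")
  case True
  hence "u powr \<theta> \<le> (2 * x) powr \<theta>" using assms by (intro powr_mono2) auto
  thus ?thesis using True assms by (simp add: powr_mult)
next
  case False
  hence "u powr \<theta> \<le> (x / 2) powr \<theta>" using assms by (intro powr_mono2') auto
  also have "\<dots> = 2 powr \<bar>\<theta>\<bar> * x powr \<theta>" using False assms by (simp add: powr_divide powr_minus_divide)
  finally show ?thesis .
qed

text \<open>The fifth and sixth claims say that the two costs of the overview agree at y =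
  x^\<beta>, with common exponent \<alpha>. The fourth makes x / m^(2 r) tend to infinity for all m
  up to y; the last admits the loss in the term with x^(1/r).\<close>

lemma exponent_identities:
  fixes r :: nat and \<theta> :: real
  assumes r: "r \<ge> 2" and \<theta>: "\<theta> < 1 / (2 * real r)"
  defines "D \<equiv> 2 * real r + 1 - 4 * real r * \<theta>"
  defines "\<alpha> \<equiv> (1 - \<theta>) / D" and "\<beta> \<equiv> (1 - 2 * \<theta>) / D"
  shows "0 < \<alpha>" "\<alpha> < 1" "0 < \<beta>" "2 * real r * \<beta> < 1" "\<alpha> = \<theta> + \<beta> * (1 - 2 * real r * \<theta>)"
    "\<alpha> = 1/2 + \<beta> * (1/2 - real r)" "1 / real r - 3/2 * \<beta> \<le> \<alpha>"
proof -
  have r\<theta>: "real r * \<theta> < 1/2" using \<theta> r by (simp add: field_simps)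
  have \<theta>4: "\<theta> < 1/4"
  proof -
    have "1 / (2 * real r) \<le> 1 / 4" using r by (intro divide_left_mono) auto
    thus ?thesis using \<theta> by linarith
  qed
  have D: "D > 0" using r\<theta> r by (simp add: D_def)
  show "0 < \<alpha>" "0 < \<beta>" using D \<theta>4 by (auto simp: \<alpha>_def \<beta>_def)
  have "1 - \<theta> < D"
  proof (cases "\<theta> \<ge> 0")
    case True
    thus ?thesis using r\<theta> r by (simp add: D_def)
  next
    case False
    have "real r * \<theta> \<le> 1 * \<theta>" using False r by (intro mult_right_mono_neg) auto
    hence "4 * real r * \<theta> \<le> 4 * \<theta>" by simp
    moreover have "real r \<ge> 2" using r by simp
    ultimately show ?thesis using False unfolding D_def by linarith
  qed
  thus "\<alpha> < 1" using D by (simp add: \<alpha>_def)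
  have "2 * real r * (1 - 2 * \<theta>) < D" by (simp add: D_def algebra_simps)
  thus *: "2 * real r * \<beta> < 1" using D by (simp add: \<beta>_def)
  show "\<alpha> = \<theta> + \<beta> * (1 - 2 * real r * \<theta>)"
  proof -
    have eq: "1 - \<theta> = \<theta> * D + (1 - 2 * \<theta>) * (1 - 2 * real r * \<theta>)" by (simp add: D_def algebra_simps)
    show ?thesis unfolding \<alpha>_def \<beta>_def eq add_divide_distrib using D by simp
  qed
  show **: "\<alpha> = 1/2 + \<beta> * (1/2 - real r)"
  proof -
    have eq: "1 - \<theta> = (1/2) * D + (1 - 2 * \<theta>) * (1/2 - real r)" by (simp add: D_def algebra_simps)
    show ?thesis unfolding \<alpha>_def \<beta>_def eq add_divide_distrib using D by simp
  qed
  \<comment> \<open>The product is exactly the gap between \<alpha> and 1/r - 3/2 \<beta>, so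
    equality holds for r = 2.\<close>
  have "0 \<le> (real r - 2) * (1 / (2 * real r) - \<beta>)"
    using r * by (intro mult_nonneg_nonneg) (auto simp: field_simps)
  also have "\<dots> = 1/2 - 1 / real r - \<beta> * (real r - 2)" using r by (simp add: field_simps)
  finally show "1 / real r - 3/2 * \<beta> \<le> \<alpha>" unfolding ** by (simp add: algebra_simps)
qed

text \<open>The logarithmic factor is absorbed by a small power, and the O-bound gets an explicit
  threshold that the arguments x / m^(2 r) have to exceed.\<close>

lemma Delta1_powr_bound:
  assumes "(\<lambda>x. Delta1 r x) \<in> O[at_top](\<lambda>x. x powr \<theta> * ln x powr \<theta>')" and \<epsilon>: "\<epsilon> > 0"
  obtains C z0 where "C > 0" "z0 \<ge> 1" "\<And>z. z \<ge> z0 \<Longrightarrow> \<bar>Delta1 r z\<bar> \<le> C * z powr (\<theta> + \<epsilon>)"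
proof -
  have "(\<lambda>x::real. x powr \<theta> * ln x powr \<theta>') \<in> O[at_top](\<lambda>x. x powr (\<theta> + \<epsilon>))"
    using \<epsilon> by real_asymp
  with assms(1) have "(\<lambda>x. Delta1 r x) \<in> O[at_top](\<lambda>x. x powr (\<theta> + \<epsilon>))"
    by (rule landau_o.big_trans)
  then obtain C where C: "C > 0" "\<forall>\<^sub>F x in at_top. norm (Delta1 r x) \<le> C * norm (x powr (\<theta> + \<epsilon>))"
    by (rule landau_o.bigE)
  then obtain z0 where z0: "\<And>z. z \<ge> z0 \<Longrightarrow> norm (Delta1 r z) \<le> C * norm (z powr (\<theta> + \<epsilon>))"
    unfolding eventually_at_top_linorder by blast
  show ?thesis by (rule that[of C "max 1 z0"]) (use C z0 in auto)
qed

abbreviation head_main :: "nat \<Rightarrow> real \<Rightarrow> real \<Rightarrow> real \<Rightarrow> real" where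
  "head_main r K y u \<equiv> zeta_real (real r) * u * mu_head_real K y (2 * real r) + zeta_real (1 / real r) * u powr (1 / real r) * mu_head_real K y 2"

text \<open>The formula for \<open>T1\<close> is inserted for each m; its two main terms add up to
  the truncated Moebius series at 2 r and at 2. Writing the error as E m^(-p) with p > 1 bounds its
  sum by a constant multiple of \<open>E\<close>, which takes up the power of y.\<close>

lemma summatory_head_coeff_expansion:
  assumes r: "r \<ge> 2" and K: "K > 0" and y: "y > 0" and u: "u > 0"
    and bd: "\<And>m. m \<ge> 1 \<Longrightarrow> real m \<le> y \<Longrightarrow> \<bar>Delta1 r (u / real m ^ (2 * r))\<bar> \<le> E * real m powr (-p)" and E: "E \<ge> 0"
    and p: "p > 1"
  shows "\<bar>summatory (head_coeff r K y) u - head_main r K y u\<bar>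
     \<le> E * (\<Sum>n. real (Suc n) powr (-p))"
proof -
  define N where "N = nat \<lceil>y\<rceil>"
  define M where "M = max N (nat \<lceil>u\<rceil>)"
  have M: "real M \<ge> u" using of_nat_ceiling[of u] unfolding M_def by linarith
  have N: "real N \<ge> y" unfolding N_def by (rule of_nat_ceiling)
  let ?w = "\<lambda>m. mu m * rweight K (y / real m)"
  have rw0: "rweight K (y / real m) = 0" if "m \<ge> 1" "y \<le> real m" for m
    using that y K by (intro rweight_eq_0) auto
  have w1: "\<bar>?w m\<bar> \<le> 1" if "m \<ge> 1" for m
  proof -
    have "0 \<le> rweight K (y / real m)" "rweight K (y / real m) \<le> 1" using rweight_bounds[of K "y / real m"] K y that by auto
    thus ?thesis unfolding abs_mult using abs_mu_le[of m] by (intro mult_le_one) auto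
  qed
  have T: "real (T1 r (u / real m ^ (2 * r))) = zeta_real (real r) * u * real m powr (- (2 * real r)) +
      zeta_real (1 / real r) * u powr (1 / real r) * real m powr (-2) + Delta1 r (u / real m ^ (2 * r))" if m: "m \<ge> 1" for m
  proof -
    have pw: "real m ^ (2 * r) = real m powr (2 * real r)" using m by (simp add: powr_realpow[symmetric])
    have e1: "u / real m ^ (2 * r) = u * real m powr (- (2 * real r))"
      unfolding pw using m by (simp add: powr_minus_divide)
    have "(u / real m ^ (2 * r)) powr (1 / real r) = u powr (1 / real r) * real m powr (-2)"
      unfolding e1 using m u r by (simp add: powr_mult powr_powr)
    thus ?thesis unfolding Delta1_def by (simp add: e1)
  qed
  have "summatory (head_coeff r K y) u = (\<Sum>m\<in>{1..M}. ?w m * real (T1 r (u / real m ^ (2 * r))))"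
    using r M by (intro summatory_head_coeff) auto
  also have "\<dots> = (\<Sum>m\<in>{1..N}. ?w m * real (T1 r (u / real m ^ (2 * r))))"
  proof (rule sum.mono_neutral_right)
    show "\<forall>m\<in>{1..M} - {1..N}. ?w m * real (T1 r (u / real m ^ (2 * r))) = 0"
    proof
      fix m assume "m \<in> {1..M} - {1..N}"
      hence "m \<ge> 1" "y \<le> real m" using N by auto
      thus "?w m * real (T1 r (u / real m ^ (2 * r))) = 0" using rw0 by simp
    qed
  qed (auto simp: M_def)
  also have "\<dots> = (\<Sum>m\<in>{Suc 0..N}. zeta_real (real r) * u * (?w m * real m powr (- (2 * real r))) +
      zeta_real (1 / real r) * u powr (1 / real r) * (?w m * real m powr (-2)) + ?w m * Delta1 r (u / real m ^ (2 * r)))"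
  proof (rule sum.cong)
    fix m assume "m \<in> {Suc 0..N}"
    hence "m \<ge> 1" by simp
    show "?w m * real (T1 r (u / real m ^ (2 * r))) = zeta_real (real r) * u * (?w m * real m powr (- (2 * real r))) +
      zeta_real (1 / real r) * u powr (1 / real r) * (?w m * real m powr (-2)) + ?w m * Delta1 r (u / real m ^ (2 * r))"
      unfolding T[OF \<open>m \<ge> 1\<close>] by (simp only: distrib_left mult_ac)
  qed simp
  also have "\<dots> = head_main r K y u +
      (\<Sum>n<N. ?w (Suc n) * Delta1 r (u / real (Suc n) ^ (2 * r)))"
    unfolding sum.atLeast1_atMost_eq sum.distrib mu_head_real_def N_def sum_distrib_left ..
  finally have "summatory (head_coeff r K y) u - head_main r K y u
      = (\<Sum>n<N. ?w (Suc n) * Delta1 r (u / real (Suc n) ^ (2 * r)))" by simp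
  also have "\<bar>\<dots>\<bar> \<le> (\<Sum>n<N. \<bar>?w (Suc n) * Delta1 r (u / real (Suc n) ^ (2 * r))\<bar>)" by (rule sum_abs)
  also have "\<dots> \<le> (\<Sum>n<N. E * real (Suc n) powr (-p))"
  proof (rule sum_mono)
    fix n
    show "\<bar>?w (Suc n) * Delta1 r (u / real (Suc n) ^ (2 * r))\<bar> \<le> E * real (Suc n) powr (-p)"
    proof (cases "real (Suc n) \<le> y")
      case True
      have "\<bar>?w (Suc n)\<bar> * \<bar>Delta1 r (u / real (Suc n) ^ (2 * r))\<bar> \<le> 1 * (E * real (Suc n) powr (-p))"
        by (intro mult_mono w1 bd True) auto
      thus ?thesis by (simp add: abs_mult)
    next
      case False
      hence "rweight K (y / real (Suc n)) = 0" by (intro rw0) auto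
      thus ?thesis using E by simp
    qed
  qed
  also have "\<dots> = E * (\<Sum>n<N. real (Suc n) powr (-p))" by (simp only: sum_distrib_left)
  also have "\<dots> \<le> E * (\<Sum>n. real (Suc n) powr (-p))"
    by (intro mult_left_mono E sum_le_suminf summable_Suc_powr p) auto
  finally show ?thesis .
qed

abbreviation tau_real :: "nat \<Rightarrow> nat \<Rightarrow> real" where
  "tau_real r \<equiv> \<lambda>n. real (tau (r - 1) n)"

lemma riesz_tau_split:
  assumes "r \<ge> 1"
  shows "riesz (tau_real r) X = riesz (head_coeff r K y) X + riesz (tail_coeff r K y) X"
  unfolding riesz_def sum.distrib[symmetric] distrib_right[symmetric]
  by (intro sum.cong refl) (simp only: tau_eq_head_plus_tail[OF zero_less_Suc assms, of _ K y])

theorem theorem2: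
  fixes r :: nat and \<theta> \<theta>' :: real
  assumes "riemann_hypothesis"
    and "r \<ge> 2"
    and "(\<lambda>x. Delta1 r x) \<in> O[at_top](\<lambda>x. x powr \<theta> * ln x powr \<theta>')"
    and "\<theta> < 1 / (2 * real r)"
  shows "\<forall>\<epsilon>>0. (\<lambda>x. err r x)
    \<in> O[at_top](\<lambda>x. x powr ((1 - \<theta>) / (2 * real r + 1 - 4 * real r * \<theta>) + \<epsilon>))"
proof (intro allI impI)
  fix \<epsilon> :: real assume \<epsilon>: "\<epsilon> > 0"
  note RH = assms(1) and r = assms(2)
  define \<alpha> where "\<alpha> = (1 - \<theta>) / (2 * real r + 1 - 4 * real r * \<theta>)"
  define \<beta> where "\<beta> = (1 - 2 * \<theta>) / (2 * real r + 1 - 4 * real r * \<theta>)"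
  have ids: "0 < \<alpha>" "\<alpha> < 1" "0 < \<beta>" "2 * real r * \<beta> < 1" "\<alpha> = \<theta> + \<beta> * (1 - 2 * real r * \<theta>)"
    "\<alpha> = 1/2 + \<beta> * (1/2 - real r)" "1 / real r - 3/2 * \<beta> \<le> \<alpha>"
    using exponent_identities[OF r assms(4)] unfolding \<alpha>_def \<beta>_def by blast+
  have \<beta>1: "\<beta> \<le> 1"
  proof -
    have "1 * \<beta> \<le> 2 * real r * \<beta>" using r ids(3) by (intro mult_right_mono) auto
    thus ?thesis using ids(4) by linarith
  qed
  \<comment> \<open>The exponent \<epsilon> is spent separately on the two halves: \<delta> + 3
    \<epsilon>1 on the tail and \<epsilon>2 + \<eta> on the head, each at most \<epsilon>. The
    second bound on \<epsilon>2 keeps \<theta> + \<epsilon>2 below 1 / (2 r), and \<open>K\<close>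
    must exceed 2 and be at least 2 r for the two estimates of the tail.\<close>
  define \<delta> where "\<delta> = min (\<epsilon> / 2) (1 / 4)"
  define \<epsilon>1 where "\<epsilon>1 = min (\<epsilon> / 6) (1 / 3)"
  define \<eta> where "\<eta> = \<epsilon> / 2"
  define \<epsilon>2 where "\<epsilon>2 = min (\<epsilon> / 2) ((1 / (2 * real r) - \<theta>) / 2)"
  define K where "K = 2 * real r + 2"
  have small: "0 < \<delta>" "\<delta> < 1/2" "\<delta> \<le> \<epsilon> / 2" "0 < \<epsilon>1" "\<epsilon>1 \<le> 1/3" "3 * \<epsilon>1 \<le> \<epsilon> / 2" "0 < \<eta>" "0 < \<epsilon>2" "\<epsilon>2 \<le> \<epsilon> / 2"
    using \<epsilon> assms(4) by (auto simp: \<delta>_def \<epsilon>1_def \<eta>_def \<epsilon>2_def min_def)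
  have K: "K > 0" "K \<ge> 2 * real r" "K > 2" using r by (auto simp: K_def)
  define \<theta>2 where "\<theta>2 = \<theta> + \<epsilon>2"
  \<comment> \<open>Being below 1, it makes the exponent 1 + \<eta> - \<kappa> in the later
    splitting of m^(-\<kappa>) positive.\<close>
  define \<kappa> where "\<kappa> = 2 * real r * \<theta>2"
  have \<kappa>: "\<kappa> < 1"
  proof -
    define X where "X = 1 / (2 * real r)"
    have "\<theta> < X" "\<epsilon>2 \<le> (X - \<theta>) / 2" using assms(4) unfolding X_def \<epsilon>2_def by (simp, intro min.cobounded2)
    hence "\<theta>2 < X" unfolding \<theta>2_def by simp
    thus ?thesis using r by (simp add: \<kappa>_def X_def field_simps)
  qed
  obtain C1 where C1: "C1 > 0" "\<And>y a b. y \<ge> 1 \<Longrightarrow> 0 < a \<Longrightarrow> a < b \<Longrightarrow>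
     norm (riesz_defect r K y a b)
       \<le> C1 * (b powr (1/2 + \<delta>) * (b / (b - a)) powr (3 * \<epsilon>1) * y powr (1/2 - real r))"
    using riesz_tail_bound[OF RH r small(1,2,4,5) K(2)] by blast
  \<comment> \<open>The point 2 = 2 r * (1/r) belongs to the term with x^(1/r).\<close>
  have "(2::real) > 1/2 + \<delta>" using small by simp
  then obtain C2 where C2: "C2 > 0" "\<And>y w. y \<ge> 1 \<Longrightarrow> Re w = 2 \<Longrightarrow>
     norm (mu_tail K y w) \<le> C2 * y powr (1/2 + \<delta> - 2) * (1 + \<bar>Im w\<bar>) powr (1/2)"
    using mu_tail_bound[OF RH _ small(1) _ _ K(3), of "1/2"] by auto
  obtain C3 z0 where C3: "C3 > 0" "z0 \<ge> 1" "\<And>z. z \<ge> z0 \<Longrightarrow> \<bar>Delta1 r z\<bar> \<le> C3 * z powr \<theta>2"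
    using Delta1_powr_bound[OF assms(3) small(8)] unfolding \<theta>2_def by blast
  define Z where "Z = (\<Sum>n. real (Suc n) powr (- (1 + \<eta>)))"
  define E1 where "E1 = C3 * 2 powr \<bar>\<theta>2\<bar> * Z"
  define A1 where "A1 = zeta_real (real r) / zeta_real (2 * real r)"
  define A2 where "A2 = zeta_real (1 / real r) / zeta_real 2"
  define main where "main = (\<lambda>v. A1 * v + A2 * v powr (1 / real r))"
  define E where "E = E1 + \<bar>A1\<bar> + \<bar>A2\<bar> + \<bar>zeta_real (1 / real r)\<bar> * (2 * C2)"
  \<comment> \<open>Stated for any interval of length x^\<alpha> within distance x^\<alpha> of x,
    because it is used on both sides of x.\<close>
  have mean: "\<bar>riesz_slope (tau_real r) a b - main x\<bar> \<le> (E + 4 * C1) * x powr (\<alpha> + \<epsilon>)"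
    if x: "x \<ge> 2" "x powr \<alpha> \<le> x / 2" "z0 \<le> x powr (1 - 2 * real r * \<beta>) / 2"
      and ab: "b - a = x powr \<alpha>" "x - x powr \<alpha> \<le> a" "b \<le> x + x powr \<alpha>" for x a b
  proof -
    define y where "y = x powr \<beta>"
    define h where "h = x powr \<alpha>"
    define Y where "Y = x powr (\<alpha> + \<epsilon>)"
    have y: "y \<ge> 1" using ge_one_powr_ge_zero[of x \<beta>] x ids by (simp add: y_def)
    have h: "h > 0" "h \<le> x / 2" using x by (auto simp: h_def)
    have ab': "a < b" "x / 2 \<le> a" "b \<le> 2 * x" "0 < a" using ab h x unfolding h_def[symmetric] by auto
    have le_Y: "x powr e \<le> Y" if "e \<le> \<alpha> + \<epsilon>" for e
      unfolding Y_def using that x by (intro powr_mono) auto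
    have hY: "h \<le> Y" unfolding h_def by (rule le_Y) (use \<epsilon> in simp)
    have S1: "\<bar>summatory (head_coeff r K y) u - head_main r K y u\<bar> \<le> E1 * Y"
      if u: "x / 2 \<le> u" "u \<le> 2 * x" for u
    proof -
      define F where "F = C3 * (2 powr \<bar>\<theta>2\<bar> * x powr \<theta>2) * y powr (1 + \<eta> - \<kappa>)"
      have F: "F \<ge> 0" using C3 by (simp add: F_def)
      have u0: "u > 0" using u x by linarith
      have "\<bar>summatory (head_coeff r K y) u - head_main r K y u\<bar>
         \<le> F * (\<Sum>n. real (Suc n) powr (- (1 + \<eta>)))"
      proof (rule summatory_head_coeff_expansion[OF r K(1) _ u0 _ F])
        fix m :: nat assume m: "m \<ge> 1" "real m \<le> y"
        have pw: "real m ^ (2 * r) = real m powr (2 * real r)" using m by (simp add: powr_realpow[symmetric])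
        \<comment> \<open>The choice of \<beta> keeps the argument of \<open>Delta1\<close> above
          the threshold \<open>z0\<close> for every m up to y.\<close>
        have "x powr (1 - 2 * real r * \<beta>) / 2 = (x / 2) / y powr (2 * real r)"
          using x by (simp add: y_def powr_powr powr_diff mult_ac)
        also have "\<dots> \<le> u / real m ^ (2 * r)"
          unfolding pw using u m x u0 by (intro frac_le powr_mono2) auto
        finally have "\<bar>Delta1 r (u / real m ^ (2 * r))\<bar> \<le> C3 * (u / real m ^ (2 * r)) powr \<theta>2"
          using x by (intro C3(3)) linarith
        also have "(u / real m ^ (2 * r)) powr \<theta>2 = u powr \<theta>2 * real m powr (- \<kappa>)"
          unfolding pw using u0 m by (simp add: powr_divide powr_powr \<kappa>_def powr_minus_divide)
        \<comment> \<open>Splitting off m^(-1 - \<eta>) leaves an increasing power, at most its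
          value at y, and a convergent sum.\<close>
        also have "real m powr (- \<kappa>) = real m powr (1 + \<eta> - \<kappa>) * real m powr (- (1 + \<eta>))"
          by (simp flip: powr_add)
        also have "C3 * (u powr \<theta>2 * (real m powr (1 + \<eta> - \<kappa>) * real m powr (- (1 + \<eta>)))) \<le>
            C3 * ((2 powr \<bar>\<theta>2\<bar> * x powr \<theta>2) * (y powr (1 + \<eta> - \<kappa>) * real m powr (- (1 + \<eta>))))"
          using C3 m \<kappa> small u x by (intro order_refl mult_left_mono mult_mono powr_mono2 powr_le_two_powr) auto
        also have "\<dots> = F * real m powr (- (1 + \<eta>))" by (simp add: F_def)
        finally show "\<bar>Delta1 r (u / real m ^ (2 * r))\<bar> \<le> F * real m powr (- (1 + \<eta>))" .
      qed (use y small in auto)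
      also have "\<dots> = C3 * 2 powr \<bar>\<theta>2\<bar> * Z * (x powr \<theta>2 * y powr (1 + \<eta> - \<kappa>))"
        by (simp add: F_def Z_def)
      also have "x powr \<theta>2 * y powr (1 + \<eta> - \<kappa>) = x powr (\<theta>2 + \<beta> * (1 + \<eta> - \<kappa>))"
        by (simp add: y_def powr_powr powr_add)
      also have "C3 * 2 powr \<bar>\<theta>2\<bar> * Z * x powr (\<theta>2 + \<beta> * (1 + \<eta> - \<kappa>)) \<le> C3 * 2 powr \<bar>\<theta>2\<bar> * Z * Y"
      proof (intro mult_left_mono le_Y)
        have "\<theta>2 + \<beta> * (1 + \<eta> - \<kappa>) = (\<theta> + \<beta> * (1 - 2 * real r * \<theta>)) + \<epsilon>2 + \<beta> * \<eta> - 2 * real r * \<beta> * \<epsilon>2"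
          by (simp add: \<theta>2_def \<kappa>_def algebra_simps)
        also have "\<dots> = \<alpha> + \<epsilon>2 + \<beta> * \<eta> - 2 * real r * \<beta> * \<epsilon>2" using ids(5) by simp
        also have "\<beta> * \<eta> \<le> 1 * \<eta>" using \<beta>1 small by (intro mult_right_mono) auto
        finally have "\<theta>2 + \<beta> * (1 + \<eta> - \<kappa>) \<le> \<alpha> + \<epsilon>2 + \<eta> - 2 * real r * \<beta> * \<epsilon>2" by simp
        moreover have "0 \<le> 2 * real r * \<beta> * \<epsilon>2" using ids(3) small by simp
        moreover have "2 * \<epsilon>2 \<le> \<epsilon>" "2 * \<eta> = \<epsilon>" using small by (simp_all add: \<eta>_def)
        ultimately show "\<theta>2 + \<beta> * (1 + \<eta> - \<kappa>) \<le> \<alpha> + \<epsilon>" by linarith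
        have "Z \<ge> 0" unfolding Z_def using small by (intro suminf_nonneg summable_Suc_powr) auto
        thus "0 \<le> C3 * 2 powr \<bar>\<theta>2\<bar> * Z" using C3 by simp
      qed
      finally show ?thesis by (simp add: E1_def)
    qed
    \<comment> \<open>The head carries \<open>mu_head_real\<close> instead of 1 / zeta at 2; this is
      the resulting loss, of size x^(1/r) y^(-3/2) up to small powers.\<close>
    have G2: "u powr (1 / real r) * \<bar>mu_tail_real K y 2\<bar> \<le> 2 * C2 * Y" if u: "0 < u" "u \<le> 2 * x" for u
    proof -
      have "\<bar>mu_tail_real K y 2\<bar> = norm (mu_tail K y 2)" using of_real_mu_tail_real[of K y 2] by (metis norm_of_real of_real_numeral real_norm_def)
      also have "\<dots> \<le> C2 * y powr (1/2 + \<delta> - 2)" using C2(2)[OF y, of 2] by simp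
      finally have G: "\<bar>mu_tail_real K y 2\<bar> \<le> C2 * y powr (1/2 + \<delta> - 2)" .
      have "u powr (1 / real r) \<le> (2 * x) powr (1 / real r)" using u by (intro powr_mono2) auto
      also have "\<dots> = 2 powr (1 / real r) * x powr (1 / real r)" using x by (simp add: powr_mult)
      also have "\<dots> \<le> 2 powr 1 * x powr (1 / real r)" using r by (intro mult_right_mono powr_mono) auto
      finally have U: "u powr (1 / real r) \<le> 2 * x powr (1 / real r)" by simp
      have "u powr (1 / real r) * \<bar>mu_tail_real K y 2\<bar> \<le> (2 * x powr (1 / real r)) * (C2 * y powr (1/2 + \<delta> - 2))"
        using U G by (intro mult_mono) auto
      also have "\<dots> = 2 * C2 * x powr (1 / real r + \<beta> * (1/2 + \<delta> - 2))"
        by (simp add: y_def powr_powr powr_add)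
      also have "\<dots> \<le> 2 * C2 * Y"
      proof (intro mult_left_mono le_Y)
        have "1 / real r + \<beta> * (1/2 + \<delta> - 2) = (1 / real r - 3/2 * \<beta>) + \<beta> * \<delta>" by (simp add: algebra_simps)
        also have "\<dots> \<le> \<alpha> + 1 * \<delta>" using ids(7) \<beta>1 small by (intro add_mono mult_right_mono) auto
        finally show "1 / real r + \<beta> * (1/2 + \<delta> - 2) \<le> \<alpha> + \<epsilon>" using small by simp
      qed (use C2 in simp)
      finally show ?thesis .
    qed
    \<comment> \<open>The linear term of the head falls short by q u, and the residue of the tail is
      q times the midpoint, which makes up for this on average.\<close>
    define q where "q = zeta_real (real r) * mu_tail_real K y (2 * real r)"
    have bnE: "\<bar>summatory (head_coeff r K y) u + q * u - main x\<bar> \<le> E * Y" if u: "a \<le> u" "u \<le> b" for u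
    proof -
      define Er where "Er = summatory (head_coeff r K y) u - head_main r K y u"
      have u': "x / 2 \<le> u" "u \<le> 2 * x" "u > 0" "u \<ge> 1" "\<bar>u - x\<bar> \<le> h" using u ab' ab x by (auto simp: h_def abs_le_iff)
      \<comment> \<open>Each \<open>mu_head_real\<close> is replaced by the reciprocal of
        \<open>zeta_real\<close> minus \<open>mu_tail_real\<close>; the tail at 2 r cancels against
        q u.\<close>
      have eq: "summatory (head_coeff r K y) u + q * u - main x = Er + A1 * (u - x) + A2 * (u powr (1 / real r) - x powr (1 / real r))
          - zeta_real (1 / real r) * (u powr (1 / real r) * mu_tail_real K y 2)"
        by (simp add: Er_def q_def main_def A1_def A2_def mu_tail_real_def algebra_simps diff_divide_distrib)
      have d: "\<bar>u powr (1 / real r) - x powr (1 / real r)\<bar> \<le> h"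
      proof (cases "u \<le> x")
        case True
        thus ?thesis using powr_diff_le_diff[of u x "1 / real r"] u' r by auto
      next
        case False
        thus ?thesis using powr_diff_le_diff[of x u "1 / real r"] u' r x by auto
      qed
      have "\<bar>Er\<bar> \<le> E1 * Y" unfolding Er_def by (rule S1[OF u'(1,2)])
      moreover have "\<bar>A1 * (u - x)\<bar> \<le> \<bar>A1\<bar> * Y"
        unfolding abs_mult using u'(5) hY by (intro mult_left_mono) auto
      moreover have "\<bar>A2 * (u powr (1 / real r) - x powr (1 / real r))\<bar> \<le> \<bar>A2\<bar> * Y"
        unfolding abs_mult using d hY by (intro mult_left_mono) auto
      moreover have "\<bar>zeta_real (1 / real r) * (u powr (1 / real r) * mu_tail_real K y 2)\<bar> \<le> \<bar>zeta_real (1 / real r)\<bar> * (2 * C2 * Y)"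
        using G2[OF u'(3,2)] unfolding abs_mult by (intro mult_left_mono) auto
      ultimately have "\<bar>summatory (head_coeff r K y) u + q * u - main x\<bar> \<le> E1 * Y + \<bar>A1\<bar> * Y + \<bar>A2\<bar> * Y + \<bar>zeta_real (1 / real r)\<bar> * (2 * C2 * Y)"
        unfolding eq by linarith
      also have "\<dots> = E * Y" by (simp add: E_def algebra_simps)
      finally show ?thesis .
    qed
    have 1: "\<bar>riesz_slope (head_coeff r K y) a b + q * ((a + b) / 2) - main x\<bar> \<le> E * Y"
      by (rule riesz_difference_quotient_bound[OF ab'(1) bnE])
    have 2: "\<bar>riesz_slope (tail_coeff r K y) a b - q * ((a + b) / 2)\<bar> \<le> 4 * C1 * Y"
    proof -
      have "complex_of_real (riesz_slope (tail_coeff r K y) a b - q * ((a + b) / 2)) =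
         riesz_defect r K y a b"
        using of_real_zeta_real[of "real r"] of_real_mu_tail_real[of K y "2 * real r"] by (simp add: q_def)
      hence "\<bar>riesz_slope (tail_coeff r K y) a b - q * ((a + b) / 2)\<bar> =
         norm (riesz_defect r K y a b)"
        by (metis norm_of_real real_norm_def)
      also have "\<dots> \<le> C1 * (b powr (1/2 + \<delta>) * (b / (b - a)) powr (3 * \<epsilon>1) * y powr (1/2 - real r))"
        by (rule C1(2)[OF y ab'(4,1)])
      also have "\<dots> \<le> C1 * ((2 * x powr (1/2 + \<delta>)) * (2 * x powr (3 * \<epsilon>1)) * x powr (\<beta> * (1/2 - real r)))"
      proof (intro mult_left_mono mult_mono)
        have "b powr (1/2 + \<delta>) \<le> (2 * x) powr (1/2 + \<delta>)" using ab' small by (intro powr_mono2) auto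
        also have "\<dots> = 2 powr (1/2 + \<delta>) * x powr (1/2 + \<delta>)" using x by (simp add: powr_mult)
        also have "\<dots> \<le> 2 powr 1 * x powr (1/2 + \<delta>)" using small by (intro mult_right_mono powr_mono) auto
        finally show "b powr (1/2 + \<delta>) \<le> 2 * x powr (1/2 + \<delta>)" by simp
        \<comment> \<open>Dividing by the length of the interval costs at most a factor 2 x, which
          occurs only to the power 3 \<epsilon>1.\<close>
        have "h \<ge> 1" using ge_one_powr_ge_zero[of x \<alpha>] x ids by (simp add: h_def)
        hence "b / (b - a) \<le> (2 * x) / 1" using ab' ab by (intro frac_le) (auto simp: h_def)
        hence "(b / (b - a)) powr (3 * \<epsilon>1) \<le> (2 * x) powr (3 * \<epsilon>1)" using ab' small by (intro powr_mono2) auto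
        also have "\<dots> = 2 powr (3 * \<epsilon>1) * x powr (3 * \<epsilon>1)" using x by (simp add: powr_mult)
        also have "\<dots> \<le> 2 powr 1 * x powr (3 * \<epsilon>1)" using small by (intro mult_right_mono powr_mono) auto
        finally show "(b / (b - a)) powr (3 * \<epsilon>1) \<le> 2 * x powr (3 * \<epsilon>1)" by simp
        show "y powr (1/2 - real r) \<le> x powr (\<beta> * (1/2 - real r))" by (simp add: y_def powr_powr)
      qed (use C1 in auto)
      also have "\<dots> = 4 * C1 * x powr ((1/2 + \<delta>) + 3 * \<epsilon>1 + \<beta> * (1/2 - real r))"
        by (simp only: powr_add)
      also have "\<dots> \<le> 4 * C1 * Y"
        using C1 small ids(6) by (intro mult_left_mono le_Y) auto
      finally show ?thesis .
    qed
    have r1: "r \<ge> 1" using r by simp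
    have "riesz_slope (tau_real r) a b =
       riesz_slope (head_coeff r K y) a b + riesz_slope (tail_coeff r K y) a b"
      unfolding riesz_tau_split[OF r1, of _ K y] by (simp add: add_divide_distrib diff_divide_distrib)
    hence "\<bar>riesz_slope (tau_real r) a b - main x\<bar> \<le> E * Y + 4 * C1 * Y"
      using 1 2 by linarith
    thus ?thesis by (simp add: Y_def distrib_right)
  qed
  have "\<forall>\<^sub>F x in at_top. norm (err r x) \<le> (E + 4 * C1) * norm (x powr (\<alpha> + \<epsilon>))"
  proof -
    have "0 < 1 - 2 * real r * \<beta>" using ids(4) by simp
    hence ev: "\<forall>\<^sub>F x in at_top. z0 \<le> x powr (1 - 2 * real r * \<beta>) / 2" by real_asymp
    have ev2: "\<forall>\<^sub>F x in at_top. x powr \<alpha> \<le> x / 2" using ids(2) by real_asymp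
    show ?thesis
      using ev ev2 eventually_ge_at_top[of 2]
    proof eventually_elim
      case (elim x)
      let ?c = "tau_real r"
      have h: "x powr \<alpha> > 0" using elim by simp
      have e: "err r x = summatory ?c x - main x"
        by (simp add: err_def summatory_def main_def A1_def A2_def)
      \<comment> \<open>The average to the right of x lies above the value at x, the average to the
        left below it.\<close>
      have up: "summatory ?c x \<le> riesz_slope ?c x (x + x powr \<alpha>)"
        using summatory_riesz_sandwich(1)[of ?c x "x + x powr \<alpha>"] h by (simp add: le_divide_eq)
      have lo: "summatory ?c x \<ge> riesz_slope ?c (x - x powr \<alpha>) x"
        using summatory_riesz_sandwich(2)[of ?c "x - x powr \<alpha>" x] h by (simp add: divide_le_eq)
      have m1: "\<bar>riesz_slope ?c x (x + x powr \<alpha>) - main x\<bar> \<le> (E + 4 * C1) * x powr (\<alpha> + \<epsilon>)"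
        by (rule mean) (use elim h in auto)
      have m2: "\<bar>riesz_slope ?c (x - x powr \<alpha>) x - main x\<bar> \<le> (E + 4 * C1) * x powr (\<alpha> + \<epsilon>)"
        by (rule mean) (use elim h in auto)
      have "\<bar>err r x\<bar> \<le> (E + 4 * C1) * x powr (\<alpha> + \<epsilon>)" unfolding e using up lo m1 m2 by linarith
      thus ?case by simp
    qed
  qed
  thus "(\<lambda>x. err r x) \<in> O[at_top](\<lambda>x. x powr ((1 - \<theta>) / (2 * real r + 1 - 4 * real r * \<theta>) + \<epsilon>))"
    unfolding \<alpha>_def by (rule bigoI)
qed

end
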